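(* Let $N$, $H$, $G=N\rtimes H$ and $\Omega_\nu$, $\Lambda_\nu$, $\{i_{s_1},\dots,i_{s_r}\}$, $\mathfrak{k}$, $\mathfrak{a}$ be as in the context, so that $\mathfrak{g}=\mathfrak{n}\times\mathfrak{k}\times\mathfrak{a}$ with $\mathfrak{h}=\mathfrak{k}\times\mathfrak{a}$. The cross-section for the coadjoint $G$-orbits in $\Omega_\nu$ is $$\Sigma=\{l\in\Omega_\nu: l=(f,k,0),\ f\in\Sigma^\circ,\ k\in\mathfrak{k}^*\}.$$ Letting $\pi:\mathfrak{g}^*\to\mathfrak{n}^*$ be the projection (restriction) map, $$\pi(\Sigma)=\Sigma^\circ=\{l\in\Lambda_\nu:|l(Z_j)|=1\ \ \forall j\in\{i_{s_1},\dots,i_{s_r}\}\}.$$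
   Context: Setting. $N$ is a simply connected, connected, non-commutative nilpotent Lie group with Lie algebra $\mathfrak{n}$, $n=\dim\mathfrak{n}$. $H$ is a subgroup of $\mathrm{Aut}(N)$ which is a commutative, simply connected, connected Lie group with Lie algebra $\mathfrak{h}$, $p=\dim\mathfrak{h}$. $\mathfrak{h}$ acts diagonalizably on $\mathfrak{n}_{\mathbb{C}}$ with weights $\gamma_j(A)=\lambda_j(A)(1+i\alpha_j)$, $\lambda_j\in\mathfrak{h}^*$ real-valued, $\alpha_j\in\mathbb{R}$. $G=N\rtimes H$ is exponential solvable with Lie algebra $\mathfrak{g}=\mathfrak{n}\oplus\mathfrak{h}$. Linear functionals are extended complex-linearly to complexifications. $G$ acts on $\mathfrak{g}^*$ (and on $\mathfrak{n}^*$) by $g\cdot l(X)=l(\mathrm{Ad}_{g^{-1}}X)$. Basis and jump indices. Fix an adaptable basis $Z_1,\dots,Z_n$ of $\mathfrak{n}_{\mathbb{C}}$: each $\mathfrak{c}_j=\mathbb{C}\text{-span}\{Z_1,\dots,Z_j\}$ is an ideal of $\mathfrak{g}_{\mathbb{C}}$; if $\mathfrak{c}_j\ne\overline{\mathfrak{c}_j}$ then $\mathfrak{c}_{j+1}=\overline{\mathfrak{c}_{j+1}}$ and $Z_{j+1}=\overline{Z_j}$; if $\mathfrak{c}_j=\overline{\mathfrak{c}_j}$ and $\mathfrak{c}_{j-1}=\overline{\mathfrak{c}_{j-1}}$ then $Z_j$ is real; $[A,Z_j]=\gamma_j(A)Z_j$ for $A\in\mathfrak{h}$. It is completed to a basis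 of $\mathfrak{g}_{\mathbb{C}}$ by a basis $Z_{n+1}=A_p,\dots,Z_{n+p}=A_1$ of $\mathfrak{h}$. For $\mathfrak{s}\in\{\mathfrak{n},\mathfrak{g}\}$ and $l\in\mathfrak{s}^*$, put $\mathfrak{w}^l=\{Z\in\mathfrak{s}_{\mathbb{C}}:l([\mathfrak{w},Z])=0\}$ for $\mathfrak{w}\subset\mathfrak{s}_{\mathbb{C}}$, $\mathfrak{q}_0(l)=\mathfrak{s}_{\mathbb{C}}$, and for $k\ge1$, as long as $\mathfrak{q}_{k-1}(l)\not\subset\mathfrak{q}_{k-1}(l)^l$: $i_k(l)=\min\{j:\mathfrak{c}_j\cap\mathfrak{q}_{k-1}(l)\not\subset\mathfrak{q}_{k-1}(l)^l\}$, $\mathfrak{q}_k(l)=(\mathfrak{q}_{k-1}(l)\cap\mathfrak{c}_{i_k})^l\cap\mathfrak{q}_{k-1}(l)$, $j_k(l)=\min\{j:\mathfrak{c}_j\cap\mathfrak{q}_{k-1}(l)\not\subset\mathfrak{q}_k(l)\}$. Then $\mathbf{i}(l)=\{i_k(l)\}$, $\mathbf{j}(l)=\{j_k(l)\}$, $\mathbf{e}(l)=\mathbf{i}(l)\cup\mathbf{j}(l)$. Cross-section for $N$. For $\mathfrak{s}=\mathfrak{n}$ let $\mathbf{e}^\circ,\mathbf{j}^\circ$ be the generic values, and $\Omega_{\mathbf{e}^\circ,\mathbf{j}^\circ}\subset\mathfrak{n}^*$ the dense open layer where $\mathbf{e}(f)=\mathbf{e}^\circ$, $\mathbf{j}(f)=\mathbf{j}^\circ$.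 For $1\le j\le n$ let $j'$ be the largest index $<j$ with $\mathfrak{c}_{j'}=\overline{\mathfrak{c}_{j'}}$ ($\mathfrak{c}_0=0$). The $H$-invariant cross-section for the $N$-coadjoint orbits in $\Omega_{\mathbf{e}^\circ,\mathbf{j}^\circ}$ is $\Lambda=\{f\in\Omega_{\mathbf{e}^\circ,\mathbf{j}^\circ}:\mathrm{Re}(\overline{f(Z_j)}\,f([X,Z_j]))=0$ for all $j\in\mathbf{e}^\circ$ and all $X\in\mathfrak{n}$ with $f([X,\mathfrak{c}_{j'}])=0\}$. Put $\nu=\{1,\dots,n\}\setminus\mathbf{e}^\circ$ and $\Lambda_\nu=\{f\in\Lambda:f(Z_j)\ne0\ \forall j\in\nu\}$. Let $\lambda:\Omega_{\mathbf{e}^\circ,\mathbf{j}^\circ}\to\Lambda$ send $f$ to the point of $\Lambda\cap N\cdot f$, and $\Omega_\nu=\pi^{-1}(\lambda^{-1}(\Lambda_\nu))\subset\mathfrak{g}^*$. Normalization of the basis of $\mathfrak{h}$. For $l\in\Omega_\nu$ the jump sets (for $\mathfrak{s}=\mathfrak{g}$) are constant and $\mathbf{e}(l)=\mathbf{e}^\circ\,\dot\cup\,\{i_{s_1},\dots,i_{s_r}\}\,\dot\cup\,\{j_{s_1},\dots,j_{s_r}\}$ with $\{i_{s_1},\dots,i_{s_r}\}=\mathbf{i}(l)\setminus\mathbf{e}^\circ$. The basis of $\mathfrak{h}$ is ordered and chosen so that $A_t=Z_{j_{s_t}}$ for $1\le t\le r$, with $\mathrm{Re}\,\gamma_{i_{s_t}}(A_t)=1$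 and $\gamma_{i_{s_t}}(A_{t'})=0$ for $t\neq t'$ in $\{1,\dots,r\}$. $\mathfrak{k}=\bigcap_{j\in\nu}\ker\gamma_j$ is the Lie algebra of the stabilizer in $H$ of any element of $\Lambda_\nu$; it is spanned by $A_{r+1},\dots,A_p$, and $\mathfrak{a}$ is spanned by $A_1,\dots,A_r$. Elements of $\mathfrak{g}^*$ are written $(f,k,a)\in\mathfrak{n}^*\times\mathfrak{k}^*\times\mathfrak{a}^*$. *)

theory Defs
  imports "HOL-Analysis.Analysis" "HOL-Algebra.Bij"
begin

section \<open>Lie groups in a global chart\<close>

text \<open>\<open>C\<^sup>\<infinity>\<close> maps: all iterated directional derivatives are Frechet differentiable everywhere.
  On finite-dimensional spaces this is the usual notion.\<close>

coinductive smooth :: "('a::real_normed_vector \<Rightarrow> 'b::real_normed_vector) \<Rightarrow> bool" where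
  "\<lbrakk>\<And>x. (f has_derivative f' x) (at x); \<And>v. smooth (\<lambda>x. f' x v)\<rbrakk> \<Longrightarrow> smooth f"

text \<open>A Lie group whose underlying manifold is a vector space, with identity \<open>0\<close>. The vector space
  is then also the tangent space at the identity, i.e. the Lie algebra.\<close>

definition vector_lie_group :: "'a::real_normed_vector monoid \<Rightarrow> bool" where
  "vector_lie_group G \<longleftrightarrow>
     group G \<and> carrier G = UNIV \<and> \<one>\<^bsub>G\<^esub> = 0 \<and>
     smooth (\<lambda>(x, y). x \<otimes>\<^bsub>G\<^esub> y) \<and> smooth (\<lambda>x. inv\<^bsub>G\<^esub> x)"

text \<open>The chart is the exponential map: straight lines through \<open>0\<close> are one-parameter subgroups.
  A connected, simply connected nilpotent Lie group is always of this form, because its exponential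
  map is a diffeomorphism from the Lie algebra onto the group.\<close>

definition exponential_coordinates :: "'a::real_normed_vector monoid \<Rightarrow> bool" where
  "exponential_coordinates G \<longleftrightarrow> (\<forall>X s t. (s *\<^sub>R X) \<otimes>\<^bsub>G\<^esub> (t *\<^sub>R X) = (s + t) *\<^sub>R X)"

definition Ad :: "'a::real_normed_vector monoid \<Rightarrow> 'a \<Rightarrow> 'a \<Rightarrow> 'a" where
  "Ad G g X = vector_derivative (\<lambda>t. g \<otimes>\<^bsub>G\<^esub> (t *\<^sub>R X) \<otimes>\<^bsub>G\<^esub> inv\<^bsub>G\<^esub> g) (at 0)"

definition lie :: "'a::real_normed_vector monoid \<Rightarrow> 'a \<Rightarrow> 'a \<Rightarrow> 'a" where
  "lie G X Y = vector_derivative (\<lambda>t. Ad G (t *\<^sub>R X) Y) (at 0)"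

definition coad :: "'a::real_normed_vector monoid \<Rightarrow> 'a \<Rightarrow> ('a \<Rightarrow>\<^sub>L real) \<Rightarrow> ('a \<Rightarrow>\<^sub>L real)" where
  "coad G g l = Blinfun (\<lambda>X. blinfun_apply l (Ad G (inv\<^bsub>G\<^esub> g) X))"

definition coad_orbit :: "'a::real_normed_vector monoid \<Rightarrow> ('a \<Rightarrow>\<^sub>L real) \<Rightarrow> ('a \<Rightarrow>\<^sub>L real) set" where
  "coad_orbit G l = (\<lambda>g. coad G g l) ` carrier G"

definition orbit_cross_section :: "('a \<Rightarrow> 'a set) \<Rightarrow> 'a set \<Rightarrow> 'a set \<Rightarrow> bool" where
  "orbit_cross_section orb X S \<longleftrightarrow> S \<subseteq> X \<and> (\<forall>x\<in>X. \<exists>!s. s \<in> S \<and> s \<in> orb x)"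

primrec lower_central :: "('a::real_vector \<Rightarrow> 'a \<Rightarrow> 'a) \<Rightarrow> nat \<Rightarrow> 'a set" where
  "lower_central br 0 = UNIV"
| "lower_central br (Suc k) = span {br X Y | X Y. Y \<in> lower_central br k}"

definition nilpotent :: "('a::real_vector \<Rightarrow> 'a \<Rightarrow> 'a) \<Rightarrow> bool" where
  "nilpotent br \<longleftrightarrow> (\<exists>k. lower_central br k = {0})"

text \<open>\<open>\<eta>\<close> parametrises a commutative Lie group \<open>H\<close> of automorphisms of \<open>N\<close>, namely its image: it is
  the exponential map \<open>\<hh> \<rightarrow> H\<close>, which is an isomorphism from the additive group of \<open>\<hh>\<close> as
  \<open>H\<close> is commutative, connected and simply connected.\<close>

definition automorphism_vector_group ::
    "'n::real_normed_vector monoid \<Rightarrow> ('h::real_normed_vector \<Rightarrow> 'n \<Rightarrow> 'n) \<Rightarrow> bool" where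
  "automorphism_vector_group N \<eta> \<longleftrightarrow>
     \<eta> \<in> hom \<lparr>carrier = UNIV, mult = (+), one = 0\<rparr> (AutoGroup N) \<and> inj \<eta> \<and>
     smooth (\<lambda>(A, X). \<eta> A X)"

text \<open>\<open>N \<rtimes> H\<close>, with \<open>(X, A)\<close> standing for \<open>exp X exp A\<close>.\<close>

definition semidirect ::
    "'n::real_normed_vector monoid \<Rightarrow> ('h::real_normed_vector \<Rightarrow> 'n \<Rightarrow> 'n) \<Rightarrow> ('n \<times> 'h) monoid" where
  "semidirect N \<eta> =
     \<lparr>carrier = UNIV, mult = (\<lambda>(X, A) (Y, B). (X \<otimes>\<^bsub>N\<^esub> \<eta> A Y, A + B)), one = (0, 0)\<rparr>"


section \<open>Complexification\<close>

text \<open>The complexification of \<open>'a\<close> is \<open>'a \<times> 'a\<close>, with \<open>(X, Y)\<close> standing for \<open>X + iY\<close>.\<close>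

definition cscale :: "complex \<Rightarrow> 'a::real_vector \<times> 'a \<Rightarrow> 'a \<times> 'a" where
  "cscale c V = (Re c *\<^sub>R fst V - Im c *\<^sub>R snd V, Re c *\<^sub>R snd V + Im c *\<^sub>R fst V)"

interpretation cplx: vector_space cscale
  by standard (auto simp: cscale_def algebra_simps)

definition cconj :: "'a::real_vector \<times> 'a \<Rightarrow> 'a \<times> 'a" where
  "cconj V = (fst V, - snd V)"

definition of_re :: "'a::real_vector \<Rightarrow> 'a \<times> 'a" where
  "of_re X = (X, 0)"

definition cbracket :: "('a::real_vector \<Rightarrow> 'a \<Rightarrow> 'a) \<Rightarrow> 'a \<times> 'a \<Rightarrow> 'a \<times> 'a \<Rightarrow> 'a \<times> 'a" where
  "cbracket br V W =
     (br (fst V) (fst W) - br (snd V) (snd W), br (fst V) (snd W) + br (snd V) (fst W))"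

definition capply :: "('a::real_normed_vector \<Rightarrow>\<^sub>L real) \<Rightarrow> 'a \<times> 'a \<Rightarrow> complex" where
  "capply l V = Complex (blinfun_apply l (fst V)) (blinfun_apply l (snd V))"

definition flag :: "(nat \<Rightarrow> 'a::real_vector \<times> 'a) \<Rightarrow> nat \<Rightarrow> ('a \<times> 'a) set" where
  "flag Z j = cplx.span (Z ` {1..j})"


section \<open>Jump indices\<close>

definition perp ::
    "('a::real_normed_vector \<Rightarrow> 'a \<Rightarrow> 'a) \<Rightarrow> ('a \<Rightarrow>\<^sub>L real) \<Rightarrow> ('a \<times> 'a) set \<Rightarrow> ('a \<times> 'a) set" where
  "perp br l W = {V. \<forall>U\<in>W. capply l (cbracket br U V) = 0}"

text \<open>Once \<open>\<qq>\<^sub>k\<close> is isotropic, the sequence is continued constantly.\<close>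

primrec jump_q ::
    "('a::real_normed_vector \<Rightarrow> 'a \<Rightarrow> 'a) \<Rightarrow> (nat \<Rightarrow> 'a \<times> 'a) \<Rightarrow> ('a \<Rightarrow>\<^sub>L real) \<Rightarrow> nat \<Rightarrow> ('a \<times> 'a) set"
where
  "jump_q br Z l 0 = UNIV"
| "jump_q br Z l (Suc k) =
     (let q = jump_q br Z l k; i = (LEAST j. \<not> flag Z j \<inter> q \<subseteq> perp br l q)
      in if q \<subseteq> perp br l q then q else perp br l (q \<inter> flag Z i) \<inter> q)"

definition jump_steps ::
    "('a::real_normed_vector \<Rightarrow> 'a \<Rightarrow> 'a) \<Rightarrow> (nat \<Rightarrow> 'a \<times> 'a) \<Rightarrow> ('a \<Rightarrow>\<^sub>L real) \<Rightarrow> nat set" where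
  "jump_steps br Z l = {k. 1 \<le> k \<and> \<not> jump_q br Z l (k - 1) \<subseteq> perp br l (jump_q br Z l (k - 1))}"

definition jump_i ::
    "('a::real_normed_vector \<Rightarrow> 'a \<Rightarrow> 'a) \<Rightarrow> (nat \<Rightarrow> 'a \<times> 'a) \<Rightarrow> ('a \<Rightarrow>\<^sub>L real) \<Rightarrow> nat \<Rightarrow> nat" where
  "jump_i br Z l k =
     (LEAST j. \<not> flag Z j \<inter> jump_q br Z l (k - 1) \<subseteq> perp br l (jump_q br Z l (k - 1)))"

definition jump_j ::
    "('a::real_normed_vector \<Rightarrow> 'a \<Rightarrow> 'a) \<Rightarrow> (nat \<Rightarrow> 'a \<times> 'a) \<Rightarrow> ('a \<Rightarrow>\<^sub>L real) \<Rightarrow> nat \<Rightarrow> nat" where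
  "jump_j br Z l k = (LEAST j. \<not> flag Z j \<inter> jump_q br Z l (k - 1) \<subseteq> jump_q br Z l k)"

definition i_set ::
    "('a::real_normed_vector \<Rightarrow> 'a \<Rightarrow> 'a) \<Rightarrow> (nat \<Rightarrow> 'a \<times> 'a) \<Rightarrow> ('a \<Rightarrow>\<^sub>L real) \<Rightarrow> nat set" where
  "i_set br Z l = jump_i br Z l ` jump_steps br Z l"

definition j_set ::
    "('a::real_normed_vector \<Rightarrow> 'a \<Rightarrow> 'a) \<Rightarrow> (nat \<Rightarrow> 'a \<times> 'a) \<Rightarrow> ('a \<Rightarrow>\<^sub>L real) \<Rightarrow> nat set" where
  "j_set br Z l = jump_j br Z l ` jump_steps br Z l"

definition e_set ::
    "('a::real_normed_vector \<Rightarrow> 'a \<Rightarrow> 'a) \<Rightarrow> (nat \<Rightarrow> 'a \<times> 'a) \<Rightarrow> ('a \<Rightarrow>\<^sub>L real) \<Rightarrow> nat set" where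
  "e_set br Z l = i_set br Z l \<union> j_set br Z l"


section \<open>Adaptable bases\<close>

definition complexified_basis :: "(nat \<Rightarrow> 'n::euclidean_space \<times> 'n) \<Rightarrow> bool" where
  "complexified_basis Z \<longleftrightarrow>
     inj_on Z {1..DIM('n)} \<and> cplx.independent (Z ` {1..DIM('n)}) \<and>
     cplx.span (Z ` {1..DIM('n)}) = UNIV"

definition incl_n :: "'n::real_vector \<times> 'n \<Rightarrow> ('n \<times> 'h::real_vector) \<times> ('n \<times> 'h)" where
  "incl_n V = ((fst V, 0), (snd V, 0))"

text \<open>The basis \<open>Z\<^sub>1, \<dots>, Z\<^sub>n, A\<^sub>p, \<dots>, A\<^sub>1\<close> of the complexification of \<open>\<gg> = \<nn> \<oplus> \<hh>\<close>.\<close>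

definition full_basis ::
    "nat \<Rightarrow> (nat \<Rightarrow> 'n::euclidean_space \<times> 'n) \<Rightarrow> (nat \<Rightarrow> 'h::real_vector) \<Rightarrow>
     nat \<Rightarrow> ('n \<times> 'h) \<times> ('n \<times> 'h)" where
  "full_basis p Z A j =
     (if j \<le> DIM('n) then incl_n (Z j) else of_re (0, A (p + DIM('n) + 1 - j)))"

definition weight :: "(nat \<Rightarrow> 'h \<Rightarrow> real) \<Rightarrow> (nat \<Rightarrow> real) \<Rightarrow> nat \<Rightarrow> 'h \<Rightarrow> complex" where
  "weight lam \<alpha> j A = of_real (lam j A) * (1 + \<i> * of_real (\<alpha> j))"

definition adaptable ::
    "('n::euclidean_space \<times> 'h::real_normed_vector) monoid \<Rightarrow> (nat \<Rightarrow> 'n \<times> 'n) \<Rightarrow>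
     (nat \<Rightarrow> 'h \<Rightarrow> real) \<Rightarrow> (nat \<Rightarrow> real) \<Rightarrow> bool" where
  "adaptable G Z lam \<alpha> \<longleftrightarrow>
     complexified_basis Z \<and>
     (\<forall>j\<in>{1..DIM('n)}. \<forall>V. \<forall>W\<in>flag Z j. cbracket (lie G) V (incl_n W) \<in> incl_n ` flag Z j) \<and>
     (\<forall>j\<in>{1..DIM('n)}. flag Z j \<noteq> cconj ` flag Z j \<longrightarrow>
        flag Z (j + 1) = cconj ` flag Z (j + 1) \<and> Z (j + 1) = cconj (Z j)) \<and>
     (\<forall>j\<in>{1..DIM('n)}. flag Z j = cconj ` flag Z j \<and> flag Z (j - 1) = cconj ` flag Z (j - 1) \<longrightarrow>
        cconj (Z j) = Z j) \<and>
     (\<forall>j\<in>{1..DIM('n)}. linear (lam j)) \<and>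
     (\<forall>j\<in>{1..DIM('n)}. \<forall>A.
        cbracket (lie G) (of_re (0, A)) (incl_n (Z j)) = cscale (weight lam \<alpha> j A) (incl_n (Z j)))"

definition basis_of_h :: "nat \<Rightarrow> (nat \<Rightarrow> 'h::real_vector) \<Rightarrow> bool" where
  "basis_of_h p A \<longleftrightarrow>
     inj_on A {1..p} \<and> independent (A ` {1..p}) \<and> span (A ` {1..p}) = UNIV"


section \<open>The cross-section for \<open>N\<close>\<close>

definition Omega ::
    "'n::euclidean_space monoid \<Rightarrow> (nat \<Rightarrow> 'n \<times> 'n) \<Rightarrow> nat set \<Rightarrow> nat set \<Rightarrow> ('n \<Rightarrow>\<^sub>L real) set" where
  "Omega N Z e j = {f. e_set (lie N) Z f = e \<and> j_set (lie N) Z f = j}"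

text \<open>There is exactly one pair \<open>(e, j)\<close> whose layer is open and dense.\<close>

definition generic_jumps ::
    "'n::euclidean_space monoid \<Rightarrow> (nat \<Rightarrow> 'n \<times> 'n) \<Rightarrow> nat set \<Rightarrow> nat set \<Rightarrow> bool" where
  "generic_jumps N Z e j \<longleftrightarrow> open (Omega N Z e j) \<and> closure (Omega N Z e j) = UNIV"

definition prev_real :: "(nat \<Rightarrow> 'a::real_vector \<times> 'a) \<Rightarrow> nat \<Rightarrow> nat" where
  "prev_real Z j = (GREATEST i. i < j \<and> flag Z i = cconj ` flag Z i)"

definition Lambda ::
    "'n::euclidean_space monoid \<Rightarrow> (nat \<Rightarrow> 'n \<times> 'n) \<Rightarrow> nat set \<Rightarrow> nat set \<Rightarrow> ('n \<Rightarrow>\<^sub>L real) set" where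
  "Lambda N Z e j = {f \<in> Omega N Z e j. \<forall>m\<in>e. \<forall>X.
     (\<forall>V\<in>flag Z (prev_real Z m). capply f (cbracket (lie N) (of_re X) V) = 0) \<longrightarrow>
     Re (cnj (capply f (Z m)) * capply f (cbracket (lie N) (of_re X) (Z m))) = 0}"

definition nu :: "'n::euclidean_space itself \<Rightarrow> nat set \<Rightarrow> nat set" where
  "nu _ e = {1..DIM('n)} - e"

definition Lambda_nu ::
    "'n::euclidean_space monoid \<Rightarrow> (nat \<Rightarrow> 'n \<times> 'n) \<Rightarrow> nat set \<Rightarrow> nat set \<Rightarrow> ('n \<Rightarrow>\<^sub>L real) set" where
  "Lambda_nu N Z e j = {f \<in> Lambda N Z e j. \<forall>m\<in>nu TYPE('n) e. capply f (Z m) \<noteq> 0}"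

definition to_Lambda ::
    "'n::euclidean_space monoid \<Rightarrow> (nat \<Rightarrow> 'n \<times> 'n) \<Rightarrow> nat set \<Rightarrow> nat set \<Rightarrow>
     ('n \<Rightarrow>\<^sub>L real) \<Rightarrow> ('n \<Rightarrow>\<^sub>L real)" where
  "to_Lambda N Z e j f = (THE f'. f' \<in> Lambda N Z e j \<inter> coad_orbit N f)"

definition restrict_n ::
    "(('n::real_normed_vector \<times> 'h::real_normed_vector) \<Rightarrow>\<^sub>L real) \<Rightarrow> ('n \<Rightarrow>\<^sub>L real)" where
  "restrict_n l = Blinfun (\<lambda>X. blinfun_apply l (X, 0))"

definition Omega_nu ::
    "'n::euclidean_space monoid \<Rightarrow> (nat \<Rightarrow> 'n \<times> 'n) \<Rightarrow> nat set \<Rightarrow> nat set \<Rightarrow>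
     (('n \<times> 'h::real_normed_vector) \<Rightarrow>\<^sub>L real) set" where
  "Omega_nu N Z e j =
     {l. restrict_n l \<in> Omega N Z e j \<and> to_Lambda N Z e j (restrict_n l) \<in> Lambda_nu N Z e j}"


section \<open>The cross-section for \<open>G\<close>\<close>

text \<open>\<open>\<iota> t\<close> is the index \<open>i\<close> with subscript \<open>s\<^sub>t\<close>, which does not depend on the functional
  \<open>l\<close>.\<close>

definition normalized_basis ::
    "'n::euclidean_space monoid \<Rightarrow> ('h::real_normed_vector \<Rightarrow> 'n \<Rightarrow> 'n) \<Rightarrow> (nat \<Rightarrow> 'n \<times> 'n) \<Rightarrow>
     (nat \<Rightarrow> 'h \<Rightarrow> real) \<Rightarrow> (nat \<Rightarrow> real) \<Rightarrow> nat set \<Rightarrow> nat set \<Rightarrow>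
     nat \<Rightarrow> (nat \<Rightarrow> 'h) \<Rightarrow> nat \<Rightarrow> (nat \<Rightarrow> nat) \<Rightarrow> (nat \<Rightarrow> nat) \<Rightarrow> bool" where
  "normalized_basis N \<eta> Z lam \<alpha> e j p A r s \<iota> \<longleftrightarrow>
     (let br = lie (semidirect N \<eta>); Z' = full_basis p Z A in
       r \<le> p \<and>
       (\<forall>l\<in>Omega_nu N Z e j.
          i_set br Z' l - e = \<iota> ` {1..r} \<and>
          (\<forall>t\<in>{1..r}. s t \<in> jump_steps br Z' l \<and> jump_i br Z' l (s t) = \<iota> t \<and>
             Z' (jump_j br Z' l (s t)) = of_re (0, A t))) \<and>
       (\<forall>t\<in>{1..r}. Re (weight lam \<alpha> (\<iota> t) (A t)) = 1) \<and>
       (\<forall>t\<in>{1..r}. \<forall>t'\<in>{1..r}. t \<noteq> t' \<longrightarrow> weight lam \<alpha> (\<iota> t) (A t') = 0))"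

definition stabilizer_algebra ::
    "'n::euclidean_space itself \<Rightarrow> (nat \<Rightarrow> 'h \<Rightarrow> real) \<Rightarrow> (nat \<Rightarrow> real) \<Rightarrow> nat set \<Rightarrow> 'h set" where
  "stabilizer_algebra _ lam \<alpha> e = {B. \<forall>m\<in>nu TYPE('n) e. weight lam \<alpha> m B = 0}"

text \<open>\<open>l = (f, \<kappa>, a)\<close> in \<open>\<nn>\<^sup>* \<times> \<kk>\<^sup>* \<times> \<aa>\<^sup>*\<close>. Elements of \<open>\<kk>\<^sup>*\<close> and \<open>\<aa>\<^sup>*\<close> are
  represented by arbitrary extensions to \<open>\<hh>\<close>.\<close>

definition dual_coordinates ::
    "'h set \<Rightarrow> 'h set \<Rightarrow> (('n::real_normed_vector \<times> 'h::real_normed_vector) \<Rightarrow>\<^sub>L real) \<Rightarrow>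
     ('n \<Rightarrow>\<^sub>L real) \<Rightarrow> ('h \<Rightarrow>\<^sub>L real) \<Rightarrow> ('h \<Rightarrow>\<^sub>L real) \<Rightarrow> bool" where
  "dual_coordinates \<kk> \<aa> l f \<kappa> a \<longleftrightarrow>
     (\<forall>X. \<forall>K\<in>\<kk>. \<forall>B\<in>\<aa>. blinfun_apply l (X, K + B) =
        blinfun_apply f X + blinfun_apply \<kappa> K + blinfun_apply a B)"

definition Sigma_circ ::
    "'n::euclidean_space monoid \<Rightarrow> (nat \<Rightarrow> 'n \<times> 'n) \<Rightarrow> nat set \<Rightarrow> nat set \<Rightarrow>
     nat \<Rightarrow> (nat \<Rightarrow> nat) \<Rightarrow> ('n \<Rightarrow>\<^sub>L real) set" where
  "Sigma_circ N Z e j r \<iota> = {f \<in> Lambda_nu N Z e j. \<forall>m\<in>\<iota> ` {1..r}. cmod (capply f (Z m)) = 1}"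

definition Sigma_G ::
    "'n::euclidean_space monoid \<Rightarrow> (nat \<Rightarrow> 'n \<times> 'n) \<Rightarrow> (nat \<Rightarrow> 'h::real_normed_vector \<Rightarrow> real) \<Rightarrow>
     (nat \<Rightarrow> real) \<Rightarrow> nat set \<Rightarrow> nat set \<Rightarrow> (nat \<Rightarrow> 'h) \<Rightarrow> nat \<Rightarrow> (nat \<Rightarrow> nat) \<Rightarrow>
     (('n \<times> 'h) \<Rightarrow>\<^sub>L real) set" where
  "Sigma_G N Z lam \<alpha> e j A r \<iota> =
     {l \<in> Omega_nu N Z e j. \<exists>f\<in>Sigma_circ N Z e j r \<iota>. \<exists>\<kappa>.
        dual_coordinates (stabilizer_algebra TYPE('n) lam \<alpha> e) (span (A ` {1..r})) l f \<kappa> 0}"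

end

theory Submission
  imports Defs
begin

text \<open>
  In exponential coordinates automorphisms of \<open>N\<close> are linear, so that the adjoint action is given
  by \<open>Ad(exp X) = exp(ad X)\<close> on \<open>\<nn>\<close> and \<open>exp A\<close> acts on \<open>Z\<^sub>j\<close> as the scalar
  \<open>e\<close> to the power \<open>\<gamma>\<^sub>j(A)\<close>. An index is a jump index of \<open>l\<close> iff no element of
  the radical of \<open>l\<close> has it as leading index. If \<open>i\<close> is a real index of the flag and \<open>X\<close>
  annihilates \<open>f\<close> on \<open>\<cc>\<^sub>i\<close>, then \<open>exp X\<close> translates \<open>f(Z\<^sub>i\<^sub>+\<^sub>1)\<close> by
  \<open>f([X, Z\<^sub>i\<^sub>+\<^sub>1])\<close>, and the condition defining \<open>\<Lambda>\<close> says that \<open>f(Z\<^sub>i\<^sub>+\<^sub>1)\<close> is orthogonal to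
  all these translations; hence \<open>\<Lambda>\<close> meets each \<open>N\<close>-orbit once.

  For \<open>f \<in> \<Lambda>\<^sub>\<nu>\<close> the same argument on the Lie algebra level shows that \<open>B \<in> \<hh>\<close> is tangent to the
  \<open>N\<close>-orbit of \<open>f\<close> only
    if \<open>B \<in> \<kk>\<close>. Consequently the radical of \<open>f\<close> in \<open>\<nn>\<close>
  maps onto the annihilator of \<open>\<kk>\<close> in the dual of \<open>\<hh>\<close>, and a comparison of the
  jump sequences of \<open>\<nn>\<close> and \<open>\<gg>\<close> gives \<open>\<hh> = \<kk> \<oplus> \<aa>\<close>. So an orbit in \<open>\<Omega>\<^sub>\<nu>\<close> is
  normalised by moving its projection into \<open>\<Lambda>\<^sub>\<nu>\<close> with \<open>N\<close>, scaling the values at the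
  indices \<open>\<iota> t\<close> to modulus \<open>1\<close> with \<open>exp \<aa>\<close>, and killing the \<open>\<aa>\<close>-component with the
  stabilizer of \<open>f\<close> in \<open>N\<close>; no freedom is left except elements acting trivially.
\<close>

section \<open>Jump indices of a skew form\<close>

text \<open>The vectors \<open>A t\<close> are tied to the indices \<open>\<iota> t\<close> only
  through the recursion for \<gg>, whereas the orbit argument needs \<hh> = \<kk> \<oplus> \<aa>.
  The bridge is the position of a single \<open>A q\<close> in the flag, at a functional over a
  point of \<open>Lambda_nu\<close>. If this position is not a jump index, the radical contains a
  vector whose \<hh>-component is \<open>A q\<close> plus a combination of \<open>A (q + 1)\<close>,
  ..., \<open>A p\<close>; that component is tangent to the N-orbit, hence lies in \<kk>. If it is a
  jump index, it is a j-index, because all i-indices of \<gg> are at most n. The i-index of that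
  step cannot be a jump index of \<nn>, so it is some \<open>\<iota> t\<close>, and as i-indices
  increase strictly the step is \<open>s t\<close>, whence \<open>A q = A t\<close>. Downward
  induction on q gives the sum. It is direct because the functionals \<open>lam (\<iota> t)\<close>
  vanish on \<kk> and are dual to the \<open>A t\<close>. The factor 1 + i\<alpha> in the weights
  makes Re \<gamma>(B) = 0 force \<gamma>(B) = 0, so that moduli of values f(Z) see the whole
  weight.\<close>

lemma capply_add: "capply l (U + V) = capply l U + capply l V"
  by (simp add: capply_def complex_eq_iff blinfun.add_right)

lemma capply_diff: "capply l (U - V) = capply l U - capply l V"
  by (simp add: capply_def complex_eq_iff blinfun.diff_right)

lemma capply_minus: "capply l (- U) = - capply l U"
  by (simp add: capply_def complex_eq_iff blinfun.minus_right)

lemma capply_zero [simp]: "capply l 0 = 0"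
  by (simp add: capply_def complex_eq_iff blinfun.zero_right)

lemma capply_cscale: "capply l (cscale c U) = c * capply l U"
  by (simp add: capply_def cscale_def complex_eq_iff blinfun.add_right blinfun.diff_right
      blinfun.scaleR_right)

lemma capply_cconj: "capply l (cconj U) = cnj (capply l U)"
  by (simp add: capply_def cconj_def complex_eq_iff blinfun.minus_right)

lemma subspace_flag: "cplx.subspace (flag Z j)"
  by (simp add: flag_def)

lemmas flag_diff = cplx.subspace_diff[OF subspace_flag]
  and flag_add = cplx.subspace_add[OF subspace_flag]
  and flag_scale = cplx.subspace_scale[OF subspace_flag]
  and flag_zero = cplx.subspace_0[OF subspace_flag]

lemma flag_mono: "i \<le> j \<Longrightarrow> flag Z i \<subseteq> flag Z j"
  unfolding flag_def by (intro cplx.span_mono image_mono) auto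

lemma flag_0 [simp]: "flag Z 0 = {0}"
  by (simp add: flag_def)

lemma flag_Suc: "V \<in> flag Z (Suc m) \<longleftrightarrow> (\<exists>c. V - cscale c (Z (Suc m)) \<in> flag Z m)"
proof -
  have "{1..Suc m} = insert (Suc m) {1..m}" by auto
  then show ?thesis by (simp add: flag_def cplx.span_breakdown_eq)
qed

lemma basis_in_flag: "1 \<le> m \<Longrightarrow> m \<le> j \<Longrightarrow> Z m \<in> flag Z j"
  unfolding flag_def by (intro cplx.span_base) auto

lemma flag_leadingE:
  assumes "V \<in> flag Z m" "V \<notin> flag Z (m - 1)" "1 \<le> m"
  obtains c where "c \<noteq> 0" "V - cscale c (Z m) \<in> flag Z (m - 1)"
proof -
  obtain k where k: "m = Suc k" using assms(3) by (cases m) auto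
  then obtain c where c: "V - cscale c (Z m) \<in> flag Z k" using assms(1) flag_Suc by blast
  moreover have "c \<noteq> 0" using c assms(2) k by auto
  ultimately show ?thesis using that k by auto
qed

definition form_radical :: "('a::real_normed_vector \<Rightarrow> 'a \<Rightarrow> 'a) \<Rightarrow> ('a \<Rightarrow>\<^sub>L real) \<Rightarrow> ('a \<times> 'a) set" where
  "form_radical br l = perp br l UNIV"

definition has_lead :: "(nat \<Rightarrow> 'a::real_vector \<times> 'a) \<Rightarrow> nat \<Rightarrow> ('a \<times> 'a) set \<Rightarrow> bool" where
  "has_lead Z m W \<longleftrightarrow> (\<exists>V\<in>W. V - Z m \<in> flag Z (m - 1))"

declare jump_q.simps(2) [simp del]

text \<open>Both algebras are instances: \<open>lie N\<close> with a flag of length n, and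
  \<open>lie G\<close> with a flag of length n + p. What the recursion uses is that l([U, V]) is a
  complex bilinear skew form.\<close>

locale jump_form =
  fixes br :: "'a::real_normed_vector \<Rightarrow> 'a \<Rightarrow> 'a"
    and Z :: "nat \<Rightarrow> 'a \<times> 'a" and l :: "'a \<Rightarrow>\<^sub>L real" and M :: nat
  assumes bilin: "bilinear br" and skew: "br X Y = - br Y X" and flag_UNIV: "flag Z M = UNIV"
begin

abbreviation "form U V \<equiv> capply l (cbracket br U V)"
abbreviation "q k \<equiv> jump_q br Z l k"

lemmas br_simps = bilinear_ladd[OF bilin] bilinear_radd[OF bilin] bilinear_lsub[OF bilin]
  bilinear_rsub[OF bilin] bilinear_lmul[OF bilin] bilinear_rmul[OF bilin]

lemma form_add_right: "form U (V + W) = form U V + form U W"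
  by (simp add: cbracket_def br_simps capply_add[symmetric] algebra_simps)

lemma form_diff_right: "form U (V - W) = form U V - form U W"
  by (simp add: cbracket_def br_simps capply_diff[symmetric] algebra_simps)

lemma form_cscale_right: "form U (cscale c V) = c * form U V"
  unfolding capply_cscale[symmetric]
  by (simp add: cbracket_def cscale_def br_simps algebra_simps)

lemma form_skew: "form U V = - form V U"
  using skew[of "fst U" "fst V"] skew[of "snd U" "snd V"] skew[of "fst U" "snd V"]
    skew[of "snd U" "fst V"]
  by (simp add: cbracket_def capply_def complex_eq_iff blinfun.minus_right blinfun.add_right
      blinfun.diff_right)

lemma form_diff_left: "form (U - V) W = form U W - form V W"
  using form_diff_right[of W U V] form_skew[of "U - V" W] form_skew[of U W] form_skew[of V W]
  by simp

lemma form_cscale_left: "form (cscale c U) W = c * form U W"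
  using form_cscale_right[of W c U] form_skew[of "cscale c U" W] form_skew[of U W] by simp

lemma form_zero_right: "form U 0 = 0"
  by (simp add: cbracket_def bilinear_rzero[OF bilin] flip: zero_prod_def)

lemma subspace_perp: "cplx.subspace (perp br l W)"
  by (rule cplx.subspaceI)
    (simp_all add: perp_def form_zero_right form_add_right form_cscale_right)

lemma subspace_q: "cplx.subspace (q k)"
  by (induction k) (auto simp: jump_q.simps(2) Let_def intro!: cplx.subspace_inter subspace_perp)

lemmas q_diff = cplx.subspace_diff[OF subspace_q]
  and q_scale = cplx.subspace_scale[OF subspace_q]
  and perp_scale = cplx.subspace_scale[OF subspace_perp]

lemma perp_iff: "V \<in> perp br l W \<longleftrightarrow> (\<forall>U\<in>W. form U V = 0)"
  by (simp add: perp_def)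

lemma form_radical_iff: "V \<in> form_radical br l \<longleftrightarrow> (\<forall>U. form U V = 0)"
  by (simp add: form_radical_def perp_def)

lemma q_Suc_subset: "q (Suc k) \<subseteq> q k"
  by (auto simp: jump_q.simps(2) Let_def)

lemma form_radical_subset_q: "form_radical br l \<subseteq> q k"
  by (induction k) (auto simp: jump_q.simps(2) Let_def form_radical_def perp_def)

definition "step k \<longleftrightarrow> \<not> q k \<subseteq> perp br l (q k)"

lemma jump_steps_iff: "k \<in> jump_steps br Z l \<longleftrightarrow> (\<exists>i. k = Suc i \<and> step i)"
  by (cases k) (auto simp: jump_steps_def step_def)

lemma q_stationary: "\<not> step k \<Longrightarrow> q (Suc k) = q k"
  by (simp add: step_def jump_q.simps(2) Let_def)

lemma step_down: "step k \<Longrightarrow> i \<le> k \<Longrightarrow> step i"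
proof (induction k)
  case (Suc k)
  have "step k" using Suc.prems(1) q_stationary[of k] by (auto simp: step_def)
  then show ?case using Suc by (cases "i = Suc k") auto
qed simp

text \<open>The part of \<open>q k\<close> in the flag member before \<open>i\<close> is orthogonal
  to \<open>q k\<close>, and \<open>U\<close> spans \<open>flag Z i \<inter> q k\<close> modulo it.
  Hence passing to \<open>q (Suc k)\<close> imposes one linear equation, orthogonality to
  \<open>U\<close>.\<close>

lemma pivot_i:
  assumes "step k"
  defines "i \<equiv> jump_i br Z l (Suc k)"
  obtains U where "U \<in> flag Z i" "U \<in> q k" "U \<notin> perp br l (q k)" "U \<notin> flag Z (i - 1)"
    "\<And>V. V \<in> q (Suc k) \<longleftrightarrow> V \<in> q k \<and> form U V = 0" "1 \<le> i" "i \<le> M"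
    "flag Z (i - 1) \<inter> q k \<subseteq> perp br l (q k)"
proof -
  let ?P = "\<lambda>j. \<not> flag Z j \<inter> q k \<subseteq> perp br l (q k)"
  have i: "i = (LEAST j. ?P j)" by (simp add: i_def jump_i_def)
  have PM: "?P M" using assms(1) by (simp add: step_def flag_UNIV)
  have Pi: "?P i" unfolding i using PM by (rule LeastI)
  have "i \<le> M" unfolding i using PM by (rule Least_le)
  obtain U where U: "U \<in> flag Z i" "U \<in> q k" "U \<notin> perp br l (q k)" using Pi by blast
  have "i \<noteq> 0" using U cplx.subspace_0[OF subspace_perp] by (metis flag_0 singletonD)
  then have less: "i - 1 < i" by simp
  have low: "flag Z (i - 1) \<inter> q k \<subseteq> perp br l (q k)"
    using not_less_Least[OF less[unfolded i], folded i] by simp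
  have Un: "U \<notin> flag Z (i - 1)" using U low by blast
  have "q (Suc k) = perp br l (q k \<inter> flag Z i) \<inter> q k"
    using assms(1) by (simp add: step_def jump_q.simps(2) Let_def i)
  also have "\<dots> = {V \<in> q k. form U V = 0}"
  proof (intro equalityI subsetI)
    fix V assume V: "V \<in> {V \<in> q k. form U V = 0}"
    have "form W V = 0" if W: "W \<in> q k" "W \<in> flag Z i" for W
    proof -
      obtain c where c: "c \<noteq> 0" "U - cscale c (Z i) \<in> flag Z (i - 1)"
        using flag_leadingE[OF U(1) Un] \<open>i \<noteq> 0\<close> by auto
      obtain d where d: "W - cscale d (Z i) \<in> flag Z (i - 1)"
        using W(2) flag_Suc[of W Z "i - 1"] \<open>i \<noteq> 0\<close> by auto
      \<comment> \<open>The multiple \<open>d / c\<close> cancels the coefficients of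
        \<open>Z i\<close>, so the difference falls into the previous flag member.\<close>
      have "(W - cscale d (Z i)) - cscale (d / c) (U - cscale c (Z i)) \<in> flag Z (i - 1)"
        using c d by (metis flag_diff flag_scale)
      moreover have "(W - cscale d (Z i)) - cscale (d / c) (U - cscale c (Z i)) = W - cscale (d / c) U"
        using c(1) by (simp add: cplx.scale_right_diff_distrib)
      ultimately have "W - cscale (d / c) U \<in> perp br l (q k)"
        using low W(1) U(2) q_diff q_scale by (metis IntI subsetD)
      then have "form V (W - cscale (d / c) U) = 0" using V by (auto simp: perp_iff)
      then show ?thesis using V form_skew[of V] by (simp add: form_diff_right form_cscale_right)
    qed
    then show "V \<in> perp br l (q k \<inter> flag Z i) \<inter> q k" using V by (auto simp: perp_iff)
  qed (use U in \<open>auto simp: perp_iff\<close>)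
  finally show ?thesis using that U Un \<open>i \<noteq> 0\<close> \<open>i \<le> M\<close> low by auto
qed

text \<open>The pivot \<open>U\<close> of the step is not orthogonal to all of \<open>q k\<close>,
  so \<open>q (Suc k)\<close> is strictly smaller and the minimum defining \<open>jump_j\<close>
  exists. Together with \<open>pivot_i\<close>, the \<open>V\<close> obtained satisfies
  \<open>form U V \<noteq> 0\<close>.\<close>

lemma pivot_j:
  assumes "step k"
  defines "j \<equiv> jump_j br Z l (Suc k)"
  obtains V where "V \<in> flag Z j" "V \<in> q k" "V \<notin> q (Suc k)" "V \<notin> flag Z (j - 1)"
    "1 \<le> j" "j \<le> M" "flag Z (j - 1) \<inter> q k \<subseteq> q (Suc k)"
proof -
  let ?P = "\<lambda>j. \<not> flag Z j \<inter> q k \<subseteq> q (Suc k)"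
  have j: "j = (LEAST j. ?P j)" by (simp add: j_def jump_j_def)
  obtain U where U: "U \<in> q k" "U \<notin> perp br l (q k)"
      "\<And>V. V \<in> q (Suc k) \<longleftrightarrow> V \<in> q k \<and> form U V = 0"
    by (rule pivot_i[OF assms(1)]) blast
  then obtain W where "W \<in> q k" "form W U \<noteq> 0" by (auto simp: perp_iff)
  then have "W \<in> q k" "W \<notin> q (Suc k)" using U(3)[of W] form_skew[of U W] by simp_all
  then have PM: "?P M" by (simp only: flag_UNIV) blast
  have Pj: "?P j" unfolding j using PM by (rule LeastI)
  have "j \<le> M" unfolding j using PM by (rule Least_le)
  obtain V where V: "V \<in> flag Z j" "V \<in> q k" "V \<notin> q (Suc k)" using Pj by blast
  have "j \<noteq> 0" using V cplx.subspace_0[OF subspace_q, of "Suc k"] by (metis flag_0 singletonD)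
  then have less: "j - 1 < j" by simp
  have low: "flag Z (j - 1) \<inter> q k \<subseteq> q (Suc k)"
    using not_less_Least[OF less[unfolded j], folded j] by simp
  have "V \<notin> flag Z (j - 1)" using V low by blast
  then show ?thesis using that[OF V] \<open>j \<noteq> 0\<close> \<open>j \<le> M\<close> low by simp
qed

text \<open>Elements of \<open>q (Suc k)\<close> are orthogonal to
  \<open>q k \<inter> flag Z i\<close> for the old index i, so a vector of \<open>q (Suc k)\<close>
  in that flag member cannot witness the next index.\<close>

lemma jump_i_Suc_less:
  assumes "step (Suc k)"
  shows "jump_i br Z l (Suc k) < jump_i br Z l (Suc (Suc k))"
proof (rule ccontr)
  assume c: "\<not> ?thesis"
  have k: "step k" using assms step_down by auto
  obtain U where U: "U \<in> flag Z (jump_i br Z l (Suc (Suc k)))" "U \<in> q (Suc k)"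
      "U \<notin> perp br l (q (Suc k))"
    by (rule pivot_i[OF assms]) blast
  have "U \<in> flag Z (jump_i br Z l (Suc k))" using U(1) c flag_mono by (metis not_le subsetD)
  moreover have "q (Suc k) = perp br l (q k \<inter> flag Z (jump_i br Z l (Suc k))) \<inter> q k"
    using k by (simp add: step_def jump_q.simps(2) Let_def jump_i_def)
  ultimately have "form U V = 0" if "V \<in> q (Suc k)" for V
    using that U(2) by (auto simp: perp_iff)
  then show False using U(3) form_skew[of _ U] by (auto simp: perp_iff)
qed

lemma jump_i_less:
  assumes "step k" "i < k"
  shows "jump_i br Z l (Suc i) < jump_i br Z l (Suc k)"
  using assms
proof (induction k)
  case (Suc k)
  then have "step k" using step_down by auto
  then show ?case using Suc jump_i_Suc_less[of k] by (cases "i = k") auto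
qed simp

lemma eventually_not_step: "\<exists>k. \<not> step k"
proof (rule ccontr)
  assume "\<not> ?thesis"
  then have s: "step k" for k by auto
  \<comment> \<open>The i-indices increase strictly and are at most \<open>M\<close>, so the steps
    cannot go on forever.\<close>
  have "k < jump_i br Z l (Suc k)" for k
  proof (induction k)
    case 0
    then show ?case using pivot_i[OF s[of 0]] by (metis less_le_trans zero_less_one)
  next
    case (Suc k)
    then show ?case using jump_i_Suc_less[OF s[of "Suc k"]] by simp
  qed
  moreover have "jump_i br Z l (Suc M) \<le> M" by (rule pivot_i[OF s[of M]]) blast
  ultimately show False using not_le by blast
qed

lemma e_set_iff:
  "m \<in> e_set br Z l \<longleftrightarrow> (\<exists>k. step k \<and> (m = jump_i br Z l (Suc k) \<or> m = jump_j br Z l (Suc k)))"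
  by (auto simp: e_set_def i_set_def j_set_def jump_steps_iff)

lemma i_set_iff: "m \<in> i_set br Z l \<longleftrightarrow> (\<exists>k. step k \<and> m = jump_i br Z l (Suc k))"
  by (auto simp: i_set_def jump_steps_iff)

lemma e_set_subset: "e_set br Z l \<subseteq> {1..M}"
proof
  fix m assume "m \<in> e_set br Z l"
  then obtain k where "step k" "m = jump_i br Z l (Suc k) \<or> m = jump_j br Z l (Suc k)"
    by (auto simp: e_set_iff)
  then show "m \<in> {1..M}" using pivot_i[of k] pivot_j[of k] by (metis atLeastAtMost_iff)
qed

text \<open>A radical vector \<open>W\<close> with leading index \<open>m\<close> could be
  subtracted from the pivot with that leading index. Orthogonality relations do not change, but the
  leading index drops, against the minimality of \<open>jump_i\<close> or
  \<open>jump_j\<close>.\<close>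

lemma no_lead_if_in_e_set:
  assumes "m \<in> e_set br Z l"
  shows "\<not> has_lead Z m (form_radical br l)"
proof
  assume "has_lead Z m (form_radical br l)"
  then obtain W where W: "W \<in> form_radical br l" "W - Z m \<in> flag Z (m - 1)"
    by (auto simp: has_lead_def)
  obtain k where k: "step k" and m: "m = jump_i br Z l (Suc k) \<or> m = jump_j br Z l (Suc k)"
    using assms by (auto simp: e_set_iff)
  have red: "\<exists>c. V - cscale c W \<in> flag Z (m - 1) \<inter> q k"
    if V: "V \<in> flag Z m" "V \<in> q k" "V \<notin> flag Z (m - 1)" "1 \<le> m" for V
  proof -
    obtain c where c: "V - cscale c (Z m) \<in> flag Z (m - 1)" using flag_leadingE V by metis
    have "(V - cscale c (Z m)) - cscale c (W - Z m) \<in> flag Z (m - 1)"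
      using c W(2) by (metis flag_diff flag_scale)
    then have "V - cscale c W \<in> flag Z (m - 1)" by (simp add: cplx.scale_right_diff_distrib)
    moreover have "V - cscale c W \<in> q k"
      using W(1) V(2) form_radical_subset_q
      by (metis q_diff q_scale subsetD)
    ultimately show ?thesis by auto
  qed
  have Wr: "W \<in> perp br l (q k)" "W \<in> q (Suc k)"
    using W(1) form_radical_subset_q[of "Suc k"] by (auto simp: form_radical_iff perp_iff)
  show False using m
  proof
    assume m: "m = jump_i br Z l (Suc k)"
    obtain U where U: "U \<in> flag Z m" "U \<in> q k" "U \<notin> perp br l (q k)" "U \<notin> flag Z (m - 1)"
      "1 \<le> m" "flag Z (m - 1) \<inter> q k \<subseteq> perp br l (q k)"
      by (rule pivot_i[OF k, folded m]) blast
    then obtain c where "U - cscale c W \<in> perp br l (q k)" using red by blast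
    then have "(U - cscale c W) + cscale c W \<in> perp br l (q k)"
      using Wr(1) by (metis cplx.subspace_add[OF subspace_perp] perp_scale)
    then show False using U(3) by simp
  next
    assume m: "m = jump_j br Z l (Suc k)"
    obtain V where V: "V \<in> flag Z m" "V \<in> q k" "V \<notin> q (Suc k)" "V \<notin> flag Z (m - 1)"
      "1 \<le> m" "flag Z (m - 1) \<inter> q k \<subseteq> q (Suc k)"
      by (rule pivot_j[OF k, folded m]) blast
    then obtain c where "V - cscale c W \<in> q (Suc k)" using red by blast
    then have "(V - cscale c W) + cscale c W \<in> q (Suc k)"
      using Wr(2) by (metis cplx.subspace_add[OF subspace_q] q_scale)
    then show False using V(3) by simp
  qed
qed

text \<open>A vector with leading index \<open>m\<close> is first corrected by the \<open>j\<close>-pivots so as to lie in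
  the final isotropic subspace, and then, going backwards, by the \<open>i\<close>-pivots so as to lie in the
  radical. Neither correction touches the leading coefficient.\<close>

lemma has_lead_if_notin_e_set:
  assumes "m \<notin> e_set br Z l" "1 \<le> m" "m \<le> M"
  shows "has_lead Z m (form_radical br l)"
proof -
  have fwd: "has_lead Z m (q k)" for k
  proof (induction k)
    case 0
    show ?case using flag_zero[of Z "m - 1"] unfolding has_lead_def by (intro bexI[of _ "Z m"]) auto
  next
    case (Suc k)
    then obtain V where V: "V \<in> q k" "V - Z m \<in> flag Z (m - 1)" by (auto simp: has_lead_def)
    show ?case
    proof (cases "V \<in> q (Suc k)")
      case False
      then have k: "step k" using V q_stationary by metis
      let ?j = "jump_j br Z l (Suc k)"
      obtain Y where Y: "Y \<in> flag Z ?j" "Y \<in> q k" "Y \<notin> q (Suc k)" "flag Z (?j - 1) \<inter> q k \<subseteq> q (Suc k)"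
        by (rule pivot_j[OF k]) blast
      obtain U where U: "\<And>V. V \<in> q (Suc k) \<longleftrightarrow> V \<in> q k \<and> form U V = 0"
        by (rule pivot_i[OF k]) blast
      have "m \<noteq> ?j" using assms(1) k by (auto simp: e_set_iff)
      moreover have "\<not> m < ?j"
      proof
        assume "m < ?j"
        then have "V - Z m \<in> flag Z (?j - 1)" "Z m \<in> flag Z (?j - 1)"
          using V(2) flag_mono[of "m - 1" "?j - 1" Z] assms(2) by (fastforce, intro basis_in_flag) auto
        from cplx.subspace_add[OF subspace_flag this] show False using Y(4) V(1) False by auto
      qed
      ultimately have "?j \<le> m - 1" by simp
      then have "Y \<in> flag Z (m - 1)" using Y(1) flag_mono by blast
      \<comment> \<open>\<open>form U Y\<close> is nonzero because \<open>Y\<close> lies in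
        \<open>q k\<close> but not in \<open>q (Suc k)\<close>; the coefficient makes the corrected
        vector orthogonal to \<open>U\<close>.\<close>
      then have "(V - Z m) - cscale (form U V / form U Y) Y \<in> flag Z (m - 1)"
        using V(2) by (metis flag_diff flag_scale)
      then have "V - cscale (form U V / form U Y) Y - Z m \<in> flag Z (m - 1)"
        by (simp add: algebra_simps)
      moreover have "V - cscale (form U V / form U Y) Y \<in> q (Suc k)"
        using Y V U q_diff q_scale
        by (auto simp: form_diff_right form_cscale_right)
      ultimately show ?thesis unfolding has_lead_def by blast
    qed (use V in \<open>auto simp: has_lead_def\<close>)
  qed
  have bwd: "has_lead Z m (q 0 \<inter> perp br l (q 0))"
    if "has_lead Z m (q k \<inter> perp br l (q k))" for k
    using that
  proof (induction k)
    case (Suc k)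
    show ?case
    proof (rule Suc.IH, cases "step k")
      case False
      then show "has_lead Z m (q k \<inter> perp br l (q k))" using Suc.prems q_stationary by metis
    next
      case k: True
      obtain V where V: "V \<in> q (Suc k)" "V \<in> perp br l (q (Suc k))" "V - Z m \<in> flag Z (m - 1)"
        using Suc.prems by (auto simp: has_lead_def)
      let ?i = "jump_i br Z l (Suc k)"
      obtain U where U: "U \<in> flag Z ?i" "U \<in> q k" "U \<notin> perp br l (q k)"
          "\<And>V. V \<in> q (Suc k) \<longleftrightarrow> V \<in> q k \<and> form U V = 0" "flag Z (?i - 1) \<inter> q k \<subseteq> perp br l (q k)"
        by (rule pivot_i[OF k]) blast
      have Vq: "V \<in> q k" using V(1) q_Suc_subset by auto
      have "m \<noteq> ?i" using assms(1) k by (auto simp: e_set_iff)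
      show "has_lead Z m (q k \<inter> perp br l (q k))"
      proof (cases "m < ?i")
        case True
        then have "V - Z m \<in> flag Z (?i - 1)" "Z m \<in> flag Z (?i - 1)"
          using V(3) flag_mono[of "m - 1" "?i - 1" Z] assms(2) by (fastforce, intro basis_in_flag) auto
        from cplx.subspace_add[OF subspace_flag this] have "V \<in> perp br l (q k)" using U(5) Vq
          by auto
        then show ?thesis using V Vq by (auto simp: has_lead_def)
      next
        case False
        with \<open>m \<noteq> ?i\<close> have "?i \<le> m - 1" by simp
        then have "U \<in> flag Z (m - 1)" using U(1) flag_mono by blast
        obtain T where T: "T \<in> q k" "form T U \<noteq> 0" using U(3) by (auto simp: perp_iff)
        \<comment> \<open>\<open>q k\<close> is spanned by \<open>q (Suc k)\<close> and
          \<open>T\<close>. Both \<open>V\<close> and \<open>U\<close> are orthogonal to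
          \<open>q (Suc k)\<close>, and \<open>c\<close> makes the difference orthogonal to
          \<open>T\<close> as well.\<close>
        define c where "c = form T V / form T U"
        have "form S (V - cscale c U) = 0" if S: "S \<in> q k" for S
        proof -
          let ?d = "form U S / form U T"
          have ut: "form U T \<noteq> 0" using T form_skew[of U T] by simp
          have "S - cscale ?d T \<in> q (Suc k)"
            using S T U ut q_diff q_scale
            by (auto simp: form_diff_right form_cscale_right)
          then have "form (S - cscale ?d T) V = 0" using V(2) by (auto simp: perp_iff)
          then have "form S V = ?d * form T V" by (simp add: form_diff_left form_cscale_left)
          then show ?thesis using T ut form_skew[of U T] form_skew[of U S]
            by (simp add: form_diff_right form_cscale_right c_def)
        qed
        moreover have "V - cscale c U \<in> q k"
          using Vq U(2) by (metis q_diff q_scale)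
        moreover have "(V - Z m) - cscale c U \<in> flag Z (m - 1)"
          using V(3) \<open>U \<in> flag Z (m - 1)\<close>
          by (metis flag_diff flag_scale)
        then have "V - cscale c U - Z m \<in> flag Z (m - 1)" by (simp add: algebra_simps)
        ultimately show ?thesis unfolding has_lead_def perp_iff[symmetric]
          by (intro bexI[of _ "V - cscale c U"]) (simp_all add: perp_iff)
      qed
    qed
  qed simp
  obtain k where "\<not> step k" using eventually_not_step by blast
  then have "has_lead Z m (q k \<inter> perp br l (q k))" using fwd[of k]
    by (auto simp: step_def Int_absorb2)
  from bwd[OF this] show ?thesis by (simp add: form_radical_def)
qed

end

text \<open>The whole recursion is transported by \<open>F\<close>. It is used with the actions of N
  and of H on \<nn>, so that both preserve the layer \<open>Omega\<close>.\<close>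

lemma jump_sets_pullback:
  assumes "bij F" and flag: "\<And>j. F ` flag Z j = flag Z j"
    and form: "\<And>U V. capply l' (cbracket br U V) = capply l (cbracket br (F U) (F V))"
  shows "e_set br Z l' = e_set br Z l" and "j_set br Z l' = j_set br Z l"
proof -
  have inj: "inj F" using assms(1) bij_is_inj by blast
  have perp: "F ` perp br l' W = perp br l (F ` W)" for W
  proof -
    have "F V \<in> perp br l (F ` W) \<longleftrightarrow> V \<in> perp br l' W" for V
      by (simp add: perp_def form)
    then have "perp br l' W = F -` perp br l (F ` W)" by blast
    then show ?thesis using bij_is_surj[OF assms(1)] by (simp add: surj_image_vimage_eq)
  qed
  have sub: "F ` S \<subseteq> F ` T \<longleftrightarrow> S \<subseteq> T" for S T using inj
    by (simp add: inj_image_subset_iff)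
  have q: "F ` jump_q br Z l' k = jump_q br Z l k" for k
  proof (induction k)
    case 0
    then show ?case using bij_is_surj[OF assms(1)] by simp
  next
    case (Suc k)
    let ?q = "jump_q br Z l' k"
    have "flag Z j \<inter> ?q \<subseteq> perp br l' ?q \<longleftrightarrow>
        flag Z j \<inter> jump_q br Z l k \<subseteq> perp br l (jump_q br Z l k)" for j
      using sub[of "flag Z j \<inter> ?q" "perp br l' ?q"]
        by (simp add: perp Suc flag image_Int[OF inj])
    moreover have "?q \<subseteq> perp br l' ?q \<longleftrightarrow> jump_q br Z l k \<subseteq> perp br l (jump_q br Z l k)"
      using sub[of ?q "perp br l' ?q"] by (simp add: perp Suc)
    ultimately show ?case by (simp add: jump_q.simps(2) Let_def perp Suc flag image_Int[OF inj])
  qed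
  have perp': "flag Z j \<inter> jump_q br Z l' k \<subseteq> perp br l' (jump_q br Z l' k) \<longleftrightarrow>
      flag Z j \<inter> jump_q br Z l k \<subseteq> perp br l (jump_q br Z l k)" for j k
    using sub[of "flag Z j \<inter> jump_q br Z l' k" "perp br l' (jump_q br Z l' k)"]
    by (simp add: perp q flag image_Int[OF inj])
  have iso: "jump_q br Z l' k \<subseteq> perp br l' (jump_q br Z l' k) \<longleftrightarrow>
      jump_q br Z l k \<subseteq> perp br l (jump_q br Z l k)" for k
    using sub[of "jump_q br Z l' k" "perp br l' (jump_q br Z l' k)"] by (simp add: perp q)
  have "flag Z j \<inter> jump_q br Z l' k \<subseteq> jump_q br Z l' k' \<longleftrightarrow>
      flag Z j \<inter> jump_q br Z l k \<subseteq> jump_q br Z l k'" for j k k'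
    using sub[of "flag Z j \<inter> jump_q br Z l' k" "jump_q br Z l' k'"]
    by (simp add: q flag image_Int[OF inj])
  then show j: "j_set br Z l' = j_set br Z l"
    by (simp add: j_set_def jump_j_def jump_steps_def iso)
  show "e_set br Z l' = e_set br Z l"
    unfolding e_set_def j by (simp add: i_set_def jump_i_def jump_steps_def iso perp')
qed

section \<open>Groups in exponential coordinates\<close>

lemma smooth_has_derivative:
  assumes "smooth f"
  shows "(f has_derivative frechet_derivative f (at x)) (at x)"
  using assms by (cases rule: smooth.cases) (metis frechet_derivative_at)

lemma smooth_frechet_derivative:
  assumes "smooth f"
  shows "smooth (\<lambda>x. frechet_derivative f (at x) v)"
  using assms
proof (cases rule: smooth.cases)
  case (1 f')
  then have "f' x = frechet_derivative f (at x)" for x using frechet_derivative_at by blast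
  then show ?thesis using 1(2)[of v] by simp
qed

lemma smooth_isCont: "smooth f \<Longrightarrow> isCont f x"
  using smooth_has_derivative has_derivative_continuous by blast

lemma has_vector_derivative_ray:
  assumes "(f has_derivative L) (at 0)"
  shows "((\<lambda>t. f (t *\<^sub>R X)) has_vector_derivative L X) (at 0)"
proof -
  interpret L: bounded_linear L using assms has_derivative_bounded_linear by blast
  have "((\<lambda>t. f (t *\<^sub>R X)) has_derivative (\<lambda>h. L (h *\<^sub>R X))) (at 0)"
    by (rule has_derivative_compose[where f="\<lambda>t. t *\<^sub>R X"])
      (auto intro!: derivative_eq_intros simp: assms)
  then show ?thesis by (simp add: has_vector_derivative_def L.scaleR)
qed

lemma has_vector_derivative_shift:
  assumes "((\<lambda>h. f (t + h)) has_vector_derivative d) (at 0)"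
  shows "(f has_vector_derivative d) (at t)"
proof -
  have "((\<lambda>h. f (t + h)) \<circ> (\<lambda>x. x - t) has_vector_derivative (1 *\<^sub>R d)) (at t)"
    by (rule vector_diff_chain_at) (auto intro!: derivative_eq_intros simp: assms)
  then show ?thesis by (simp add: o_def)
qed

text \<open>The difference quotient at 0 is \<open>h\<close> itself, so continuity of
  \<open>h\<close> suffices. This serves \<open>Ad_G_n_h_has_vector_derivative\<close>, where
  \<open>h\<close> is \<open>mulD\<close> at a moving base point.\<close>

lemma has_vector_derivative_times_cont:
  assumes "isCont h (0::real)"
  shows "((\<lambda>t. t *\<^sub>R h t) has_vector_derivative h 0) (at 0)"
proof -
  have "((\<lambda>y. (1 / \<bar>y\<bar>) *\<^sub>R (y *\<^sub>R (h y - h 0))) \<longlongrightarrow> 0) (at 0)"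
  proof (rule Lim_null_comparison)
    show "((\<lambda>y. norm (h y - h 0)) \<longlongrightarrow> 0) (at 0)"
      using assms by (simp add: isCont_def LIM_zero tendsto_norm_zero)
    show "\<forall>\<^sub>F y in at 0. norm ((1 / \<bar>y\<bar>) *\<^sub>R (y *\<^sub>R (h y - h 0))) \<le> norm (h y - h 0)"
      by (auto simp: eventually_at intro!: exI[of _ 1])
  qed
  then show ?thesis
    by (simp add: has_vector_derivative_def has_derivative_at2 bounded_linear_scaleR_left
        scaleR_diff_right)
qed

section \<open>Complexified linear maps\<close>

definition cmap :: "('a \<Rightarrow> 'b) \<Rightarrow> 'a \<times> 'a \<Rightarrow> 'b \<times> 'b" where
  "cmap F V = (F (fst V), F (snd V))"

lemma cmap_cscale: "linear F \<Longrightarrow> cmap F (cscale c V) = cscale c (cmap F V)"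
  by (simp add: cmap_def cscale_def linear_diff linear_add linear_scale)

lemma cmap_add: "linear F \<Longrightarrow> cmap F (V + W) = cmap F V + cmap F W"
  by (simp add: cmap_def linear_add)

lemma cmap_diff: "linear F \<Longrightarrow> cmap F (V - W) = cmap F V - cmap F W"
  by (simp add: cmap_def linear_diff)

lemma cmap_cconj: "linear F \<Longrightarrow> cmap F (cconj V) = cconj (cmap F V)"
  by (simp add: cmap_def cconj_def linear_neg)

lemma cmap_cbracket:
  assumes "linear F" "\<And>X Y. F (br X Y) = br' (F X) (F Y)"
  shows "cmap F (cbracket br V W) = cbracket br' (cmap F V) (cmap F W)"
  using assms by (simp add: cmap_def cbracket_def linear_diff linear_add)

lemma capply_eqI:
  fixes U V :: "'a::real_inner \<times> 'a"
  assumes "\<And>l. capply l U = capply l V"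
  shows "U = V"
proof -
  have "x \<bullet> fst U = x \<bullet> fst V \<and> x \<bullet> snd U = x \<bullet> snd V" for x
    using assms[of "blinfun_inner_right x"] by (simp add: capply_def)
  then show ?thesis by (metis prod_eqI vector_eq_ldot)
qed

locale chart_group =
  fixes N :: "'n::euclidean_space monoid"
  assumes vector_lie_group: "vector_lie_group N"
    and exponential_coordinates: "exponential_coordinates N"
begin

abbreviation mul :: "'n \<Rightarrow> 'n \<Rightarrow> 'n" (infixl "\<cdot>" 70) where "x \<cdot> y \<equiv> x \<otimes>\<^bsub>N\<^esub> y"

sublocale group N
  using vector_lie_group by (simp add: vector_lie_group_def)

lemma carrier_N [simp]: "carrier N = UNIV" and one_N [simp]: "\<one>\<^bsub>N\<^esub> = 0"
  using vector_lie_group by (auto simp: vector_lie_group_def)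

lemma mul_0 [simp]: "0 \<cdot> x = x" "x \<cdot> 0 = x"
  using l_one[of x] r_one[of x] by simp_all

lemma mul_assoc: "x \<cdot> y \<cdot> z = x \<cdot> (y \<cdot> z)"
  using m_assoc[of x y z] by simp

lemma mul_line: "(s *\<^sub>R X) \<cdot> (t *\<^sub>R X) = (s + t) *\<^sub>R X"
  using exponential_coordinates by (simp add: exponential_coordinates_def)

lemma mul_minus [simp]: "x \<cdot> (- x) = 0" "(- x) \<cdot> x = 0"
  using mul_line[of 1 x "-1"] mul_line[of "-1" x 1] by simp_all

lemma mul_minus_cancel [simp]: "x \<cdot> (- x \<cdot> y) = y" "(- x) \<cdot> (x \<cdot> y) = y"
  by (simp_all flip: mul_assoc)

lemma inv_N [simp]: "inv\<^bsub>N\<^esub> x = - x"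
  by (rule inv_equality) simp_all

lemma minus_mul: "- (x \<cdot> y) = (- y) \<cdot> (- x)"
  using inv_mult_group[of x y] by simp

definition "mulD z = frechet_derivative (\<lambda>(x, y). x \<cdot> y) (at z)"

lemma mul_has_derivative: "((\<lambda>(x, y). x \<cdot> y) has_derivative mulD z) (at z)"
  using vector_lie_group unfolding vector_lie_group_def mulD_def by (blast intro: smooth_has_derivative)

lemma linear_mulD: "linear (mulD z)"
  using mul_has_derivative has_derivative_linear by blast

lemma isCont_mulD: "isCont (\<lambda>z. mulD z v) z"
  using vector_lie_group unfolding vector_lie_group_def mulD_def
  by (blast intro: smooth_isCont smooth_frechet_derivative)

lemma has_derivative_mul:
  assumes "(f has_derivative f') (at x)" "(g has_derivative g') (at x)"
  shows "((\<lambda>x. f x \<cdot> g x) has_derivative (\<lambda>h. mulD (f x, g x) (f' h, g' h))) (at x)"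
  using has_derivative_compose[OF has_derivative_Pair[OF assms] mul_has_derivative] by simp

lemma mulD_0: "mulD (0, 0) (v, w) = v + w"
proof -
  have "((\<lambda>x. x \<cdot> 0) has_derivative (\<lambda>h. mulD (0, 0) (h, 0))) (at 0)"
    by (rule has_derivative_mul) (auto intro!: derivative_eq_intros)
  then have 1: "mulD (0, 0) (v, 0) = v"
    using has_derivative_unique[OF _ has_derivative_ident] by (metis (lifting) ext mul_0(2))
  have "((\<lambda>x. 0 \<cdot> x) has_derivative (\<lambda>h. mulD (0, 0) (0, h))) (at 0)"
    by (rule has_derivative_mul) (auto intro!: derivative_eq_intros)
  then have 2: "mulD (0, 0) (0, w) = w"
    using has_derivative_unique[OF _ has_derivative_ident] by (metis (lifting) ext mul_0(1))
  have "mulD (0, 0) ((v, 0) + (0, w)) = v + w"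
    unfolding linear_add[OF linear_mulD] 1 2 ..
  then show ?thesis by simp
qed

text \<open>The curve \<open>\<phi>(-sX) \<cdot> sL(X)\<close> is constant, so that \<open>\<phi>(sX) = sL(X)\<close>.\<close>

lemma hom_eq_derivative:
  assumes hom: "\<And>x y. \<phi> (x \<cdot> y) = \<phi> x \<cdot> \<phi> y" and der: "(\<phi> has_derivative L) (at 0)"
  shows "\<phi> = L"
proof
  fix X
  have \<phi>0: "\<phi> 0 = 0"
    using hom[of 0 0] by (metis l_cancel_one carrier_N one_N UNIV_I mul_0(1))
  interpret L: bounded_linear L using der has_derivative_bounded_linear by blast
  define c where "c h = \<phi> (h *\<^sub>R - X) \<cdot> (h *\<^sub>R L X)" for h :: real
  have "((\<lambda>h. \<phi> (h *\<^sub>R - X)) has_derivative (\<lambda>h. h *\<^sub>R L (- X))) (at 0)"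
    using has_vector_derivative_ray[OF der, of "- X"] by (simp add: has_vector_derivative_def L.neg)
  moreover have "((\<lambda>h. h *\<^sub>R L X) has_derivative (\<lambda>h. h *\<^sub>R L X)) (at 0)"
    by (auto intro!: derivative_eq_intros)
  ultimately have "(c has_derivative (\<lambda>h. mulD (0, 0) (h *\<^sub>R L (- X), h *\<^sub>R L X))) (at 0)"
    unfolding c_def by (drule_tac has_derivative_mul) (auto simp: \<phi>0)
  then have c': "(c has_derivative (\<lambda>h. 0)) (at 0)"
    by (simp add: mulD_0 L.neg)
  have "(c has_derivative (\<lambda>h. 0)) (at s)" for s
  proof -
    \<comment> \<open>Translation by \<open>\<phi> (s *\<^sub>R - X)\<close> on the left and by
      \<open>s *\<^sub>R L X\<close> on the right carries the curve near 0 to the curve near s, and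
      with it the zero derivative.\<close>
    have eq: "c (s + h) = \<phi> (s *\<^sub>R - X) \<cdot> c h \<cdot> (s *\<^sub>R L X)" for h
    proof -
      have "c (s + h) = \<phi> (s *\<^sub>R - X) \<cdot> \<phi> (h *\<^sub>R - X) \<cdot> ((h *\<^sub>R L X) \<cdot> (s *\<^sub>R L X))"
        unfolding c_def hom[symmetric] mul_line by (simp add: add.commute)
      then show ?thesis by (simp add: c_def mul_assoc)
    qed
    have "((\<lambda>h. \<phi> (s *\<^sub>R - X) \<cdot> c h) has_derivative (\<lambda>h. mulD (\<phi> (s *\<^sub>R - X), c 0) (0, 0))) (at 0)"
      by (rule has_derivative_mul[OF has_derivative_const c'])
    from has_derivative_mul[OF this has_derivative_const]
    have "((\<lambda>h. c (s + h)) has_derivative (\<lambda>h. 0)) (at 0)"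
      unfolding eq using linear_0[OF linear_mulD] by (simp flip: zero_prod_def)
    then have "((\<lambda>h. c (s + h)) has_vector_derivative 0) (at 0)"
      by (simp add: has_vector_derivative_def)
    from has_vector_derivative_shift[OF this] show ?thesis by (simp add: has_vector_derivative_def)
  qed
  then have "c (- 1) = c 0" using has_derivative_zero_unique[of UNIV c] by simp
  then have "\<phi> X \<cdot> (- L X) = 0" using \<phi>0 by (simp add: c_def)
  then show "\<phi> X = L X" using mul_assoc[of "\<phi> X" "- L X" "L X"] by simp
qed

section \<open>Conjugation and the Lie bracket of \<open>N\<close>\<close>

definition inn :: "'n \<Rightarrow> 'n \<Rightarrow> 'n" where "inn g x = g \<cdot> x \<cdot> (- g)"

lemma inn_hom: "inn g (x \<cdot> y) = inn g x \<cdot> inn g y"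
  by (simp add: inn_def mul_assoc)

lemma inn_mul: "inn (g \<cdot> h) x = inn g (inn h x)"
  by (simp add: inn_def mul_assoc minus_mul)

lemma inn_minus_cancel [simp]: "inn (- g) (inn g x) = x" "inn g (inn (- g) x) = x"
  by (simp_all add: inn_def mul_assoc)

lemma inn_0 [simp]: "inn 0 x = x"
  by (simp add: inn_def)

lemma inn_has_derivative:
  assumes "(f has_derivative f') (at x)" "(g has_derivative g') (at x)"
  shows "\<exists>D. ((\<lambda>x. inn (f x) (g x)) has_derivative D) (at x)"
  unfolding inn_def
  using has_derivative_mul[OF has_derivative_mul[OF assms] has_derivative_minus[OF assms(1)]] by blast

lemma linear_inn: "linear (inn g)"
proof -
  obtain D where "((\<lambda>x. inn g x) has_derivative D) (at 0)"
    using inn_has_derivative[OF has_derivative_const has_derivative_ident] by blast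
  then show ?thesis using hom_eq_derivative[of "inn g", OF inn_hom] has_derivative_linear by blast
qed

lemma Ad_N: "Ad N g X = inn g X"
proof -
  have "(\<lambda>t. g \<cdot> (t *\<^sub>R X) \<cdot> inv\<^bsub>N\<^esub> g) = (\<lambda>t. t *\<^sub>R inn g X)"
    using linear_scale[OF linear_inn, of g] by (auto simp: inn_def)
  moreover have "((\<lambda>t. t *\<^sub>R inn g X) has_vector_derivative inn g X) (at 0)"
    by (auto intro!: derivative_eq_intros)
  ultimately show ?thesis unfolding Ad_def by (simp add: vector_derivative_at)
qed

lemma lie_has_derivative: "((\<lambda>g. inn g Y) has_derivative (\<lambda>X. lie N X Y)) (at 0)"
proof -
  obtain D where D: "((\<lambda>g. inn g Y) has_derivative D) (at 0)"
    using inn_has_derivative[OF has_derivative_ident has_derivative_const] by blast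
  have "lie N X Y = D X" for X
    unfolding lie_def Ad_N using vector_derivative_at[OF has_vector_derivative_ray[OF D]] .
  then show ?thesis using D by simp
qed

lemmas lie_has_vector_derivative = has_vector_derivative_ray[OF lie_has_derivative]

lemma hom_lie:
  assumes "linear F" "\<And>x y. F (x \<cdot> y) = F x \<cdot> F y"
  shows "F (lie N X Y) = lie N (F X) (F Y)"
proof (rule vector_derivative_unique_at)
  have "F (inn (t *\<^sub>R X) Y) = inn (t *\<^sub>R F X) (F Y)" for t
    by (simp add: inn_def assms linear_neg linear_scale)
  then show "((\<lambda>t. inn (t *\<^sub>R F X) (F Y)) has_vector_derivative F (lie N X Y)) (at 0)"
    using bounded_linear.has_vector_derivative[OF linear_conv_bounded_linear[THEN iffD1, OF assms(1)]
        lie_has_vector_derivative[of X Y]] by simp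
qed (rule lie_has_vector_derivative)

lemma inn_lie: "inn g (lie N X Y) = lie N (inn g X) (inn g Y)"
  by (rule hom_lie[of "inn g"]) (simp_all add: linear_inn inn_hom)

lemma bilinear_lie: "bilinear (lie N)"
  unfolding bilinear_def
proof (intro conjI allI)
  show "linear (\<lambda>x. lie N x y)" for y
    using lie_has_derivative has_derivative_linear by blast
  show "linear (lie N x)" for x
  proof (rule linearI)
    show "lie N x (a + b) = lie N x a + lie N x b" for a b
    proof (rule vector_derivative_unique_at[OF lie_has_vector_derivative])
      show "((\<lambda>t. inn (t *\<^sub>R x) (a + b)) has_vector_derivative lie N x a + lie N x b) (at 0)"
        unfolding linear_add[OF linear_inn]
        by (intro has_vector_derivative_add lie_has_vector_derivative)
    qed
    show "lie N x (r *\<^sub>R a) = r *\<^sub>R lie N x a" for r a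
    proof (rule vector_derivative_unique_at[OF lie_has_vector_derivative])
      show "((\<lambda>t. inn (t *\<^sub>R x) (r *\<^sub>R a)) has_vector_derivative r *\<^sub>R lie N x a) (at 0)"
        unfolding linear_scale[OF linear_inn]
        by (intro bounded_linear.has_vector_derivative[OF bounded_linear_scaleR_right]
            lie_has_vector_derivative)
    qed
  qed
qed

lemma inn_ray_self: "inn (t *\<^sub>R X) X = X"
  using mul_line[of t X 1] mul_line[of "t + 1" X "- t"] by (simp add: inn_def)

lemma lie_self: "lie N X X = 0"
  by (rule vector_derivative_unique_at[OF lie_has_vector_derivative]) (simp add: inn_ray_self)

lemma lie_skew: "lie N X Y = - lie N Y X"
proof -
  have "lie N (X + Y) (X + Y) = lie N X Y + lie N Y X"
    by (simp only: bilinear_ladd[OF bilinear_lie] bilinear_radd[OF bilinear_lie]) (simp add: lie_self)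
  then show ?thesis using lie_self[of "X + Y"] by (simp add: eq_neg_iff_add_eq_0)
qed

lemma inn_ray_has_vector_derivative:
  "((\<lambda>t. inn (t *\<^sub>R X) Y) has_vector_derivative inn (t *\<^sub>R X) (lie N X Y)) (at t)"
proof (rule has_vector_derivative_shift)
  have "inn ((t + h) *\<^sub>R X) Y = inn (t *\<^sub>R X) (inn (h *\<^sub>R X) Y)" for h
    by (simp flip: mul_line inn_mul)
  then show "((\<lambda>h. inn ((t + h) *\<^sub>R X) Y) has_vector_derivative inn (t *\<^sub>R X) (lie N X Y)) (at 0)"
    using bounded_linear.has_vector_derivative[OF linear_conv_bounded_linear[THEN iffD1, OF linear_inn]
        lie_has_vector_derivative] by simp
qed

text \<open>\<open>inn (t *\<^sub>R X)\<close> fixes \<open>X\<close>, hence commutes with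
  \<open>lie N X\<close>. So the derivative of the left side in t is a value of f on the image of
  \<open>lie N X\<close>, which is 0.\<close>

lemma inn_ray_stabilizer:
  assumes "\<And>Y. blinfun_apply f (lie N X Y) = 0"
  shows "blinfun_apply f (inn (t *\<^sub>R X) Y) = blinfun_apply f Y"
proof -
  have "inn (s *\<^sub>R X) (lie N X Y) = lie N X (inn (s *\<^sub>R X) Y)" for s
    using hom_lie[of "inn (s *\<^sub>R X)" X Y] by (simp add: inn_ray_self linear_inn inn_hom)
  then have "((\<lambda>t. blinfun_apply f (inn (t *\<^sub>R X) Y)) has_vector_derivative 0) (at s)" for s
    using bounded_linear.has_vector_derivative[OF blinfun.bounded_linear_right[of f]
        inn_ray_has_vector_derivative[of X Y s]] by (simp add: assms)
  then have "blinfun_apply f (inn (t *\<^sub>R X) Y) = blinfun_apply f (inn (0 *\<^sub>R X) Y)"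
    using has_derivative_zero_unique[of UNIV "\<lambda>t. blinfun_apply f (inn (t *\<^sub>R X) Y)" t 0]
    by (simp add: has_vector_derivative_def)
  then show ?thesis by simp
qed

text \<open>Both sides agree at t = 0, and by the induction hypothesis for \<open>lie N X Y\<close>
  they have the same derivative in t.\<close>

lemma inn_ray_eq_exp_ad:
  "(lie N X ^^ k) Y = 0 \<Longrightarrow>
     inn (t *\<^sub>R X) Y = (\<Sum>i<k. (t ^ i / fact i) *\<^sub>R (lie N X ^^ i) Y)"
proof (induction k arbitrary: Y t)
  case 0
  then show ?case using linear_0[OF linear_inn] by simp
next
  case (Suc k)
  let ?S = "\<lambda>t. \<Sum>i<Suc k. (t ^ i / fact i) *\<^sub>R (lie N X ^^ i) Y"
  have IH: "inn (t *\<^sub>R X) (lie N X Y) = (\<Sum>i<k. (t ^ i / fact i) *\<^sub>R (lie N X ^^ Suc i) Y)" for t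
    using Suc.IH[of "lie N X Y" t] Suc.prems by (simp add: funpow_swap1)
  have S: "?S = (\<lambda>t. Y + (\<Sum>i<k. (t ^ Suc i / fact (Suc i)) *\<^sub>R (lie N X ^^ Suc i) Y))"
    by (simp only: sum.lessThan_Suc_shift) simp
  have "((\<lambda>t. (t ^ Suc i / fact (Suc i)) *\<^sub>R V) has_vector_derivative (t ^ i / fact i) *\<^sub>R V) (at t)"
    for i :: nat and V :: 'n and t :: real
    by (auto intro!: derivative_eq_intros simp: field_simps simp del: power_Suc fact_Suc)
      (simp add: field_simps)
  then have "((\<lambda>t. Y + (\<Sum>i<k. (t ^ Suc i / fact (Suc i)) *\<^sub>R (lie N X ^^ Suc i) Y))
      has_vector_derivative 0 + (\<Sum>i<k. (t ^ i / fact i) *\<^sub>R (lie N X ^^ Suc i) Y)) (at t)" for t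
    by (intro has_vector_derivative_add has_vector_derivative_const has_vector_derivative_sum)
  then have dS: "(?S has_vector_derivative inn (t *\<^sub>R X) (lie N X Y)) (at t)" for t
    unfolding S IH by (simp only: add_0)
  have "((\<lambda>t. inn (t *\<^sub>R X) Y - ?S t) has_vector_derivative 0) (at t)" for t
    using has_vector_derivative_diff[OF inn_ray_has_vector_derivative[of X Y t] dS[of t]] by simp
  then have "((\<lambda>t. inn (t *\<^sub>R X) Y - ?S t) has_derivative (\<lambda>h. 0)) (at t)" for t
    by (simp add: has_vector_derivative_def)
  then have "inn (t *\<^sub>R X) Y - ?S t = inn (0 *\<^sub>R X) Y - ?S 0"
    by (rule has_derivative_zero_unique[of UNIV "\<lambda>t. inn (t *\<^sub>R X) Y - ?S t" t 0, OF convex_UNIV])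
      (simp_all del: sum.lessThan_Suc)
  moreover have "?S 0 = Y" using fun_cong[OF S, of 0] by (simp del: sum.lessThan_Suc)
  ultimately show ?case by (simp del: sum.lessThan_Suc)
qed

end

section \<open>The semidirect product\<close>

locale semidirect_group = chart_group N for N :: "'n::euclidean_space monoid" +
  fixes \<eta> :: "'h::real_normed_vector \<Rightarrow> 'n \<Rightarrow> 'n"
  assumes automorphism_vector_group: "automorphism_vector_group N \<eta>"
begin

abbreviation "G \<equiv> semidirect N \<eta>"

lemma \<eta>_auto: "\<eta> A \<in> auto N"
  using automorphism_vector_group
  by (auto simp: automorphism_vector_group_def hom_def AutoGroup_def Pi_iff)

lemma \<eta>_hom: "\<eta> A (x \<cdot> y) = \<eta> A x \<cdot> \<eta> A y"
  using \<eta>_auto[of A] by (simp add: auto_def hom_def)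

lemma \<eta>_add: "\<eta> (A + B) x = \<eta> A (\<eta> B x)"
proof -
  have "\<eta> (A + B) = \<eta> A \<otimes>\<^bsub>AutoGroup N\<^esub> \<eta> B"
    using automorphism_vector_group by (simp add: automorphism_vector_group_def hom_def)
  then show ?thesis
    using \<eta>_auto[of A] \<eta>_auto[of B]
      by (simp add: AutoGroup_def BijGroup_def auto_def compose_def)
qed

text \<open>\<open>\<eta> 0\<close> is injective and idempotent.\<close>

lemma \<eta>_0 [simp]: "\<eta> 0 x = x"
proof -
  have "inj (\<eta> 0)" using \<eta>_auto[of 0] by (simp add: auto_def Bij_def bij_betw_def)
  then show ?thesis using \<eta>_add[of 0 0 x] by (simp add: inj_eq)
qed

lemma \<eta>_has_derivative: "\<exists>D. ((\<lambda>(A, X). \<eta> A X) has_derivative D) (at z)"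
  using automorphism_vector_group smooth_has_derivative
  by (auto simp: automorphism_vector_group_def)

lemma has_derivative_\<eta>:
  assumes "(f has_derivative f') (at x)" "(g has_derivative g') (at x)"
  shows "\<exists>D. ((\<lambda>x. \<eta> (f x) (g x)) has_derivative D) (at x)"
proof -
  obtain D where "((\<lambda>(A, X). \<eta> A X) has_derivative D) (at (f x, g x))"
    using \<eta>_has_derivative by blast
  from has_derivative_compose[OF has_derivative_Pair[OF assms] this] show ?thesis by auto
qed

lemma linear_\<eta>: "linear (\<eta> A)"
proof -
  obtain D where "((\<lambda>x. \<eta> A x) has_derivative D) (at 0)"
    using has_derivative_\<eta>[OF has_derivative_const has_derivative_ident] by blast
  then show ?thesis using hom_eq_derivative[of "\<eta> A", OF \<eta>_hom] has_derivative_linear by blast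
qed

lemma \<eta>_minus_cancel [simp]: "\<eta> (- A) (\<eta> A x) = x" "\<eta> A (\<eta> (- A) x) = x"
  by (simp_all flip: \<eta>_add)

text \<open>The derivation of \<nn> given by the bracket with \<open>A\<close> in \<gg>; see
  \<open>lie_G\<close>.\<close>

definition D :: "'h \<Rightarrow> 'n \<Rightarrow> 'n" where "D A X = frechet_derivative (\<lambda>A. \<eta> A X) (at 0) A"

lemma D_has_derivative: "((\<lambda>A. \<eta> A X) has_derivative (\<lambda>A. D A X)) (at 0)"
  using has_derivative_\<eta>[OF has_derivative_ident has_derivative_const, of X 0]
  unfolding D_def by (metis frechet_derivative_at)

lemmas D_has_vector_derivative = has_vector_derivative_ray[OF D_has_derivative]

lemma linear_D_left: "linear (\<lambda>A. D A X)"
  using D_has_derivative has_derivative_linear by blast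

lemma linear_D: "linear (D A)"
proof (rule linearI)
  show "D A (a + b) = D A a + D A b" for a b
  proof (rule vector_derivative_unique_at[OF D_has_vector_derivative])
    show "((\<lambda>t. \<eta> (t *\<^sub>R A) (a + b)) has_vector_derivative D A a + D A b) (at 0)"
      unfolding linear_add[OF linear_\<eta>]
      by (intro has_vector_derivative_add D_has_vector_derivative)
  qed
  show "D A (r *\<^sub>R a) = r *\<^sub>R D A a" for r a
  proof (rule vector_derivative_unique_at[OF D_has_vector_derivative])
    show "((\<lambda>t. \<eta> (t *\<^sub>R A) (r *\<^sub>R a)) has_vector_derivative r *\<^sub>R D A a) (at 0)"
      unfolding linear_scale[OF linear_\<eta>]
      by (intro bounded_linear.has_vector_derivative[OF bounded_linear_scaleR_right]
          D_has_vector_derivative)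
  qed
qed

lemma \<eta>_ray_has_vector_derivative:
  "((\<lambda>t. \<eta> (t *\<^sub>R A) X) has_vector_derivative \<eta> (t *\<^sub>R A) (D A X)) (at t)"
proof (rule has_vector_derivative_shift)
  have "\<eta> ((t + h) *\<^sub>R A) X = \<eta> (t *\<^sub>R A) (\<eta> (h *\<^sub>R A) X)" for h
    by (simp add: scaleR_add_left flip: \<eta>_add)
  then show "((\<lambda>h. \<eta> ((t + h) *\<^sub>R A) X) has_vector_derivative \<eta> (t *\<^sub>R A) (D A X)) (at 0)"
    using bounded_linear.has_vector_derivative[OF linear_conv_bounded_linear[THEN iffD1, OF linear_\<eta>]
        D_has_vector_derivative] by simp
qed

lemma \<eta>_lie: "\<eta> A (lie N X Y) = lie N (\<eta> A X) (\<eta> A Y)"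
  by (rule hom_lie[OF linear_\<eta> \<eta>_hom])

section \<open>The group \<open>G\<close> and its adjoint action\<close>

lemma mult_G [simp]: "(X, A) \<otimes>\<^bsub>G\<^esub> (Y, B) = (X \<cdot> \<eta> A Y, A + B)"
  and carrier_G [simp]: "carrier G = UNIV" and one_G [simp]: "\<one>\<^bsub>G\<^esub> = 0"
  by (simp_all add: semidirect_def zero_prod_def)

lemma \<eta>_zero_right [simp]: "\<eta> A 0 = 0"
  using linear_0[OF linear_\<eta>] .

lemma \<eta>_minus_right: "\<eta> A (- x) = - \<eta> A x"
  using linear_neg[OF linear_\<eta>] .

sublocale G: group G
proof (rule groupI)
  show "\<exists>y\<in>carrier G. y \<otimes>\<^bsub>G\<^esub> x = \<one>\<^bsub>G\<^esub>" for x
  proof (cases x)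
    case (Pair X A)
    then show ?thesis
      by (intro bexI[of _ "(\<eta> (- A) (- X), - A)"]) (simp_all add: \<eta>_minus_right zero_prod_def)
  qed
qed (auto simp: zero_prod_def mul_assoc \<eta>_hom \<eta>_add add.assoc)

lemma inv_G [simp]: "inv\<^bsub>G\<^esub> (X, A) = (\<eta> (- A) (- X), - A)"
  by (rule G.inv_equality) (simp_all add: \<eta>_minus_right zero_prod_def)

text \<open>Straight lines through 0 are in general not one-parameter subgroups of \<open>G\<close>.
  Unlike \<open>inn\<close>, this conjugation need not be linear, and \<open>Ad\<close> is obtained
  as its derivative at 0.\<close>

definition innG :: "'n \<times> 'h \<Rightarrow> 'n \<times> 'h \<Rightarrow> 'n \<times> 'h" where
  "innG g V = g \<otimes>\<^bsub>G\<^esub> V \<otimes>\<^bsub>G\<^esub> inv\<^bsub>G\<^esub> g"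

lemma innG_eq: "innG (X, A) (Y, B) = (X \<cdot> \<eta> A Y \<cdot> \<eta> B (- X), B)"
  by (simp add: innG_def flip: \<eta>_add)

lemma innG_mult: "innG (g \<otimes>\<^bsub>G\<^esub> h) V = innG g (innG h V)"
  by (simp add: innG_def G.inv_mult_group G.m_assoc)

lemma innG_0 [simp]: "innG g 0 = 0"
  by (cases g) (simp add: zero_prod_def innG_eq)

lemma Ad_G_has_derivative: "(innG g has_derivative Ad G g) (at 0)"
proof -
  obtain X A where g: "g = (X, A)" by (cases g)
  obtain D1 D2 where D1: "((\<lambda>V. \<eta> A (fst V)) has_derivative D1) (at (0 :: 'n \<times> 'h))"
    and D2: "((\<lambda>V. \<eta> (snd V) (- X)) has_derivative D2) (at (0 :: 'n \<times> 'h))"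
    using has_derivative_\<eta>[OF has_derivative_const has_derivative_fst[OF has_derivative_ident]]
      has_derivative_\<eta>[OF has_derivative_snd[OF has_derivative_ident] has_derivative_const]
        by metis
  have "\<exists>E. ((\<lambda>V. (X \<cdot> \<eta> A (fst V) \<cdot> \<eta> (snd V) (- X), snd V)) has_derivative E) (at 0)"
    by (rule exI) (rule has_derivative_Pair[OF has_derivative_mul[OF has_derivative_mul[OF
        has_derivative_const D1] D2] has_derivative_snd[OF has_derivative_ident]])
  moreover have "innG g = (\<lambda>V. (X \<cdot> \<eta> A (fst V) \<cdot> \<eta> (snd V) (- X), snd V))"
    by (auto simp: g innG_eq)
  ultimately obtain E where E: "(innG g has_derivative E) (at 0)" by auto
  have "Ad G g V = E V" for V
    unfolding Ad_def using vector_derivative_at[OF has_vector_derivative_ray[OF E]]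
    by (simp add: innG_def)
  then have "Ad G g = E" by auto
  then show ?thesis using E by simp
qed

lemma bounded_linear_Ad_G: "bounded_linear (Ad G g)"
  using Ad_G_has_derivative has_derivative_bounded_linear by blast

lemma Ad_G_mult: "Ad G (g \<otimes>\<^bsub>G\<^esub> h) V = Ad G g (Ad G h V)"
proof -
  have "((\<lambda>V. innG g (innG h V)) has_derivative (\<lambda>V. Ad G g (Ad G h V))) (at 0)"
    by (rule has_derivative_compose[OF Ad_G_has_derivative]) (simp add: Ad_G_has_derivative)
  then show ?thesis
    using has_derivative_unique[OF Ad_G_has_derivative[of "g \<otimes>\<^bsub>G\<^esub> h"]]
      by (simp add: innG_mult[abs_def])
qed

lemma Ad_G_eqI: "((\<lambda>t. innG g (t *\<^sub>R V)) has_vector_derivative W) (at 0) \<Longrightarrow> Ad G g V = W"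
  using vector_derivative_unique_at[OF has_vector_derivative_ray[OF Ad_G_has_derivative]] by blast

lemma Ad_G_n: "Ad G (X, A) (Y, 0) = (inn X (\<eta> A Y), 0)"
proof (rule Ad_G_eqI)
  have "innG (X, A) (t *\<^sub>R (Y, 0)) = t *\<^sub>R (inn X (\<eta> A Y), 0)" for t
    using linear_scale[OF linear_inn, of X t "\<eta> A Y"] linear_scale[OF linear_\<eta>, of A t Y]
    by (simp add: innG_eq inn_def)
  then show "((\<lambda>t. innG (X, A) (t *\<^sub>R (Y, 0))) has_vector_derivative (inn X (\<eta> A Y), 0)) (at 0)"
    by (auto intro!: derivative_eq_intros)
qed

lemma Ad_G_h: "Ad G (0, A) (0, B) = (0, B)"
proof (rule Ad_G_eqI)
  have "innG (0, A) (t *\<^sub>R (0, B)) = t *\<^sub>R (0, B)" for t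
    by (simp add: innG_eq)
  then show "((\<lambda>t. innG (0, A) (t *\<^sub>R (0, B))) has_vector_derivative (0, B)) (at 0)"
    by (auto intro!: derivative_eq_intros)
qed

lemma Ad_G_n_h: "Ad G (X, 0) (0, B) = (mulD (X, - X) (0, - D B X), B)"
proof (rule Ad_G_eqI)
  have "((\<lambda>t. \<eta> (t *\<^sub>R B) (- X)) has_derivative (\<lambda>t. t *\<^sub>R - D B X)) (at 0)"
    using D_has_vector_derivative[of B "- X"] linear_neg[OF linear_D]
    by (simp add: has_vector_derivative_def)
  then have "((\<lambda>t. X \<cdot> \<eta> (t *\<^sub>R B) (- X)) has_derivative (\<lambda>t. mulD (X, - X) (0, t *\<^sub>R - D B X))) (at 0)"
    using has_derivative_mul[OF has_derivative_const] by fastforce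
  moreover have "mulD (X, - X) (0, t *\<^sub>R - D B X) = t *\<^sub>R mulD (X, - X) (0, - D B X)" for t
    using linear_scale[OF linear_mulD, of "(X, - X)" t "(0, - D B X)"] by simp
  ultimately have "((\<lambda>t. X \<cdot> \<eta> (t *\<^sub>R B) (- X)) has_vector_derivative mulD (X, - X) (0, - D B X)) (at 0)"
    by (simp add: has_vector_derivative_def)
  then have "((\<lambda>t. (X \<cdot> \<eta> (t *\<^sub>R B) (- X), t *\<^sub>R B)) has_vector_derivative
      (mulD (X, - X) (0, - D B X), B)) (at 0)"
    by (intro has_vector_derivative_Pair) (auto intro!: derivative_eq_intros)
  then show "((\<lambda>t. innG (X, 0) (t *\<^sub>R (0, B))) has_vector_derivative
      (mulD (X, - X) (0, - D B X), B)) (at 0)"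
    by (simp add: innG_eq)
qed

text \<open>By linearity of \<open>mulD\<close> in its second argument, the \<nn>-component is t
  times a continuous function of t, whose value at 0 is the derivative.\<close>

lemma Ad_G_n_h_has_vector_derivative:
  "((\<lambda>t. Ad G (t *\<^sub>R X, 0) (0, B)) has_vector_derivative (- D B X, 0)) (at 0)"
proof -
  let ?h = "\<lambda>t. mulD (t *\<^sub>R X, - (t *\<^sub>R X)) (0, - D B X)"
  have "isCont ?h 0"
    by (rule isCont_o2[of 0 "\<lambda>t. (t *\<^sub>R X, - (t *\<^sub>R X))", OF _ isCont_mulD])
      (intro continuous_intros)
  from has_vector_derivative_times_cont[OF this]
  have "((\<lambda>t. t *\<^sub>R ?h t) has_vector_derivative - D B X) (at 0)" by (simp add: mulD_0)
  then have "((\<lambda>t. (t *\<^sub>R ?h t, B)) has_vector_derivative (- D B X, 0)) (at 0)"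
    by (intro has_vector_derivative_Pair has_vector_derivative_const)
  moreover have "Ad G (t *\<^sub>R X, 0) (0, B) = (t *\<^sub>R ?h t, B)" for t
  proof -
    have "(0, - D B (t *\<^sub>R X)) = t *\<^sub>R (0 :: 'n, - D B X)"
      using linear_scale[OF linear_D] by simp
    then show ?thesis unfolding Ad_G_n_h using linear_scale[OF linear_mulD] by metis
  qed
  ultimately show ?thesis by simp
qed

text \<open>Differentiability of \<open>inn (fst z) (\<eta> (snd z) Y)\<close> at 0 allows its
  derivative to be computed along \<nn> and \<hh> separately. The argument \<open>(0, B)\<close>
  feels only the \<nn>-direction, since H is commutative.\<close>

lemma lie_G: "lie G (X, A) (Y, B) = (lie N X Y + D A Y - D B X, 0)"
proof -
  have "\<exists>E. ((\<lambda>z. inn (fst z) (\<eta> (snd z) Y)) has_derivative E) (at (0 :: 'n \<times> 'h))"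
    using has_derivative_\<eta>[OF has_derivative_snd[OF has_derivative_ident] has_derivative_const]
      inn_has_derivative[OF has_derivative_fst[OF has_derivative_ident]] by metis
  then obtain E where E: "((\<lambda>z. inn (fst z) (\<eta> (snd z) Y)) has_derivative E) (at (0 :: 'n \<times> 'h))"
    by blast
  have "((\<lambda>t. inn (t *\<^sub>R X) Y) has_vector_derivative E (X, 0)) (at 0)"
    using has_vector_derivative_ray[OF E, of "(X, 0)"] by simp
  then have 1: "E (X, 0) = lie N X Y"
    using vector_derivative_unique_at lie_has_vector_derivative by blast
  have "((\<lambda>t. \<eta> (t *\<^sub>R A) Y) has_vector_derivative E (0, A)) (at 0)"
    using has_vector_derivative_ray[OF E, of "(0, A)"] by simp
  then have 2: "E (0, A) = D A Y"
    using vector_derivative_unique_at D_has_vector_derivative by blast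
  have "E (X, A) = E (X, 0) + E (0, A)"
    using linear_add[OF has_derivative_linear[OF E], of "(X, 0)" "(0, A)"] by simp
  then have "((\<lambda>t. inn (t *\<^sub>R X) (\<eta> (t *\<^sub>R A) Y)) has_vector_derivative lie N X Y + D A Y) (at 0)"
    using has_vector_derivative_ray[OF E, of "(X, A)"] 1 2 by simp
  then have "((\<lambda>t. (inn (t *\<^sub>R X) (\<eta> (t *\<^sub>R A) Y), 0) + Ad G (t *\<^sub>R X, 0) (0, B)) has_vector_derivative
      (lie N X Y + D A Y, 0) + (- D B X, 0)) (at 0)"
    by (intro has_vector_derivative_add has_vector_derivative_Pair has_vector_derivative_const
        Ad_G_n_h_has_vector_derivative)
  moreover have "Ad G (t *\<^sub>R (X, A)) (Y, B) =
      (inn (t *\<^sub>R X) (\<eta> (t *\<^sub>R A) Y), 0) + Ad G (t *\<^sub>R X, 0) (0, B)" for t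
  proof -
    have "Ad G (t *\<^sub>R (X, A)) (0, B) = Ad G (t *\<^sub>R X, 0) (0, B)"
      using Ad_G_mult[of "(t *\<^sub>R X, 0)" "(0, t *\<^sub>R A)" "(0, B)"] by (simp add: Ad_G_h)
    then show ?thesis
      using linear_add[OF bounded_linear.linear[OF bounded_linear_Ad_G], of "t *\<^sub>R (X, A)" "(Y, 0)" "(0, B)"]
      by (simp add: Ad_G_n)
  qed
  ultimately show ?thesis unfolding lie_def by (simp add: vector_derivative_at)
qed

lemma bilinear_lie_G: "bilinear (lie G)"
  unfolding bilinear_def
  by (auto intro!: linearI simp: lie_G bilinear_ladd[OF bilinear_lie] bilinear_radd[OF bilinear_lie]
      bilinear_lmul[OF bilinear_lie] bilinear_rmul[OF bilinear_lie] linear_add[OF linear_D]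
      linear_scale[OF linear_D] linear_add[OF linear_D_left] linear_scale[OF linear_D_left]
      scaleR_add_right scaleR_diff_right)

lemma lie_G_skew: "lie G V W = - lie G W V"
  using lie_skew[of "fst V" "fst W"] by (cases V; cases W) (simp add: lie_G)

text \<open>Let u(t) be the left side for t X. As \<open>Ad\<close> is multiplicative and f is
  invariant under \<open>inn (s *\<^sub>R X)\<close>, the derivative of u is constant, equal to the
  right side, and u(0) = 0. So the stabilizer shifts \<hh>-components by an exactly linear
  formula.\<close>

lemma Ad_G_stabilizer:
  assumes "\<And>Y. blinfun_apply f (lie N X Y) = 0"
  shows "blinfun_apply f (fst (Ad G (X, 0) (0, B))) = - blinfun_apply f (D B X)"
proof -
  define u where "u t = blinfun_apply f (fst (Ad G (t *\<^sub>R X, 0) (0, B)))" for t :: real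
  have "(u has_vector_derivative - blinfun_apply f (D B X)) (at s)" for s
  proof (rule has_vector_derivative_shift)
    let ?L = "\<lambda>V. blinfun_apply f (fst (Ad G (s *\<^sub>R X, 0) V))"
    have "bounded_linear ?L"
      by (intro bounded_linear_compose[OF blinfun.bounded_linear_right]
          bounded_linear_compose[OF bounded_linear_fst] bounded_linear_Ad_G)
    from bounded_linear.has_vector_derivative[OF this Ad_G_n_h_has_vector_derivative]
    have "((\<lambda>t. ?L (Ad G (t *\<^sub>R X, 0) (0, B))) has_vector_derivative ?L (- D B X, 0)) (at 0)" .
    moreover have "?L (- D B X, 0) = - blinfun_apply f (D B X)"
      by (simp add: Ad_G_n inn_ray_stabilizer[OF assms] blinfun.minus_right)
    moreover have "?L (Ad G (t *\<^sub>R X, 0) (0, B)) = u (s + t)" for t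
      using Ad_G_mult[of "(s *\<^sub>R X, 0)" "(t *\<^sub>R X, 0)"] by (simp add: u_def mul_line)
    ultimately show "((\<lambda>t. u (s + t)) has_vector_derivative - blinfun_apply f (D B X)) (at 0)"
      by simp
  qed
  then have "((\<lambda>t. u t - t *\<^sub>R (- blinfun_apply f (D B X))) has_vector_derivative 0) (at s)" for s
    by (auto intro!: derivative_eq_intros)
  then have "u 1 - 1 *\<^sub>R (- blinfun_apply f (D B X)) = u 0 - 0 *\<^sub>R (- blinfun_apply f (D B X))"
    using has_derivative_zero_unique[of UNIV "\<lambda>t. u t - t *\<^sub>R (- blinfun_apply f (D B X))" 1 0]
    by (simp add: has_vector_derivative_def)
  moreover have "u 0 = 0" by (simp add: u_def Ad_G_h)
  ultimately show ?thesis by (simp add: u_def eq_neg_iff_add_eq_0)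
qed

end

section \<open>Complexified functionals and a duality lemma\<close>

lemma capply_sum: "capply l (\<Sum>i\<in>I. V i) = (\<Sum>i\<in>I. capply l (V i))"
  by (induction I rule: infinite_finite_induct) (simp_all add: capply_add)

lemma cconj_cconj [simp]: "cconj (cconj V) = V"
  by (simp add: cconj_def)

lemma inj_incl_n: "inj incl_n"
  by (auto simp: inj_def incl_n_def prod_eq_iff)

lemma cscale_incl_n: "cscale c (incl_n V) = incl_n (cscale c V)"
  by (simp add: cscale_def incl_n_def)

lemma cbracket_of_re: "bilinear br \<Longrightarrow> cbracket br (of_re X) V = cmap (br X) V"
  by (simp add: cbracket_def of_re_def cmap_def bilinear_lzero)

lemma fst_cmap: "fst (cmap F V) = F (fst V)" and snd_cmap: "snd (cmap F V) = F (snd V)"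
  by (simp_all add: cmap_def)

lemma cmap_zero: "linear F \<Longrightarrow> cmap F 0 = 0"
  by (simp add: cmap_def linear_0 zero_prod_def)

lemma linear_cmap_subspace:
  assumes "linear F" "cplx.subspace S"
  shows "cplx.subspace {V. cmap F V \<in> S}"
  using assms
  by (intro cplx.subspaceI)
    (simp_all add: cmap_zero cmap_add cmap_cscale cplx.subspace_0 cplx.subspace_add cplx.subspace_scale)

lemma subspace_capply_cmap_eq:
  assumes "linear F" "linear F'"
  shows "cplx.subspace {V. capply f (cmap F V) = capply f' (cmap F' V)}"
  using assms by (intro cplx.subspaceI)
    (simp_all add: cmap_zero cmap_add cmap_cscale capply_add capply_cscale)

lemma cmap_id [simp]: "cmap (\<lambda>x. x) V = V"
  by (simp add: cmap_def)

text \<open>Represent functionals by vectors and split the vector of \<phi> orthogonally along the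
  family. The remainder z lies in the common kernel, so \<phi> vanishes at z; but this value is
  \<open>z \<bullet> z\<close>. The lemma turns annihilation hypotheses into vectors of \<nn> or
  \<hh> that realize a given functional.\<close>

lemma functional_in_family:
  fixes T :: "'v::real_vector \<Rightarrow> 'n::euclidean_space \<Rightarrow> real"
  assumes S: "subspace S" and T: "\<And>v. linear (T v)" "\<And>X. linear (\<lambda>v. T v X)" and \<phi>: "linear \<phi>"
    and ann: "\<And>X. (\<And>v. v \<in> S \<Longrightarrow> T v X = 0) \<Longrightarrow> \<phi> X = 0"
  shows "\<exists>v\<in>S. \<forall>X. \<phi> X = T v X"
proof -
  define rep where "rep g = (\<Sum>b\<in>Basis. g b *\<^sub>R b)" for g :: "'n \<Rightarrow> real"
  have rep: "g X = rep g \<bullet> X" if "linear g" for g X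
  proof -
    have "g X = g (\<Sum>b\<in>Basis. (X \<bullet> b) *\<^sub>R b)"
      by (simp add: euclidean_representation)
    also have "\<dots> = (\<Sum>b\<in>Basis. (X \<bullet> b) * g b)"
      using that by (simp add: linear_sum linear_scale)
    finally show ?thesis by (simp add: rep_def inner_sum_right inner_commute[of _ X] mult.commute)
  qed
  let ?R = "(\<lambda>v. rep (T v)) ` S"
  have "linear (\<lambda>v. rep (T v))"
    unfolding rep_def
    by (rule linearI) (simp_all add: linear_add[OF T(2)] linear_scale[OF T(2)] scaleR_add_left
        sum.distrib scaleR_sum_right)
  then have "subspace ?R" using S linear_subspace_image by blast
  then have sp: "span ?R = ?R" by (simp add: span_eq_iff)
  obtain y z where yz: "y \<in> span ?R" "\<And>w. w \<in> span ?R \<Longrightarrow> orthogonal z w" "rep \<phi> = y + z"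
    using orthogonal_subspace_decomp_exists[of ?R "rep \<phi>"] by metis
  have "T v z = 0" if "v \<in> S" for v
    using yz(2)[of "rep (T v)"] that sp rep[OF T(1), of v z]
      by (auto simp: orthogonal_def inner_commute)
  then have "rep \<phi> \<bullet> z = 0" using ann[of z] rep[OF \<phi>] by metis
  moreover have "z \<bullet> y = 0" using yz by (auto simp: orthogonal_def)
  ultimately have "z \<bullet> z = 0" using yz(3) by (simp add: inner_add_left inner_commute[of y])
  then have "z = 0" by simp
  then obtain v where "v \<in> S" "rep \<phi> = rep (T v)" using yz sp by auto
  then show ?thesis using rep[OF \<phi>] rep[OF T(1)] by metis
qed

section \<open>Adaptable bases\<close>

locale adapted = semidirect_group N \<eta>
  for N :: "'n::euclidean_space monoid" and \<eta> :: "'h::real_normed_vector \<Rightarrow> 'n \<Rightarrow> 'n" +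
  fixes Z :: "nat \<Rightarrow> 'n \<times> 'n" and lam :: "nat \<Rightarrow> 'h \<Rightarrow> real" and \<alpha> :: "nat \<Rightarrow> real"
  assumes nilpotent: "nilpotent (lie N)" and adaptable: "adaptable G Z lam \<alpha>"
begin

abbreviation "ad X \<equiv> cmap (lie N X)"

lemma linear_lie: "linear (lie N X)"
  using bilinear_lie by (simp add: bilinear_def)

lemma linear_lie_left: "linear (\<lambda>X. lie N X Y)"
  using bilinear_lie by (simp add: bilinear_def)

lemma cbracket_lie [simp]: "cbracket (lie N) (of_re X) V = ad X V"
  by (rule cbracket_of_re[OF bilinear_lie])

lemma flag_n: "flag Z DIM('n) = UNIV"
  using adaptable by (simp add: adaptable_def complexified_basis_def flag_def)

lemma jump_form_N: "jump_form (lie N) Z DIM('n)"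
  by unfold_locales (rule bilinear_lie, rule lie_skew, rule flag_n)

lemma cbracket_G_incl: "cbracket (lie G) (incl_n U) (incl_n V) = incl_n (cbracket (lie N) U V)"
  by (simp add: cbracket_def incl_n_def lie_G linear_0[OF linear_D_left])

lemma flag_ideal:
  "1 \<le> j \<Longrightarrow> j \<le> DIM('n) \<Longrightarrow> W \<in> flag Z j \<Longrightarrow>
     cbracket (lie G) V (incl_n W) \<in> incl_n ` flag Z j"
  using adaptable unfolding adaptable_def by (metis atLeastAtMost_iff)

lemma ad_flag:
  assumes "j \<le> DIM('n)" "V \<in> flag Z j"
  shows "ad X V \<in> flag Z j"
proof (cases "j = 0")
  case True
  then show ?thesis using assms by (simp add: cmap_zero linear_lie)
next
  case False
  then have "cbracket (lie G) (incl_n (of_re X)) (incl_n V) \<in> incl_n ` flag Z j"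
    using assms by (intro flag_ideal) auto
  then show ?thesis by (simp add: cbracket_G_incl inj_image_mem_iff[OF inj_incl_n])
qed

lemma Z_notin_flag:
  assumes "1 \<le> m" "m \<le> DIM('n)"
  shows "Z m \<notin> flag Z (m - 1)"
proof
  assume "Z m \<in> flag Z (m - 1)"
  moreover have inj: "inj_on Z {1..DIM('n)}" and ind: "cplx.independent (Z ` {1..DIM('n)})"
    using adaptable by (auto simp: adaptable_def complexified_basis_def)
  have sub: "Z ` {1..m - 1} \<subseteq> Z ` {1..DIM('n)} - {Z m}"
  proof
    fix V assume "V \<in> Z ` {1..m - 1}"
    then obtain i where i: "V = Z i" "i \<in> {1..m - 1}" by blast
    then have "i \<in> {1..DIM('n)}" "i \<noteq> m" using assms by auto
    then show "V \<in> Z ` {1..DIM('n)} - {Z m}" using i assms inj_onD[OF inj, of i m] by auto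
  qed
  ultimately have "Z m \<in> cplx.span (Z ` {1..DIM('n)} - {Z m})"
    using cplx.span_mono[OF sub] by (auto simp: flag_def)
  then show False using ind assms by (auto simp: cplx.dependent_def)
qed

lemma ad_funpow_zero: obtains K where "\<And>k X Y. K \<le> k \<Longrightarrow> (lie N X ^^ k) Y = 0"
proof -
  obtain K where K: "lower_central (lie N) K = {0}" using nilpotent by (auto simp: nilpotent_def)
  have "(lie N X ^^ k) Y \<in> lower_central (lie N) k" for k X Y
    by (induction k) (auto intro!: span_base)
  then have zero: "(lie N X ^^ K) Y = 0" for X Y using K by blast
  have "(lie N X ^^ k) Y = 0" if "K \<le> k" for k X Y
    using zero[of X "(lie N X ^^ (k - K)) Y"] that funpow_add[of K "k - K" "lie N X"] by simp
  then show ?thesis using that by blast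
qed

lemma cmap_funpow: fixes F :: "'a \<Rightarrow> 'a" shows "(cmap F ^^ k) V = cmap (F ^^ k) V"
proof -
  have "fst ((cmap F ^^ k) V) = (F ^^ k) (fst V)" "snd ((cmap F ^^ k) V) = (F ^^ k) (snd V)"
    by (induction k) (simp_all add: fst_cmap snd_cmap)
  then show ?thesis by (simp add: prod_eq_iff fst_cmap snd_cmap)
qed

text \<open>The eigenvalue of \<open>ad X\<close> on a one-dimensional quotient of the flag vanishes by
  nilpotency.\<close>

lemma ad_flag_Suc:
  assumes "Suc j \<le> DIM('n)" "V \<in> flag Z (Suc j)"
  shows "ad X V \<in> flag Z j"
proof -
  have "ad X (Z (Suc j)) \<in> flag Z (Suc j)"
    using assms(1) by (intro ad_flag basis_in_flag) auto
  then obtain c where c: "ad X (Z (Suc j)) - cscale c (Z (Suc j)) \<in> flag Z j"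
    by (auto simp: flag_Suc)
  have pow: "(ad X ^^ k) (Z (Suc j)) - cscale (c ^ k) (Z (Suc j)) \<in> flag Z j" for k
  proof (induction k)
    case 0
    then show ?case by (simp add: flag_zero)
  next
    case (Suc k)
    have "ad X ((ad X ^^ k) (Z (Suc j)) - cscale (c ^ k) (Z (Suc j))) \<in> flag Z j"
      using Suc assms(1) by (intro ad_flag) auto
    then have "ad X ((ad X ^^ k) (Z (Suc j))) - cscale (c ^ k) (ad X (Z (Suc j))) \<in> flag Z j"
      by (simp add: cmap_diff[OF linear_lie] cmap_cscale[OF linear_lie])
    from flag_add[OF this flag_scale[OF c, of "c ^ k"]] show ?case
      by (simp add: cplx.scale_right_diff_distrib mult.commute)
  qed
  obtain K where K: "\<And>k Y. K \<le> k \<Longrightarrow> (lie N X ^^ k) Y = 0"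
    using ad_funpow_zero by metis
  have "(ad X ^^ K) (Z (Suc j)) = 0" unfolding cmap_funpow by (simp add: cmap_def K zero_prod_def)
  then have "- cscale (c ^ K) (Z (Suc j)) \<in> flag Z j" using pow[of K] by simp
  then have "cscale (c ^ K) (Z (Suc j)) \<in> flag Z j" using flag_diff[OF flag_zero] by fastforce
  from flag_scale[OF this, of "inverse (c ^ K)"] have "c = 0"
    using Z_notin_flag[of "Suc j"] assms(1) by (cases "c = 0") simp_all
  then have Z: "ad X (Z (Suc j)) \<in> flag Z j" using c by simp
  obtain d where d: "V - cscale d (Z (Suc j)) \<in> flag Z j" using assms(2) by (auto simp: flag_Suc)
  have "ad X (V - cscale d (Z (Suc j))) \<in> flag Z j" using assms(1) d by (intro ad_flag) auto
  then have "ad X V - cscale d (ad X (Z (Suc j))) \<in> flag Z j"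
    by (simp add: cmap_diff[OF linear_lie] cmap_cscale[OF linear_lie])
  from flag_add[OF this flag_scale[OF Z, of d]] show ?thesis by simp
qed

text \<open>One bound serves all \<open>X\<close> by nilpotency. The limit
  \<open>Suc (Suc K)\<close> guarantees that the terms of order 0 and 1 are present, to be split off
  in \<open>capply_inn_affine\<close>.\<close>

lemma inn_eq_exp_ad: obtains K where
  "\<And>X V. cmap (inn X) V = (\<Sum>i<Suc (Suc K). cscale (of_real (1 / fact i)) ((ad X ^^ i) V))"
proof -
  obtain K where K: "\<And>k X Y. K \<le> k \<Longrightarrow> (lie N X ^^ k) Y = 0"
    using ad_funpow_zero by metis
  have 1: "inn X Y = (\<Sum>i<Suc (Suc K). (1 / fact i) *\<^sub>R (lie N X ^^ i) Y)" for X Y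
    using inn_ray_eq_exp_ad[where X=X and k="Suc (Suc K)" and Y=Y and t=1] K[of "Suc (Suc K)"]
      by (simp del: sum.lessThan_Suc)
  have 2: "cscale (of_real c) V = c *\<^sub>R V" for c and V :: "'n \<times> 'n"
    by (simp add: cscale_def prod_eq_iff)
  have "cmap (inn X) V = (\<Sum>i<Suc (Suc K). cscale (of_real (1 / fact i)) ((ad X ^^ i) V))" for X V
    unfolding 2 cmap_funpow by (simp add: prod_eq_iff fst_sum snd_sum cmap_def 1 del: sum.lessThan_Suc)
  then show ?thesis using that by blast
qed

lemma ad_funpow_flag: "j \<le> DIM('n) \<Longrightarrow> V \<in> flag Z j \<Longrightarrow> (ad X ^^ k) V \<in> flag Z j"
  by (induction k) (simp_all add: ad_flag)

lemma inn_flag: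
  assumes "V \<in> flag Z j"
  shows "cmap (inn X) V \<in> flag Z j"
proof (cases "j \<le> DIM('n)")
  case True
  obtain K where "\<And>X V. cmap (inn X) V = (\<Sum>i<Suc (Suc K). cscale (of_real (1 / fact i)) ((ad X ^^ i) V))"
    using inn_eq_exp_ad by blast
  then show ?thesis
    using assms True by (auto intro!: cplx.subspace_sum[OF subspace_flag] flag_scale ad_funpow_flag
        simp del: sum.lessThan_Suc)
next
  case False
  then show ?thesis using flag_n flag_mono[of "DIM('n)" j Z] by auto
qed

text \<open>\<open>ad X V\<close> already lies in \<open>flag Z j\<close>, so every term of the
  exponential series from order 2 on is \<open>ad X\<close> of a vector of \<open>flag Z j\<close>
  and is killed by f.\<close>

lemma capply_inn_affine:
  assumes "Suc j \<le> DIM('n)" "V \<in> flag Z (Suc j)" and f: "\<And>W. W \<in> flag Z j \<Longrightarrow> capply f (ad X W) = 0"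
  shows "capply f (cmap (inn X) V) = capply f V + capply f (ad X V)"
proof -
  obtain K where K: "\<And>X V. cmap (inn X) V = (\<Sum>i<Suc (Suc K). cscale (of_real (1 / fact i)) ((ad X ^^ i) V))"
    using inn_eq_exp_ad by blast
  have "(ad X ^^ Suc i) V \<in> flag Z j" for i
    using ad_funpow_flag[where j=j and V="ad X V" and X=X and k=i] ad_flag_Suc[OF assms(1,2), of X] assms(1)
    by (simp add: funpow_swap1)
  then have "capply f ((ad X ^^ Suc (Suc i)) V) = 0" for i using f by simp
  then show ?thesis
    unfolding K sum.lessThan_Suc_shift by (simp add: capply_add capply_sum capply_cscale del: funpow.simps(2))
      simp
qed

lemma bij_cmap:
  assumes "\<And>x. F' (F x) = x" "\<And>x. F (F' x) = x"
  shows "bij (cmap F)"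
  by (rule o_bij[of "cmap F'"]) (simp_all add: fun_eq_iff cmap_def assms)

lemma cmap_image_flag:
  assumes "\<And>x. F' (F x) = x" "\<And>x. F (F' x) = x"
    and "\<And>V. V \<in> flag Z j \<Longrightarrow> cmap F V \<in> flag Z j" "\<And>V. V \<in> flag Z j \<Longrightarrow> cmap F' V \<in> flag Z j"
  shows "cmap F ` flag Z j = flag Z j"
proof
  show "flag Z j \<subseteq> cmap F ` flag Z j"
  proof
    fix V assume "V \<in> flag Z j"
    then have "cmap F' V \<in> flag Z j" "V = cmap F (cmap F' V)" using assms by (auto simp: cmap_def)
    then show "V \<in> cmap F ` flag Z j" by blast
  qed
qed (use assms in auto)

lemma D_Z: "1 \<le> m \<Longrightarrow> m \<le> DIM('n) \<Longrightarrow> cmap (D A) (Z m) = cscale (weight lam \<alpha> m A) (Z m)"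
proof -
  assume "1 \<le> m" "m \<le> DIM('n)"
  then have "cbracket (lie G) (of_re (0, A)) (incl_n (Z m)) = cscale (weight lam \<alpha> m A) (incl_n (Z m))"
    using adaptable unfolding adaptable_def by (metis atLeastAtMost_iff)
  moreover have "cbracket (lie G) (of_re (0, A)) (incl_n (Z m)) = incl_n (cmap (D A) (Z m))"
    using bilinear_lzero[OF bilinear_lie]
    by (simp add: cbracket_def of_re_def incl_n_def cmap_def lie_G linear_0[OF linear_D]
        linear_0[OF linear_D_left] bilinear_lzero[OF bilinear_lie_G])
  ultimately show ?thesis by (simp add: cscale_incl_n inj_eq[OF inj_incl_n])
qed

text \<open>Tested on a functional, the curve of \<open>Z m\<close> under
  \<open>t *\<^sub>R A\<close> solves h' = \<gamma> h with \<gamma> the weight; multiplication by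
  exp(-t\<gamma>) makes it constant.\<close>

lemma \<eta>_Z:
  assumes "1 \<le> m" "m \<le> DIM('n)"
  shows "cmap (\<eta> A) (Z m) = cscale (exp (weight lam \<alpha> m A)) (Z m)"
proof (rule capply_eqI)
  fix f :: "'n \<Rightarrow>\<^sub>L real"
  let ?w = "weight lam \<alpha> m A"
  define h where "h t = capply f (cmap (\<eta> (t *\<^sub>R A)) (Z m))" for t :: real
  have "((\<lambda>t. blinfun_apply f (\<eta> (t *\<^sub>R A) Y)) has_real_derivative
      blinfun_apply f (\<eta> (t *\<^sub>R A) (D A Y))) (at t)" for Y t
    using bounded_linear.has_vector_derivative[OF blinfun.bounded_linear_right \<eta>_ray_has_vector_derivative]
    by (simp add: has_real_derivative_iff_has_vector_derivative)
  then have "(h has_vector_derivative capply f (cmap (\<eta> (t *\<^sub>R A)) (cmap (D A) (Z m)))) (at t)" for t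
    unfolding h_def capply_def cmap_def has_vector_derivative_complex_iff
    by (simp add: has_real_derivative_iff_has_vector_derivative)
  then have h: "(h has_vector_derivative ?w * h t) (at t)" for t
    using D_Z[OF assms] cmap_cscale[OF linear_\<eta>] by (simp add: capply_cscale h_def)
  have e: "((\<lambda>t. exp (of_real t * - ?w)) has_vector_derivative exp (of_real t * - ?w) * - ?w) (at t)" for t :: real
    by (rule has_vector_derivative_real_field) (auto intro!: derivative_eq_intros)
  have "((\<lambda>t. exp (of_real t * - ?w) * h t) has_vector_derivative 0) (at t)" for t
    using has_vector_derivative_mult[OF e h, of t] by (simp add: algebra_simps)
  then have "exp (of_real 1 * - ?w) * h 1 = exp (of_real 0 * - ?w) * h 0"
    using has_derivative_zero_unique[of UNIV "\<lambda>t. exp (of_real t * - ?w) * h t" 1 0]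
    by (simp add: has_vector_derivative_def)
  then show "capply f (cmap (\<eta> A) (Z m)) = capply f (cscale (exp ?w) (Z m))"
    by (simp add: h_def exp_minus field_simps capply_cscale cmap_def)
qed

lemma \<eta>_flag:
  assumes "V \<in> flag Z j"
  shows "cmap (\<eta> A) V \<in> flag Z j"
proof (cases "j \<le> DIM('n)")
  case True
  have "V \<in> {V. cmap (\<eta> A) V \<in> flag Z j}"
  proof (rule subsetD[OF cplx.span_minimal])
    show "Z ` {1..j} \<subseteq> {V. cmap (\<eta> A) V \<in> flag Z j}"
      using True by (auto simp: \<eta>_Z intro!: flag_scale basis_in_flag)
  qed (use assms in \<open>auto simp: flag_def intro!: linear_cmap_subspace linear_\<eta>\<close>)
  then show ?thesis by simp
next
  case False
  then show ?thesis using flag_n flag_mono[of "DIM('n)" j Z] by auto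
qed

lemma inn_image_flag: "cmap (inn g) ` flag Z j = flag Z j"
  by (rule cmap_image_flag[of "inn (- g)"]) (simp_all add: inn_flag)

lemma \<eta>_image_flag: "cmap (\<eta> A) ` flag Z j = flag Z j"
  by (rule cmap_image_flag[of "\<eta> (- A)"]) (simp_all add: \<eta>_flag)

section \<open>Real blocks of the flag\<close>

definition "real_flag i \<longleftrightarrow> flag Z i = cconj ` flag Z i"

lemma real_flag_0: "real_flag 0"
  by (simp add: real_flag_def cconj_def zero_prod_def)

lemma prev_real:
  assumes "1 \<le> m"
  shows "prev_real Z m < m" "real_flag (prev_real Z m)"
    "\<And>k. prev_real Z m < k \<Longrightarrow> k < m \<Longrightarrow> \<not> real_flag k"
proof -
  let ?P = "\<lambda>i. i < m \<and> flag Z i = cconj ` flag Z i"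
  have P0: "?P 0" using assms real_flag_0 by (simp add: real_flag_def)
  have b: "?P i \<Longrightarrow> i \<le> m" for i by simp
  have "?P (prev_real Z m)" unfolding prev_real_def by (rule GreatestI_nat[of ?P, OF P0 b])
  then show "prev_real Z m < m" "real_flag (prev_real Z m)" by (auto simp: real_flag_def)
  show "\<not> real_flag k" if "prev_real Z m < k" "k < m" for k
    using Greatest_le_nat[of ?P k m] that by (auto simp: real_flag_def prev_real_def)
qed

lemma prev_real_eqI:
  assumes "i < m" "real_flag i" "\<And>k. i < k \<Longrightarrow> k < m \<Longrightarrow> \<not> real_flag k"
  shows "prev_real Z m = i"
  using prev_real[of m] assms by (metis le_less_trans less_one linorder_neqE_nat not_le zero_le)

lemma prev_real_Suc: "real_flag i \<Longrightarrow> prev_real Z (Suc i) = i"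
  by (rule prev_real_eqI) auto

lemma conj_pair:
  assumes "1 \<le> j" "j \<le> DIM('n)" "\<not> real_flag j"
  shows "real_flag (Suc j)" "Z (Suc j) = cconj (Z j)" "Suc j \<le> DIM('n)"
proof -
  have "flag Z (j + 1) = cconj ` flag Z (j + 1) \<and> Z (j + 1) = cconj (Z j)"
    using adaptable assms unfolding adaptable_def real_flag_def by (metis atLeastAtMost_iff)
  then show "real_flag (Suc j)" "Z (Suc j) = cconj (Z j)" by (auto simp: real_flag_def)
  have "real_flag DIM('n)" unfolding real_flag_def flag_n by (metis cconj_cconj surjI)
  then have "j \<noteq> DIM('n)" using assms(3) by blast
  then show "Suc j \<le> DIM('n)" using assms(2) by simp
qed

lemma real_basis_vector:
  assumes "real_flag i" "real_flag (Suc i)" "Suc i \<le> DIM('n)"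
  shows "cconj (Z (Suc i)) = Z (Suc i)"
proof -
  have "Suc i \<in> {1..DIM('n)}" using assms(3) by simp
  then show ?thesis using adaptable assms(1,2) unfolding adaptable_def real_flag_def
    by (metis diff_Suc_1)
qed

text \<open>Between consecutive real members the flag grows by one real vector or by a conjugate
  pair. The case \<open>first\<close> covers real vectors and first members of pairs alike.\<close>

lemma block_cases:
  assumes "1 \<le> m" "m \<le> DIM('n)"
  obtains (first) i where "m = Suc i" "real_flag i" "prev_real Z m = i"
  | (second) i where "m = Suc (Suc i)" "real_flag i" "prev_real Z m = i" "Z m = cconj (Z (Suc i))"
proof -
  define i where "i = prev_real Z m"
  have i: "i < m" "real_flag i" "\<And>k. i < k \<Longrightarrow> k < m \<Longrightarrow> \<not> real_flag k"
    using prev_real[OF assms(1)] by (auto simp: i_def)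
  have pm: "prev_real Z m = i" by (simp add: i_def)
  show ?thesis
  proof (cases "m = Suc i")
    case True
    then show ?thesis by (rule first[OF _ i(2) pm])
  next
    case False
    then have "\<not> real_flag (Suc i)" using i by auto
    then have *: "real_flag (Suc (Suc i))" "Z (Suc (Suc i)) = cconj (Z (Suc i))"
      using conj_pair[of "Suc i"] i(1) assms(2) by auto
    have m: "m = Suc (Suc i)" using i False *(1) by (metis Suc_lessI lessI less_SucI)
    show ?thesis by (rule second[OF m i(2) pm]) (simp add: m *(2))
  qed
qed

text \<open>The second vector of a conjugate pair comes for free from closure under
  \<open>cconj\<close>, so only the first vector of each block has to be checked.\<close>

lemma block_induct:
  assumes S: "cplx.subspace S" and conj: "\<And>V. V \<in> S \<Longrightarrow> cconj V \<in> S"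
    and step: "\<And>i. real_flag i \<Longrightarrow> Suc i \<le> DIM('n) \<Longrightarrow> flag Z i \<subseteq> S \<Longrightarrow> Z (Suc i) \<in> S"
  shows "V \<in> S"
proof -
  have "m \<in> {1..DIM('n)} \<longrightarrow> Z m \<in> S" for m
  proof (induction m rule: less_induct)
    case (less m)
    show ?case
    proof
      assume m: "m \<in> {1..DIM('n)}"
      have sub: "flag Z i \<subseteq> S" if "i < m" for i
        unfolding flag_def using that m less by (intro cplx.span_minimal[OF _ S]) auto
      show "Z m \<in> S" using m[unfolded atLeastAtMost_iff, THEN conjunct1] m[unfolded atLeastAtMost_iff, THEN conjunct2]
      proof (cases rule: block_cases)
        case (first i)
        then show ?thesis using step sub m by auto
      next
        case (second i)
        then have "Z (Suc i) \<in> S" using less m by auto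
        then show ?thesis using conj second by simp
      qed
    qed
  qed
  then have "flag Z DIM('n) \<subseteq> S" unfolding flag_def by (intro cplx.span_minimal[OF _ S]) auto
  then show ?thesis by (auto simp: flag_n)
qed

lemma real_flag_parts:
  assumes "real_flag i" "V \<in> flag Z i"
  shows "of_re (fst V) \<in> flag Z i" "of_re (snd V) \<in> flag Z i"
proof -
  have c: "cconj V \<in> flag Z i" using assms by (auto simp: real_flag_def)
  have "of_re (fst V) = cscale (1 / 2) (V + cconj V)"
    by (simp add: of_re_def cscale_def cconj_def)
  then show "of_re (fst V) \<in> flag Z i" using c assms(2) by (auto intro: flag_scale flag_add)
  have "of_re (snd V) = cscale (- \<i> / 2) (V - cconj V)"
    by (simp add: of_re_def cscale_def cconj_def)
  then show "of_re (snd V) \<in> flag Z i" using c assms(2) by (metis flag_scale flag_diff)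
qed

lemma capply_of_re: "linear F \<Longrightarrow> capply f (cmap F (of_re V)) = of_real (blinfun_apply f (F V))"
  by (simp add: capply_def cmap_def of_re_def linear_0 complex_eq_iff)

lemma capply_cmap_parts: "capply f (cmap F V) = Complex (blinfun_apply f (F (fst V))) (blinfun_apply f (F (snd V)))"
  by (simp add: capply_def cmap_def)

section \<open>The slice condition\<close>

definition slice :: "nat \<Rightarrow> ('n \<Rightarrow>\<^sub>L real) \<Rightarrow> bool" where
  "slice m f \<longleftrightarrow> (\<forall>X. (\<forall>V\<in>flag Z (prev_real Z m). capply f (ad X V) = 0) \<longrightarrow>
     Re (cnj (capply f (Z m)) * capply f (ad X (Z m))) = 0)"

text \<open>The values at the second vector are the complex conjugates of those at the first, which
  does not change the real part.\<close>

lemma slice_second: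
  assumes "real_flag i" "prev_real Z (Suc (Suc i)) = i" "Z (Suc (Suc i)) = cconj (Z (Suc i))"
  shows "slice (Suc (Suc i)) f \<longleftrightarrow> slice (Suc i) f"
  using assms by (simp add: slice_def prev_real_Suc cmap_cconj[OF linear_lie] capply_cconj)

text \<open>For use in \<open>slice_exists\<close>: later corrections do not change f on lower flag
  members, so conditions already reached persist.\<close>

lemma slice_cong:
  assumes "1 \<le> m" "m \<le> j" "j \<le> DIM('n)" "\<And>V. V \<in> flag Z j \<Longrightarrow> capply f V = capply f' V"
  shows "slice m f \<longleftrightarrow> slice m f'"
proof -
  have Z: "Z m \<in> flag Z j" using assms by (intro basis_in_flag) auto
  have "flag Z (prev_real Z m) \<subseteq> flag Z j" using prev_real(1)[OF assms(1)] assms(2)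
    by (intro flag_mono) simp
  then have "capply f (ad X V) = capply f' (ad X V)" if "V \<in> flag Z (prev_real Z m)" for V X
    using assms(3,4) ad_flag that by blast
  moreover have "capply f (ad X (Z m)) = capply f' (ad X (Z m))" for X
    using assms(3,4) ad_flag Z by blast
  ultimately show ?thesis using assms(4)[OF Z] by (simp add: slice_def)
qed

text \<open>Outside \<open>e\<close> the condition is automatic at the first vector of a block: a
  radical vector with leading term \<open>Z (Suc i)\<close> shows that f([X, .]) = 0 on
  \<open>flag Z i\<close> implies f([X, \<open>Z (Suc i)\<close>]) = 0. A second vector inherits the
  condition from the first.\<close>

lemma Lambda_iff:
  "f \<in> Lambda N Z e j \<longleftrightarrow> f \<in> Omega N Z e j \<and> (\<forall>m\<in>{1..DIM('n)}. slice m f)"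
proof -
  interpret J: jump_form "lie N" Z f "DIM('n)" by (rule jump_form_N)
  have L: "f \<in> Lambda N Z e j \<longleftrightarrow> f \<in> Omega N Z e j \<and> (\<forall>m\<in>e. slice m f)"
    by (auto simp: Lambda_def slice_def)
  have "slice m f" if e: "\<forall>m\<in>e_set (lie N) Z f. slice m f" and m: "1 \<le> m" "m \<le> DIM('n)" for m
  proof -
    have first: "slice (Suc i) f" if i: "Suc i \<le> DIM('n)" "real_flag i" for i
    proof (cases "Suc i \<in> e_set (lie N) Z f")
      case False
      then have "has_lead Z (Suc i) (form_radical (lie N) f)"
        using J.has_lead_if_notin_e_set i by simp
      then obtain W where W: "W \<in> form_radical (lie N) f" "W - Z (Suc i) \<in> flag Z i"
        by (auto simp: has_lead_def)
      have "capply f (ad X (Z (Suc i))) = 0" if X: "\<forall>V\<in>flag Z i. capply f (ad X V) = 0"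
        for X
      proof -
        have "capply f (cbracket (lie N) (of_re X) W) = 0" using W(1) J.form_radical_iff by blast
        moreover have "capply f (ad X (W - Z (Suc i))) = 0" using W(2) X by blast
        ultimately show ?thesis by (simp add: cmap_diff[OF linear_lie] capply_diff)
      qed
      then show ?thesis using i by (simp add: slice_def prev_real_Suc)
    qed (use e in blast)
    show ?thesis using m
    proof (cases rule: block_cases)
      case (first i)
      then show ?thesis using \<open>\<And>i. Suc i \<le> DIM('n) \<Longrightarrow> real_flag i \<Longrightarrow> slice (Suc i) f\<close> m by simp
    next
      case (second i)
      then show ?thesis
        using \<open>\<And>i. Suc i \<le> DIM('n) \<Longrightarrow> real_flag i \<Longrightarrow> slice (Suc i) f\<close> m slice_second by simp
    qed
  qed
  then show ?thesis using J.e_set_subset unfolding L Omega_def by fastforce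
qed

section \<open>The cross-section for the nilpotent group\<close>

lemma coad_N_apply: "blinfun_apply (coad N g f) X = blinfun_apply f (inn (- g) X)"
proof -
  have "bounded_linear (\<lambda>X. blinfun_apply f (inn (- g) X))"
    by (intro bounded_linear_compose[OF blinfun.bounded_linear_right])
      (use linear_inn linear_conv_bounded_linear in blast)
  then show ?thesis by (simp add: coad_def Ad_N bounded_linear_Blinfun_apply)
qed

lemma capply_coad_N: "capply (coad N g f) V = capply f (cmap (inn (- g)) V)"
  by (simp add: capply_def cmap_def coad_N_apply)

lemma coad_N_mul: "coad N (g \<cdot> h) f = coad N g (coad N h f)"
  by (rule blinfun_eqI) (simp add: coad_N_apply minus_mul inn_mul)

lemma coad_N_0 [simp]: "coad N 0 f = f"
  by (rule blinfun_eqI) (simp add: coad_N_apply)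

lemma coad_orbit_N: "coad_orbit N f = range (\<lambda>g. coad N g f)"
  by (simp add: coad_orbit_def)

lemma bij_inn: "bij (cmap (inn g))"
  by (rule bij_cmap[of "inn (- g)"]) simp_all

lemma Omega_coad: "coad N g f \<in> Omega N Z e j \<longleftrightarrow> f \<in> Omega N Z e j"
proof -
  have "capply (coad N g f) (cbracket (lie N) U V) =
      capply f (cbracket (lie N) (cmap (inn (- g)) U) (cmap (inn (- g)) V))" for U V
    by (simp add: capply_coad_N cmap_cbracket[of "inn (- g)" "lie N" "lie N", OF linear_inn inn_lie])
  from jump_sets_pullback[where F="cmap (inn (- g))", OF bij_inn inn_image_flag this] show ?thesis
    by (simp add: Omega_def)
qed

text \<open>Going up the flag, vanishing on the previous member makes
  \<open>capply_inn_affine\<close> applicable, and invariance forces its linear term to be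
  0.\<close>

lemma inn_fixes_imp_ad_kills:
  assumes "\<And>V. V \<in> flag Z i \<Longrightarrow> capply f (cmap (inn X) V) = capply f V" "i \<le> DIM('n)"
    and "V \<in> flag Z i"
  shows "capply f (ad X V) = 0"
  using assms
proof (induction i arbitrary: V)
  case 0
  then show ?case by (simp add: cmap_zero linear_lie)
next
  case (Suc i)
  have "capply f (ad X W) = 0" if "W \<in> flag Z i" for W
    by (rule Suc.IH[OF Suc.prems(1)]) (use Suc.prems(2) that flag_mono[of i "Suc i" Z] in auto)
  then show ?case using capply_inn_affine[of i V f X] Suc.prems by simp
qed

lemma slice_unique:
  assumes "\<And>m. m \<in> {1..DIM('n)} \<Longrightarrow> slice m f" "\<And>m. m \<in> {1..DIM('n)} \<Longrightarrow> slice m (coad N g f)"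
  shows "coad N g f = f"
proof -
  let ?X = "- g"
  let ?S = "{V. capply f (cmap (inn ?X) V) = capply f (cmap (\<lambda>x. x) V)}"
  have "V \<in> ?S" for V
  proof (rule block_induct)
    show "cplx.subspace ?S"
      by (rule subspace_capply_cmap_eq[OF linear_inn]) (rule linear_id[unfolded id_def])
    show "cconj V \<in> ?S" if "V \<in> ?S" for V
      using that by (simp add: cmap_cconj[OF linear_inn] capply_cconj)
  next
    fix i assume i: "real_flag i" "Suc i \<le> DIM('n)" "flag Z i \<subseteq> ?S"
    have kill: "capply f (ad ?X V) = 0" if "V \<in> flag Z i" for V
      by (rule inn_fixes_imp_ad_kills[OF _ _ that]) (use i in auto)
    have aff: "capply f (cmap (inn ?X) V) = capply f V + capply f (ad ?X V)"
      if "V \<in> flag Z (Suc i)" for V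
      using capply_inn_affine[OF i(2) that kill] .
    have same: "capply (coad N g f) V = capply f V" if "V \<in> flag Z i" for V
      using i(3) that by (auto simp: capply_coad_N)
    define d where "d = capply f (ad ?X (Z (Suc i)))"
    have Z: "Z (Suc i) \<in> flag Z (Suc i)" by (rule basis_in_flag) auto
    have "Re (cnj (capply f (Z (Suc i))) * d) = 0"
      using assms(1)[of "Suc i"] i kill by (simp add: slice_def prev_real_Suc d_def)
    \<comment> \<open>This is the slice condition at the moved functional, whose value at
      \<open>Z (Suc i)\<close> is the old value plus the translation d. Subtracting the two
      conditions leaves |d|^2 = 0.\<close>
    moreover have "Re (cnj (capply f (Z (Suc i)) + d) * d) = 0"
    proof -
      have "\<forall>V\<in>flag Z i. capply (coad N g f) (ad ?X V) = 0"
        using same kill ad_flag i(2) by simp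
      moreover have "capply (coad N g f) (ad ?X (Z (Suc i))) = d"
        unfolding d_def by (rule same[OF ad_flag_Suc[OF i(2) Z]])
      moreover have "capply (coad N g f) (Z (Suc i)) = capply f (Z (Suc i)) + d"
        using aff[OF Z] by (simp add: capply_coad_N d_def)
      moreover have "slice (Suc i) (coad N g f)" using assms(2) i(2) by simp
      then have "(\<forall>V\<in>flag Z i. capply (coad N g f) (ad ?X V) = 0) \<longrightarrow>
          Re (cnj (capply (coad N g f) (Z (Suc i))) * capply (coad N g f) (ad ?X (Z (Suc i)))) = 0"
        unfolding slice_def prev_real_Suc[OF i(1)] by blast
      ultimately show ?thesis by simp
    qed
    ultimately have "Re (cnj d * d) = 0" by (simp add: algebra_simps)
    then have "d = 0" by (simp add: complex_eq_iff sum_squares_eq_zero_iff)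
    then show "Z (Suc i) \<in> ?S" using aff[OF Z] by (simp add: d_def)
  qed
  then have "capply (coad N g f) V = capply f V" for V by (simp add: capply_coad_N)
  then have "blinfun_apply (coad N g f) X = blinfun_apply f X" for X
    by (metis capply_def complex.inject fst_conv)
  then show ?thesis by (rule blinfun_eqI)
qed

text \<open>Go up the real flag members. The translations of f(Z) that leave f unchanged on lower
  members form a real subspace of the complex plane. Translating away the orthogonal projection of
  f(Z) onto it leaves a value orthogonal to all of them, which is the slice condition.\<close>

lemma slice_exists: "\<exists>g. \<forall>m\<in>{1..DIM('n)}. slice m (coad N g f)"
proof -
  have "\<exists>g. \<forall>m\<in>{1..i}. slice m (coad N g f)" if "real_flag i" "i \<le> DIM('n)"
    for i
    using that
  proof (induction i rule: less_induct)
    case (less k)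
    show ?case
    proof (cases "k = 0")
      case False
      define i where "i = prev_real Z k"
      have k1: "1 \<le> k" using False by simp
      have i: "i < k" "real_flag i" using prev_real[OF k1] by (auto simp: i_def)
      then have Si: "Suc i \<le> DIM('n)" "i \<le> DIM('n)" using less.prems by auto
      obtain g where g: "\<forall>m\<in>{1..i}. slice m (coad N g f)" using less i Si by blast
      define f1 where "f1 = coad N g f"
      define K where "K = {X. \<forall>V\<in>flag Z i. capply f1 (ad X V) = 0}"
      define w where "w X = capply f1 (ad X (Z (Suc i)))" for X
      have ad_lin: "ad (X + Y) V = ad X V + ad Y V" "ad (c *\<^sub>R X) V = cscale (of_real c) (ad X V)" for X Y V c
        by (simp_all add: cmap_def cscale_def bilinear_ladd[OF bilinear_lie] bilinear_lmul[OF bilinear_lie])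
      have lin_w: "linear w"
        by (rule linearI) (simp_all add: w_def ad_lin capply_add capply_cscale scaleR_conv_of_real)
      have "subspace K"
        using ad_lin(2)[of 0 0] by (intro subspaceI) (simp_all add: K_def ad_lin capply_add capply_cscale)
      then have sub: "subspace (w ` K)" using lin_w linear_subspace_image by blast
      \<comment> \<open>\<open>y\<close> is the part of the value that can be translated away,
        \<open>z\<close> the value that remains.\<close>
      obtain y z where yz: "y \<in> span (w ` K)" "\<And>v. v \<in> span (w ` K) \<Longrightarrow> orthogonal z v"
          "capply f1 (Z (Suc i)) = y + z"
        using orthogonal_subspace_decomp_exists[of "w ` K" "capply f1 (Z (Suc i))"] by metis
      have "y \<in> w ` K" using yz(1) sub unfolding span_eq_iff[symmetric] by metis
      then obtain X where X: "X \<in> K" "y = w X" by blast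
      define f2 where "f2 = coad N X f1"
      have kill: "capply f1 (ad (- X) V) = 0" if "V \<in> flag Z i" for V
        using X(1) that ad_lin(2)[of "-1" X V] by (auto simp: K_def capply_cscale capply_minus)
      have same: "capply f2 V = capply f1 V" if V: "V \<in> flag Z i" for V
      proof (cases i)
        case 0
        then show ?thesis using V by simp
      next
        case (Suc i')
        have "capply f1 (cmap (inn (- X)) V) = capply f1 V + capply f1 (ad (- X) V)"
          using Suc V Si kill flag_mono[of i' i Z] by (intro capply_inn_affine[of i']) auto
        then show ?thesis using kill[OF V] by (simp add: f2_def capply_coad_N)
      qed
      have Z: "Z (Suc i) \<in> flag Z (Suc i)" by (rule basis_in_flag) auto
      have "capply f2 (Z (Suc i)) = z"
        using capply_inn_affine[OF Si(1) Z kill] yz(3) X(2) ad_lin(2)[of "-1" X "Z (Suc i)"]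
        by (simp add: f2_def capply_coad_N w_def capply_cscale capply_minus)
      moreover have "capply f2 (ad Y (Z (Suc i))) = w Y" for Y
        unfolding w_def by (rule same[OF ad_flag_Suc[OF Si(1) Z]])
      moreover have "Y \<in> K" if "\<forall>V\<in>flag Z i. capply f2 (ad Y V) = 0" for Y
        using that same ad_flag[OF Si(2)] by (auto simp: K_def)
      moreover have "Re (cnj z * w Y) = 0" if "Y \<in> K" for Y
        using yz(2)[OF span_base, of "w Y"] that by (simp add: orthogonal_def inner_complex_def)
      ultimately have slice_Suc: "slice (Suc i) f2"
        using i by (simp add: slice_def prev_real_Suc)
      have "slice m f2" if m: "m \<in> {1..k}" for m
      proof (cases "m \<le> i")
        case True
        then show ?thesis
          using slice_cong[of m i f2 f1] same g m Si by (simp add: f1_def)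
      next
        case False
        have "k \<le> DIM('n)" "1 \<le> k" using less.prems k1 by auto
        from this(2,1) have "m = Suc i \<or> (m = Suc (Suc i) \<and> prev_real Z m = i \<and> Z m = cconj (Z (Suc i)))"
        proof (cases rule: block_cases)
          case (first i')
          then show ?thesis using False m i_def by simp
        next
          case (second i')
          then show ?thesis using False m i_def by (auto simp: le_Suc_eq)
        qed
        then show ?thesis using slice_Suc slice_second i(2) by metis
      qed
      then show ?thesis unfolding f2_def f1_def by (metis coad_N_mul)
    qed auto
  qed
  moreover have "real_flag DIM('n)" unfolding real_flag_def flag_n by (metis cconj_cconj surjI)
  ultimately show ?thesis by blast
qed

lemma Lambda_unique: "f \<in> Lambda N Z e j \<Longrightarrow> coad N g f \<in> Lambda N Z e j \<Longrightarrow> coad N g f = f"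
  by (rule slice_unique) (auto simp: Lambda_iff)

lemma Lambda_exists: "f \<in> Omega N Z e j \<Longrightarrow> \<exists>g. coad N g f \<in> Lambda N Z e j"
  using slice_exists[of f] by (simp add: Lambda_iff Omega_coad)

lemma to_Lambda_eq:
  assumes "coad N g f \<in> Lambda N Z e j"
  shows "to_Lambda N Z e j f = coad N g f"
  unfolding to_Lambda_def
proof (rule the_equality)
  show "coad N g f \<in> Lambda N Z e j \<inter> coad_orbit N f" using assms
    by (auto simp: coad_orbit_N)
  fix f' assume "f' \<in> Lambda N Z e j \<inter> coad_orbit N f"
  then obtain h where h: "f' = coad N h f" "coad N h f \<in> Lambda N Z e j"
    by (auto simp: coad_orbit_N)
  have "coad N h f = coad N (h \<cdot> (- g)) (coad N g f)"
    by (simp add: mul_assoc flip: coad_N_mul)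
  then show "f' = coad N g f" using Lambda_unique[OF assms] h by metis
qed

section \<open>The stabilizer in \<open>\<hh>\<close>\<close>

lemma linear_lam: "m \<in> {1..DIM('n)} \<Longrightarrow> linear (lam m)"
  using adaptable unfolding adaptable_def by blast

lemma Re_weight: "Re (weight lam \<alpha> m B) = lam m B"
  by (simp add: weight_def)

lemma weight_eq_0_iff: "weight lam \<alpha> m B = 0 \<longleftrightarrow> lam m B = 0"
proof -
  have "1 + \<i> * complex_of_real (\<alpha> m) \<noteq> 0" by (simp add: complex_eq_iff)
  then show ?thesis by (simp add: weight_def)
qed

lemma mem_stabilizer_iff:
  "B \<in> stabilizer_algebra TYPE('n) lam \<alpha> e \<longleftrightarrow> (\<forall>m\<in>{1..DIM('n)} - e. lam m B = 0)"
  by (simp add: stabilizer_algebra_def nu_def weight_eq_0_iff)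

lemma subspace_stabilizer: "subspace (stabilizer_algebra TYPE('n) lam \<alpha> e)"
  by (rule subspaceI)
    (auto simp: mem_stabilizer_iff linear_0[OF linear_lam] linear_add[OF linear_lam] linear_scale[OF linear_lam])

lemma capply_D_Z:
  "m \<in> {1..DIM('n)} \<Longrightarrow> capply f (cmap (D B) (Z m)) = weight lam \<alpha> m B * capply f (Z m)"
  by (simp add: D_Z capply_cscale)

lemma subspace_D_kernel: "cplx.subspace {V. capply f (cmap (D B) V) = 0}"
  by (rule cplx.subspaceI)
    (simp_all add: cmap_zero cmap_add cmap_cscale linear_D capply_add capply_cscale)

lemma D_kernel_cconj: "capply f (cmap (D B) V) = 0 \<Longrightarrow> capply f (cmap (D B) (cconj V)) = 0"
  by (simp add: cmap_cconj[OF linear_D] capply_cconj)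

lemma capply_cmap_UNIV:
  "(\<And>V. capply f (cmap F V) = capply f' (cmap F' V)) \<Longrightarrow> blinfun_apply f (F X) = blinfun_apply f' (F' X)"
  by (metis capply_cmap_parts complex.inject fst_conv)

text \<open>A direction \<open>B \<in> \<hh>\<close> which is tangent to the \<open>N\<close>-orbit at a point of the slice fixes
  this point: on the first block where it does not, the slice condition says that the real part of
  \<open>\<gamma>(B) |f(Z)|\<^sup>2\<close> vanishes, and \<open>\<gamma>(B)\<close> is a real multiple of \<open>1 + \<i>\<alpha>\<close>.\<close>

lemma D_eq_0_if_tangent:
  assumes slice: "\<And>m. m \<in> {1..DIM('n)} \<Longrightarrow> slice m f"
    and tangent: "\<And>X. blinfun_apply f (D B X) = blinfun_apply f (lie N Y X)"
  shows "blinfun_apply f (D B X) = 0"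
proof -
  let ?S = "{V. capply f (cmap (D B) V) = 0}"
  have tan: "capply f (cmap (D B) V) = capply f (ad Y V)" for V
    by (simp add: capply_cmap_parts tangent)
  have "V \<in> ?S" for V
  proof (rule block_induct[OF subspace_D_kernel])
    fix i assume i: "real_flag i" "Suc i \<le> DIM('n)" "flag Z i \<subseteq> ?S"
    let ?w = "capply f (Z (Suc i))" and ?c = "weight lam \<alpha> (Suc i) B"
    have "\<forall>V\<in>flag Z i. capply f (ad Y V) = 0" using i(3) tan by auto
    then have "Re (cnj ?w * capply f (ad Y (Z (Suc i)))) = 0"
      using slice[of "Suc i"] i unfolding slice_def prev_real_Suc[OF i(1)] by auto
    moreover have "capply f (ad Y (Z (Suc i))) = ?c * ?w"
      using i(2) by (simp add: capply_D_Z flip: tan)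
    moreover have "cnj ?w * (?c * ?w) = ?c * of_real ((cmod ?w)\<^sup>2)"
      by (simp only: complex_norm_square) (simp add: algebra_simps)
    ultimately have "lam (Suc i) B * (cmod ?w)\<^sup>2 = 0"
      by (simp add: Re_weight del: of_real_power)
    then have "?c * ?w = 0" by (auto simp: weight_eq_0_iff)
    then show "Z (Suc i) \<in> ?S" using i(2) by (simp add: capply_D_Z)
  qed (simp add: D_kernel_cconj)
  then show ?thesis using capply_cmap_parts[of f "D B" "of_re X"]
    by (simp add: of_re_def complex_eq_iff)
qed

lemma linear_form_left: "linear (\<lambda>X. blinfun_apply f (lie N X V))"
  by (intro linear_compose[OF linear_lie_left, unfolded o_def] bounded_linear.linear blinfun.bounded_linear_right)

lemma linear_form_right: "linear (\<lambda>V. blinfun_apply f (lie N X V))"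
  by (intro linear_compose[OF linear_lie, unfolded o_def] bounded_linear.linear blinfun.bounded_linear_right)

lemma linear_form_D: "linear (\<lambda>X. blinfun_apply f (D B X))"
  by (intro linear_compose[OF linear_D, unfolded o_def] bounded_linear.linear blinfun.bounded_linear_right)

lemma linear_form_D_left: "linear (\<lambda>B. blinfun_apply f (D B X))"
  by (intro linear_compose[OF linear_D_left, unfolded o_def] bounded_linear.linear blinfun.bounded_linear_right)

text \<open>If \<open>f(Z) \<noteq> 0\<close> at the start of a block then, by the slice condition, the real vector
  \<open>cnj f(Z) Z + f(Z) cnj Z\<close> agrees with an element of the radical modulo the preceding
  flag member, so the last index of the block is no jump index.\<close>

lemma block_not_jump:
  assumes f: "f \<in> Lambda N Z e j" and i: "real_flag i" "Suc i \<le> DIM('n)"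
    and w: "capply f (Z (Suc i)) \<noteq> 0"
  obtains b where "b \<in> {1..DIM('n)} - e" "Z b = Z (Suc i) \<or> Z b = cconj (Z (Suc i))"
proof -
  interpret J: jump_form "lie N" Z f "DIM('n)" by (rule jump_form_N)
  let ?Z = "Z (Suc i)" and ?w = "capply f (Z (Suc i))"
  \<comment> \<open>\<open>P\<close> is a real vector with f([X, P]) = 2 Re(cnj f(Z) f([X, Z])), so
    the slice condition supplies the annihilation hypothesis of
    \<open>functional_in_family\<close>.\<close>
  define P where "P = cscale (cnj ?w) ?Z + cscale ?w (cconj ?Z)"
  have P: "P = of_re (fst P)"
    by (simp add: P_def of_re_def cscale_def cconj_def prod_eq_iff)
  have e: "e = e_set (lie N) Z f" and slice: "slice (Suc i) f"
    using f i by (auto simp: Lambda_iff Omega_def)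
  have "subspace {V. of_re V \<in> flag Z i}"
  proof (rule subspaceI; safe)
    show "of_re 0 \<in> flag Z i" using flag_zero by (simp add: of_re_def flip: zero_prod_def)
    show "of_re (x + y) \<in> flag Z i" if "of_re x \<in> flag Z i" "of_re y \<in> flag Z i" for x y
      using flag_add[OF that] by (simp add: of_re_def)
    show "of_re (c *\<^sub>R x) \<in> flag Z i" if "of_re x \<in> flag Z i" for c x
      using flag_scale[OF that, of "of_real c"] by (simp add: of_re_def cscale_def)
  qed
  moreover have "blinfun_apply f (lie N X (fst P)) = 0"
    if "\<And>V. V \<in> {V. of_re V \<in> flag Z i} \<Longrightarrow> blinfun_apply f (lie N X V) = 0" for X
  proof -
    have "\<forall>V\<in>flag Z i. capply f (ad X V) = 0"
      using that real_flag_parts[OF i(1)] by (simp add: capply_cmap_parts complex_eq_iff)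
    then have "Re (cnj ?w * capply f (ad X ?Z)) = 0"
      using slice unfolding slice_def prev_real_Suc[OF i(1)] by blast
    then have "capply f (ad X P) = 0"
      by (simp add: P_def cmap_add[OF linear_lie] cmap_cscale[OF linear_lie] cmap_cconj[OF linear_lie]
          capply_add capply_cscale capply_cconj complex_eq_iff)
    then show ?thesis by (simp add: capply_cmap_parts complex_eq_iff)
  qed
  ultimately have "\<exists>V\<in>{V. of_re V \<in> flag Z i}.
      \<forall>X. blinfun_apply f (lie N X (fst P)) = blinfun_apply f (lie N X V)"
    by (intro functional_in_family linear_form_left linear_form_right) auto
  then obtain V where V: "of_re V \<in> flag Z i"
      "\<And>X. blinfun_apply f (lie N X (fst P)) = blinfun_apply f (lie N X V)" by blast
  have rad: "P - of_re V \<in> form_radical (lie N) f"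
    unfolding J.form_radical_iff
  proof
    fix U
    have "cbracket (lie N) U (P - of_re V) = (lie N (fst U) (fst P - V), lie N (snd U) (fst P - V))"
      by (subst P) (simp add: cbracket_def of_re_def linear_0[OF linear_lie])
    then show "J.form U (P - of_re V) = 0"
      by (simp add: capply_def V(2) linear_diff[OF linear_lie] blinfun.diff_right complex_eq_iff)
  qed
  have lead: "b \<notin> e" if "1 \<le> b" "c \<noteq> 0" "P - of_re V - cscale c (Z b) \<in> flag Z (b - 1)" for b c
  proof -
    have "cscale (1 / c) (P - of_re V) \<in> form_radical (lie N) f"
      using rad by (simp add: J.form_radical_iff J.form_cscale_right)
    moreover have "cscale (1 / c) (P - of_re V) - Z b \<in> flag Z (b - 1)"
      using flag_scale[OF that(3), of "1 / c"] that(2) by (simp add: cplx.scale_right_diff_distrib)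
    ultimately have "has_lead Z b (form_radical (lie N) f)" by (auto simp: has_lead_def)
    then show ?thesis using J.no_lead_if_in_e_set e by blast
  qed
  show ?thesis
  proof (cases "real_flag (Suc i)")
    case True
    have Z: "cconj ?Z = ?Z" by (rule real_basis_vector[OF i(1) True i(2)])
    then have "cnj ?w = ?w" by (metis capply_cconj)
    then have "P = cscale (2 * ?w) ?Z" by (simp add: P_def Z cplx.scale_left_distrib[symmetric])
    then have "P - of_re V - cscale (2 * ?w) ?Z \<in> flag Z (Suc i - 1)"
      using flag_diff[OF flag_zero V(1)] by simp
    from lead[OF _ _ this] show ?thesis using that[of "Suc i"] i(2) w by auto
  next
    case False
    then have Z: "Z (Suc (Suc i)) = cconj ?Z" "Suc (Suc i) \<le> DIM('n)"
      using conj_pair[of "Suc i"] i(2) by auto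
    have "cscale (cnj ?w) ?Z \<in> flag Z (Suc i)" by (intro flag_scale basis_in_flag) auto
    moreover have "of_re V \<in> flag Z (Suc i)" using V(1) flag_mono[of i "Suc i" Z] by auto
    ultimately have "P - of_re V - cscale ?w (Z (Suc (Suc i))) \<in> flag Z (Suc (Suc i) - 1)"
      using flag_diff by (simp add: P_def Z)
    from lead[OF _ w this] show ?thesis using that[of "Suc (Suc i)"] Z by auto
  qed
qed

text \<open>On a block where f(Z) = 0 the eigenvalue equation gives 0. Otherwise
  \<open>block_not_jump\<close> finds a non-jump index in the block, where the weight of
  \<open>B\<close> vanishes, and conjugation carries this to the other vector of a pair.\<close>

lemma D_eq_0_if_stabilizer:
  assumes f: "f \<in> Lambda N Z e j" and B: "B \<in> stabilizer_algebra TYPE('n) lam \<alpha> e"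
  shows "blinfun_apply f (D B X) = 0"
proof -
  let ?S = "{V. capply f (cmap (D B) V) = 0}"
  have "V \<in> ?S" for V
  proof (rule block_induct[OF subspace_D_kernel])
    fix i assume i: "real_flag i" "Suc i \<le> DIM('n)" "flag Z i \<subseteq> ?S"
    show "Z (Suc i) \<in> ?S"
    proof (cases "capply f (Z (Suc i)) = 0")
      case True
      then show ?thesis using i(2) by (simp add: capply_D_Z)
    next
      case False
      then obtain b where b: "b \<in> {1..DIM('n)} - e" "Z b = Z (Suc i) \<or> Z b = cconj (Z (Suc i))"
        using block_not_jump[OF f i(1,2)] by blast
      then have "capply f (cmap (D B) (Z b)) = 0"
        using B by (simp add: capply_D_Z mem_stabilizer_iff weight_eq_0_iff)
      then show ?thesis using b(2) D_kernel_cconj[of f B "Z b"] by auto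
    qed
  qed (simp add: D_kernel_cconj)
  then show ?thesis using capply_cmap_parts[of f "D B" "of_re X"]
    by (simp add: of_re_def complex_eq_iff)
qed

lemma stabilizer_if_D_eq_0:
  assumes f: "f \<in> Lambda_nu N Z e j" and B: "\<And>X. blinfun_apply f (D B X) = 0"
  shows "B \<in> stabilizer_algebra TYPE('n) lam \<alpha> e"
  unfolding mem_stabilizer_iff
proof
  fix m assume m: "m \<in> {1..DIM('n)} - e"
  then have "capply f (Z m) \<noteq> 0" using f by (simp add: Lambda_nu_def nu_def)
  moreover have "weight lam \<alpha> m B * capply f (Z m) = 0"
    using m B capply_D_Z[of m f B] by (simp add: capply_cmap_parts complex_eq_iff)
  ultimately show "lam m B = 0" by (simp add: weight_eq_0_iff)
qed

lemma Lambda_nu_slice: "f \<in> Lambda_nu N Z e j \<Longrightarrow> m \<in> {1..DIM('n)} \<Longrightarrow> slice m f"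
  by (simp add: Lambda_nu_def Lambda_iff)

lemma stabilizer_if_tangent:
  assumes "f \<in> Lambda_nu N Z e j" "\<And>X. blinfun_apply f (D B X) = blinfun_apply f (lie N Y X)"
  shows "B \<in> stabilizer_algebra TYPE('n) lam \<alpha> e"
  using stabilizer_if_D_eq_0[OF assms(1)] D_eq_0_if_tangent[OF Lambda_nu_slice[OF assms(1)] assms(2)]
  by blast

text \<open>Apply duality to the functionals f([Y, .]), whose common kernel is the radical of f: f(D
  B .) must be one of them, and then \<open>B\<close> is tangent to the N-orbit.\<close>

lemma stabilizer_if_annihilates:
  assumes f: "f \<in> Lambda_nu N Z e j"
    and ann: "\<And>X. (\<And>Y. blinfun_apply f (lie N Y X) = 0) \<Longrightarrow> blinfun_apply f (D B X) = 0"
  shows "B \<in> stabilizer_algebra TYPE('n) lam \<alpha> e"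
proof -
  have "\<exists>Y\<in>UNIV. \<forall>X. blinfun_apply f (D B X) = blinfun_apply f (lie N Y X)"
    by (rule functional_in_family) (simp_all add: linear_form_left linear_form_right linear_form_D ann)
  then obtain Y where "\<And>X. blinfun_apply f (D B X) = blinfun_apply f (lie N Y X)" by blast
  then show ?thesis using stabilizer_if_tangent[OF f] by blast
qed

lemma capply_image_Z_eq:
  assumes "linear F" "\<And>m. m \<in> {1..DIM('n)} \<Longrightarrow> capply f (cmap F (Z m)) = capply f (Z m)"
  shows "blinfun_apply f (F X) = blinfun_apply f X"
proof -
  have "cplx.subspace {V. capply f (cmap F V) = capply f (cmap (\<lambda>x. x) V)}"
    by (rule subspace_capply_cmap_eq[OF assms(1)]) (rule linear_id[unfolded id_def])
  moreover have "Z ` {1..DIM('n)} \<subseteq> {V. capply f (cmap F V) = capply f (cmap (\<lambda>x. x) V)}"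
    using assms(2) by auto
  ultimately have "flag Z DIM('n) \<subseteq> {V. capply f (cmap F V) = capply f (cmap (\<lambda>x. x) V)}"
    unfolding flag_def by (rule cplx.span_minimal[rotated])
  then have "capply f (cmap F V) = capply f (cmap (\<lambda>x. x) V)" for V by (auto simp: flag_n)
  then show ?thesis by (rule capply_cmap_UNIV)
qed

section \<open>The action of \<open>H\<close> on the slice\<close>

definition hact :: "'h \<Rightarrow> ('n \<Rightarrow>\<^sub>L real) \<Rightarrow> ('n \<Rightarrow>\<^sub>L real)" where
  "hact B f = Blinfun (\<lambda>X. blinfun_apply f (\<eta> (- B) X))"

lemma hact_apply: "blinfun_apply (hact B f) X = blinfun_apply f (\<eta> (- B) X)"
proof -
  have "bounded_linear (\<lambda>X. blinfun_apply f (\<eta> (- B) X))"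
    by (intro bounded_linear_compose[OF blinfun.bounded_linear_right])
      (use linear_\<eta> linear_conv_bounded_linear in blast)
  then show ?thesis by (simp add: hact_def bounded_linear_Blinfun_apply)
qed

lemma capply_hact: "capply (hact B f) V = capply f (cmap (\<eta> (- B)) V)"
  by (simp add: capply_def cmap_def hact_apply)

lemma lam_minus: "m \<in> {1..DIM('n)} \<Longrightarrow> lam m (- B) = - lam m B"
  using linear_neg[OF linear_lam] by blast

lemma capply_hact_Z:
  "m \<in> {1..DIM('n)} \<Longrightarrow> capply (hact B f) (Z m) = exp (- weight lam \<alpha> m B) * capply f (Z m)"
  by (simp add: capply_hact \<eta>_Z capply_cscale weight_def lam_minus)

lemma cmod_hact_Z:
  "m \<in> {1..DIM('n)} \<Longrightarrow> cmod (capply (hact B f) (Z m)) = exp (- lam m B) * cmod (capply f (Z m))"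
  by (simp add: capply_hact_Z norm_mult Re_weight)

lemma Omega_hact: "hact B f \<in> Omega N Z e j \<longleftrightarrow> f \<in> Omega N Z e j"
proof -
  have form: "capply (hact B f) (cbracket (lie N) U V) =
      capply f (cbracket (lie N) (cmap (\<eta> (- B)) U) (cmap (\<eta> (- B)) V))" for U V
    by (simp add: capply_hact cmap_cbracket[of "\<eta> (- B)" "lie N" "lie N", OF linear_\<eta> \<eta>_lie])
  have "bij (cmap (\<eta> (- B)))" by (rule bij_cmap[of "\<eta> B"]) simp_all
  from jump_sets_pullback[where F="cmap (\<eta> (- B))", OF this \<eta>_image_flag form] show ?thesis
    by (simp add: Omega_def)
qed

text \<open>H preserves the flag and hence permutes the admissible \<open>X\<close>. Since it acts
  on \<open>Z m\<close> by a scalar, the slice expression is multiplied by a squared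
  modulus.\<close>

lemma slice_hact:
  assumes m: "m \<in> {1..DIM('n)}" and f: "slice m f"
  shows "slice m (hact B f)"
  unfolding slice_def
proof (intro allI impI)
  fix X assume X: "\<forall>V\<in>flag Z (prev_real Z m). capply (hact B f) (ad X V) = 0"
  let ?X = "\<eta> (- B) X" and ?c = "exp (- weight lam \<alpha> m B)"
  have push: "capply (hact B f) (ad X V) = capply f (ad ?X (cmap (\<eta> (- B)) V))" for V
    by (simp add: capply_hact cmap_def \<eta>_lie)
  have *: "capply f (ad ?X V) = 0" if "V \<in> flag Z (prev_real Z m)" for V
  proof -
    have "cmap (\<eta> B) V \<in> flag Z (prev_real Z m)" using that by (rule \<eta>_flag)
    then have "capply (hact B f) (ad X (cmap (\<eta> B) V)) = 0" using X by blast
    then show ?thesis unfolding push by (simp add: cmap_def)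
  qed
  have Re_of_real: "Re (of_real c * z) = c * Re z" for c z by simp
  from * have s: "Re (cnj (capply f (Z m)) * capply f (ad ?X (Z m))) = 0"
    using f unfolding slice_def by blast
  have "cmap (\<eta> (- B)) (Z m) = cscale ?c (Z m)"
    using m by (simp add: \<eta>_Z weight_def lam_minus)
  then have "capply (hact B f) (ad X (Z m)) = ?c * capply f (ad ?X (Z m))"
    by (simp add: push cmap_cscale[OF linear_lie] capply_cscale)
  moreover have "capply (hact B f) (Z m) = ?c * capply f (Z m)" by (rule capply_hact_Z[OF m])
  ultimately have "cnj (capply (hact B f) (Z m)) * capply (hact B f) (ad X (Z m)) =
      of_real ((cmod ?c)\<^sup>2) * (cnj (capply f (Z m)) * capply f (ad ?X (Z m)))"
    unfolding complex_norm_square by (simp add: algebra_simps)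
  then show "Re (cnj (capply (hact B f) (Z m)) * capply (hact B f) (ad X (Z m))) = 0"
    using s Re_of_real by (simp only: mult_zero_right)
qed

lemma Lambda_hact: "f \<in> Lambda N Z e j \<Longrightarrow> hact B f \<in> Lambda N Z e j"
  by (simp add: Lambda_iff Omega_hact slice_hact)

lemma Lambda_nu_hact: "f \<in> Lambda_nu N Z e j \<Longrightarrow> hact B f \<in> Lambda_nu N Z e j"
  by (simp add: Lambda_nu_def Lambda_hact nu_def capply_hact_Z)

text \<open>For each m the weight of \<open>B\<close> or the value at \<open>Z m\<close> is 0, so
  the factor exp(-weight) has no effect.\<close>

lemma hact_stabilizer:
  assumes f: "f \<in> Lambda N Z e j" and B: "B \<in> stabilizer_algebra TYPE('n) lam \<alpha> e"
  shows "hact B f = f"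
proof (rule blinfun_eqI)
  fix X
  have "capply f (cmap (\<eta> (- B)) (Z m)) = capply f (Z m)" if m: "m \<in> {1..DIM('n)}" for m
  proof -
    have "weight lam \<alpha> m B * capply f (Z m) = 0"
      using D_eq_0_if_stabilizer[OF f B] capply_D_Z[OF m, of f B]
      by (simp add: capply_cmap_parts complex_eq_iff)
    then have "exp (- weight lam \<alpha> m B) * capply f (Z m) = capply f (Z m)" by auto
    then show ?thesis using capply_hact_Z[OF m] by (simp add: capply_hact)
  qed
  then show "blinfun_apply (hact B f) X = blinfun_apply f X"
    unfolding hact_apply by (rule capply_image_Z_eq[OF linear_\<eta>])
qed

end

section \<open>Jump indices of the semidirect product\<close>

lemma full_basis_le: "q \<le> DIM('n) \<Longrightarrow> full_basis p Z A q = incl_n (Z q)"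
  for Z :: "nat \<Rightarrow> 'n::euclidean_space \<times> 'n"
  by (simp add: full_basis_def)

lemma flag_full_basis_le:
  fixes Z :: "nat \<Rightarrow> 'n::euclidean_space \<times> 'n" and A :: "nat \<Rightarrow> 'h::real_vector"
  assumes "q \<le> DIM('n)"
  shows "flag (full_basis p Z A) q = incl_n ` flag Z q"
  using assms
proof (induction q)
  case 0
  then show ?case by (simp add: incl_n_def zero_prod_def)
next
  case (Suc q)
  have add: "incl_n (V + W) = (incl_n V + incl_n W :: ('n \<times> 'h) \<times> ('n \<times> 'h))"
    and diff: "incl_n (V - W) = (incl_n V - incl_n W :: ('n \<times> 'h) \<times> ('n \<times> 'h))" for V W :: "'n \<times> 'n"
    by (simp_all add: incl_n_def)
  let ?i = "incl_n :: 'n \<times> 'n \<Rightarrow> ('n \<times> 'h) \<times> ('n \<times> 'h)"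
  have "W \<in> flag (full_basis p Z A) (Suc q) \<longleftrightarrow> W \<in> ?i ` flag Z (Suc q)" for W
  proof
    assume "W \<in> flag (full_basis p Z A) (Suc q)"
    then obtain c V where cV: "W - cscale c (?i (Z (Suc q))) = ?i V" "V \<in> flag Z q"
      using Suc by (auto simp: flag_Suc full_basis_le)
    then have "W = ?i (V + cscale c (Z (Suc q)))" by (simp add: add cscale_incl_n algebra_simps)
    moreover have "V + cscale c (Z (Suc q)) \<in> flag Z (Suc q)" using cV(2)
      by (auto simp: flag_Suc intro!: exI[of _ c])
    ultimately show "W \<in> ?i ` flag Z (Suc q)" by blast
  next
    assume "W \<in> ?i ` flag Z (Suc q)"
    then obtain V c where V: "W = ?i V" "V - cscale c (Z (Suc q)) \<in> flag Z q"
      by (auto simp: flag_Suc)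
    then have "W - cscale c (?i (Z (Suc q))) = ?i (V - cscale c (Z (Suc q)))"
      by (simp add: diff cscale_incl_n)
    then show "W \<in> flag (full_basis p Z A) (Suc q)"
      using V(2) Suc by (auto simp: flag_Suc full_basis_le intro!: exI[of _ c])
  qed
  then show ?case by blast
qed

locale normalized = adapted N \<eta> Z lam \<alpha>
  for N :: "'n::euclidean_space monoid" and \<eta> :: "'h::real_normed_vector \<Rightarrow> 'n \<Rightarrow> 'n"
    and Z :: "nat \<Rightarrow> 'n \<times> 'n" and lam :: "nat \<Rightarrow> 'h \<Rightarrow> real" and \<alpha> :: "nat \<Rightarrow> real" +
  fixes e j :: "nat set" and p r :: nat and A :: "nat \<Rightarrow> 'h" and s \<iota> :: "nat \<Rightarrow> nat"
  assumes basis_of_h: "basis_of_h p A"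
    and normalized: "normalized_basis N \<eta> Z lam \<alpha> e j p A r s \<iota>"
begin

abbreviation "Z' \<equiv> full_basis p Z A"

text \<open>A representative over f. Brackets of \<gg> lie in \<nn>, so the skew form, and with it
  the jump data, depends only on the restriction to \<nn>.\<close>

definition lift_n :: "('n \<Rightarrow>\<^sub>L real) \<Rightarrow> (('n \<times> 'h) \<Rightarrow>\<^sub>L real)" where
  "lift_n f = Blinfun (\<lambda>V. blinfun_apply f (fst V))"

lemma lift_n_apply [simp]: "blinfun_apply (lift_n f) V = blinfun_apply f (fst V)"
proof -
  have "bounded_linear (\<lambda>V :: 'n \<times> 'h. blinfun_apply f (fst V))"
    by (intro bounded_linear_compose[OF blinfun.bounded_linear_right] bounded_linear_fst)
  then show ?thesis by (simp add: lift_n_def bounded_linear_Blinfun_apply)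
qed

lemma restrict_n_apply [simp]: "blinfun_apply (restrict_n l) X = blinfun_apply l (X, 0)"
proof -
  have "bounded_linear (\<lambda>X. blinfun_apply l (X, 0))"
    by (intro bounded_linear_compose[OF blinfun.bounded_linear_right] bounded_linear_Pair
        bounded_linear_ident bounded_linear_zero)
  then show ?thesis by (simp add: restrict_n_def bounded_linear_Blinfun_apply)
qed

lemma restrict_n_lift_n [simp]: "restrict_n (lift_n f) = f"
  by (rule blinfun_eqI) simp

lemma Omega_nu_if_Lambda_nu:
  assumes "restrict_n l \<in> Lambda_nu N Z e j"
  shows "l \<in> Omega_nu N Z e j"
proof -
  have L: "restrict_n l \<in> Lambda N Z e j" using assms by (simp add: Lambda_nu_def)
  then have "to_Lambda N Z e j (restrict_n l) = restrict_n l"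
    using to_Lambda_eq[of 0 "restrict_n l"] by simp
  then show ?thesis using L assms by (simp add: Omega_nu_def Lambda_iff)
qed

text \<open>The basis of \<hh> is appended in reversed order: position m > n holds
  \<open>A (n + p + 1 - m)\<close>, so a flag member reaches only the last vectors of the family
  \<open>A\<close>.\<close>

lemma linear_snd_flag:
  assumes "DIM('n) \<le> m" "m \<le> DIM('n) + p" "W \<in> flag Z' m"
  shows "snd (fst W) \<in> span (A ` {DIM('n) + p + 1 - m..p})"
proof -
  let ?S = "span (A ` {DIM('n) + p + 1 - m..p})"
  let ?T = "{W :: ('n \<times> 'h) \<times> ('n \<times> 'h). snd (fst W) \<in> ?S \<and> snd (snd W) \<in> ?S}"
  have "cplx.subspace ?T"
    by (rule cplx.subspaceI)
      (auto simp: cscale_def span_zero span_add span_diff span_scale)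
  moreover have "Z' ` {1..m} \<subseteq> ?T"
  proof (rule image_subsetI)
    fix i assume i: "i \<in> {1..m}"
    show "Z' i \<in> ?T"
    proof (cases "i \<le> DIM('n)")
      case True
      then show ?thesis by (simp add: full_basis_le incl_n_def span_zero)
    next
      case False
      then have "A (p + DIM('n) + 1 - i) \<in> ?S"
        using i assms by (intro span_base imageI) auto
      then show ?thesis using False by (simp add: full_basis_def of_re_def span_zero)
    qed
  qed
  ultimately have "flag Z' m \<subseteq> ?T" unfolding flag_def by (rule cplx.span_minimal[rotated])
  then show ?thesis using assms(3) by auto
qed

lemma flag_Z': "flag Z' (DIM('n) + p) = UNIV"
proof -
  let ?F = "flag Z' (DIM('n) + p)"
  have n: "incl_n V \<in> ?F" for V
    using flag_full_basis_le[of "DIM('n)" p Z A] flag_mono[of "DIM('n)" "DIM('n) + p" Z'] flag_n by auto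
  have "subspace {B. of_re (0, B) \<in> ?F}"
  proof (rule subspaceI; safe)
    show "of_re (0, 0) \<in> ?F" using flag_zero[of Z' "DIM('n) + p"]
      by (simp add: of_re_def zero_prod_def)
    show "of_re (0, x + y) \<in> ?F" if "of_re (0, x) \<in> ?F" "of_re (0, y) \<in> ?F" for x y
      using flag_add[OF that] by (simp add: of_re_def)
    show "of_re (0, c *\<^sub>R x) \<in> ?F" if "of_re (0, x) \<in> ?F" for c x
      using flag_scale[OF that, of "of_real c"] by (simp add: of_re_def cscale_def zero_prod_def)
  qed
  moreover have "A ` {1..p} \<subseteq> {B. of_re (0, B) \<in> ?F}"
  proof (rule image_subsetI)
    fix q assume q: "q \<in> {1..p}"
    then have "Z' (DIM('n) + p + 1 - q) = of_re (0, A q)" by (auto simp: full_basis_def)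
    moreover have "Z' (DIM('n) + p + 1 - q) \<in> ?F" using q by (intro basis_in_flag) auto
    ultimately show "A q \<in> {B. of_re (0, B) \<in> ?F}" by simp
  qed
  ultimately have "span (A ` {1..p}) \<subseteq> {B. of_re (0, B) \<in> ?F}"
    by (rule span_minimal[rotated])
  then have h: "of_re (0, B) \<in> ?F" for B using basis_of_h by (auto simp: basis_of_h_def)
  have "W \<in> ?F" for W
  proof -
    obtain X1 B1 X2 B2 where W: "W = ((X1, B1), (X2, B2))" by (metis prod.collapse)
    have "W = incl_n (X1, X2) + (of_re (0, B1) + cscale \<i> (of_re (0, B2)))"
      by (simp add: W incl_n_def of_re_def cscale_def)
    then show ?thesis using n h by (metis flag_add flag_scale)
  qed
  then show ?thesis by blast
qed

lemma jump_form_G: "jump_form (lie G) Z' (DIM('n) + p)"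
  by unfold_locales (rule bilinear_lie_G, rule lie_G_skew, rule flag_Z')

end

section \<open>The jump sequence of \<gg> over a point of \<open>Lambda_nu\<close>\<close>

locale normalized_at = normalized N \<eta> Z lam \<alpha> e j p r A s \<iota>
  for N :: "'n::euclidean_space monoid" and \<eta> :: "'h::real_normed_vector \<Rightarrow> 'n \<Rightarrow> 'n"
    and Z lam \<alpha> e j p r A s \<iota> +
  fixes f :: "'n \<Rightarrow>\<^sub>L real"
  assumes f: "f \<in> Lambda_nu N Z e j"
begin

sublocale J: jump_form "lie G" Z' "lift_n f" "DIM('n) + p"
  by (rule jump_form_G)

sublocale JN: jump_form "lie N" Z f "DIM('n)"
  by (rule jump_form_N)

lemma f_Lambda: "f \<in> Lambda N Z e j" and e_eq: "e = e_set (lie N) Z f"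
  using f by (auto simp: Lambda_nu_def Lambda_def Omega_def)

lemma D_0_left [simp]: "D 0 X = 0" and D_0_right [simp]: "D B 0 = 0"
  and lie_0_left [simp]: "lie N 0 X = 0" and lie_0_right [simp]: "lie N X 0 = 0"
  using linear_0[OF linear_D_left] linear_0[OF linear_D] bilinear_lzero[OF bilinear_lie]
    bilinear_rzero[OF bilinear_lie] by auto

lemma form_incl: "J.form (incl_n U) (incl_n V) = JN.form U V"
  by (simp only: cbracket_G_incl) (simp add: capply_def incl_n_def)

lemma form_of_re_right:
  "J.form ((Y1, B1), (Y2, B2)) (incl_n (of_re X)) =
     Complex (blinfun_apply f (lie N Y1 X + D B1 X)) (blinfun_apply f (lie N Y2 X + D B2 X))"
  by (simp add: cbracket_def capply_def incl_n_def of_re_def lie_G bilinear_rzero[OF bilinear_lie_G]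
      flip: zero_prod_def)

text \<open>Brackets with \<nn> are killed by f because of \<open>D_eq_0_if_stabilizer\<close>;
  brackets with \<hh> vanish as H is commutative.\<close>

lemma stabilizer_in_radical:
  assumes "B1 \<in> stabilizer_algebra TYPE('n) lam \<alpha> e" "B2 \<in> stabilizer_algebra TYPE('n) lam \<alpha> e"
  shows "((0, B1), (0, B2)) \<in> form_radical (lie G) (lift_n f)"
  unfolding J.form_radical_iff
proof
  fix U :: "('n \<times> 'h) \<times> ('n \<times> 'h)"
  obtain X1 C1 X2 C2 where U: "U = ((X1, C1), (X2, C2))" by (metis prod.collapse)
  show "J.form U ((0, B1), (0, B2)) = 0"
    using D_eq_0_if_stabilizer[OF f_Lambda assms(1)] D_eq_0_if_stabilizer[OF f_Lambda assms(2)]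
    by (simp add: U cbracket_def capply_def lie_G blinfun.diff_right blinfun.add_right blinfun.minus_right
        complex_eq_iff)
qed

text \<open>The radical of f in \<nn> need not be orthogonal to \<hh>. But a pivot with index at
  most n lies in \<nn>, so the equation that it imposes holds on this radical.\<close>

lemma radical_N_subset_q:
  assumes V: "\<And>U. JN.form U V = 0"
    and le: "\<And>i. i < k \<Longrightarrow> J.step i \<Longrightarrow> jump_i (lie G) Z' (lift_n f) (Suc i) \<le> DIM('n)"
  shows "incl_n V \<in> J.q k"
  using le
proof (induction k)
  case (Suc k)
  then have IH: "incl_n V \<in> J.q k" by simp
  show ?case
  proof (cases "J.step k")
    case True
    let ?i = "jump_i (lie G) Z' (lift_n f) (Suc k)"
    obtain U where U: "U \<in> flag Z' ?i" "\<And>V. V \<in> J.q (Suc k) \<longleftrightarrow> V \<in> J.q k \<and> J.form U V = 0"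
      by (rule J.pivot_i[OF True]) blast
    have "?i \<le> DIM('n)" using Suc.prems True by simp
    then obtain U' where "U = incl_n U'" using U(1) flag_full_basis_le by blast
    then show ?thesis using IH U(2) V form_incl by simp
  qed (use IH J.q_stationary in simp)
qed simp

text \<open>If a step had \<open>i\<^sub>k > n\<close>, then \<open>\<qq>\<^sub>k\<^sub>-\<^sub>1\<close> would contain the radical of \<open>f\<close> in \<open>\<nn>\<close> and be
  orthogonal to \<open>\<qq>\<^sub>k\<^sub>-\<^sub>1 \<inter> \<nn>\<close>; the \<open>\<hh>\<close>-components of its elements would then stabilize \<open>f\<close>
  and \<open>\<qq>\<^sub>k\<^sub>-\<^sub>1\<close> would be isotropic.\<close>

lemma jump_i_le:
  assumes "J.step k"
  shows "jump_i (lie G) Z' (lift_n f) (Suc k) \<le> DIM('n)"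
  using assms
proof (induction k rule: less_induct)
  case (less k)
  show ?case
  proof (rule ccontr)
    assume "\<not> ?thesis"
    then have n: "DIM('n) \<le> jump_i (lie G) Z' (lift_n f) (Suc k) - 1" by simp
    have "flag Z' (jump_i (lie G) Z' (lift_n f) (Suc k) - 1) \<inter> J.q k \<subseteq> perp (lie G) (lift_n f) (J.q k)"
      by (rule J.pivot_i[OF less.prems])
    then have low: "flag Z' DIM('n) \<inter> J.q k \<subseteq> perp (lie G) (lift_n f) (J.q k)"
      using flag_mono[OF n, of Z'] by blast
    have incl: "incl_n V \<in> flag Z' DIM('n)" for V
      using flag_full_basis_le[of "DIM('n)" p Z A] flag_n by simp
    \<comment> \<open>The radical of f in \<nn> lies in \<open>q k\<close> and is orthogonal to it.
      Pairing with it leaves only the \<hh>-components, so these satisfy the hypothesis of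
      \<open>stabilizer_if_annihilates\<close>.\<close>
    have stab: "B1 \<in> stabilizer_algebra TYPE('n) lam \<alpha> e \<and> B2 \<in> stabilizer_algebra TYPE('n) lam \<alpha> e" if U: "((Y1, B1), (Y2, B2)) \<in> J.q k" for Y1 Y2 B1 B2
    proof -
      have "blinfun_apply f (D B1 X) = 0 \<and> blinfun_apply f (D B2 X) = 0"
        if X: "\<And>Y. blinfun_apply f (lie N Y X) = 0" for X
      proof -
        have "JN.form U (of_re X) = 0" for U
          using X by (simp add: cbracket_def of_re_def capply_def complex_eq_iff)
        then have "incl_n (of_re X) \<in> J.q k"
          by (rule radical_N_subset_q) (use less.IH J.step_down[OF less.prems] in auto)
        then have "incl_n (of_re X) \<in> perp (lie G) (lift_n f) (J.q k)" using low incl by blast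
        then have "J.form ((Y1, B1), (Y2, B2)) (incl_n (of_re X)) = 0" using U J.perp_iff by blast
        then show ?thesis unfolding form_of_re_right using X
          by (simp add: blinfun.add_right complex_eq_iff)
      qed
      then show ?thesis using stabilizer_if_annihilates[OF f] by blast
    qed
    have "U \<in> perp (lie G) (lift_n f) (J.q k)" if U: "U \<in> J.q k" for U
    proof -
      obtain Y1 B1 Y2 B2 where U': "U = ((Y1, B1), (Y2, B2))" by (metis prod.collapse)
      \<comment> \<open>The \<hh>-part is in the radical; removing it leaves a vector of
        \<open>q k\<close> inside \<nn>, where orthogonality is already known.\<close>
      let ?R = "((0, B1), (0, B2)) :: ('n \<times> 'h) \<times> ('n \<times> 'h)"
      have R: "?R \<in> form_radical (lie G) (lift_n f)"
        using stab U U' by (intro stabilizer_in_radical) auto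
      then have "U - ?R \<in> J.q k" using J.q_diff[OF U] J.form_radical_subset_q by blast
      moreover have "U - ?R \<in> flag Z' DIM('n)"
        using incl[of "(Y1, Y2)"] by (simp add: U' incl_n_def)
      ultimately have "U - ?R \<in> perp (lie G) (lift_n f) (J.q k)" using low by blast
      moreover have "?R \<in> perp (lie G) (lift_n f) (J.q k)" using R J.form_radical_iff J.perp_iff
        by blast
      ultimately have "U - ?R + ?R \<in> perp (lie G) (lift_n f) (J.q k)"
        by (rule cplx.subspace_add[OF J.subspace_perp])
      then show ?thesis by simp
    qed
    then show False using less.prems by (auto simp: J.step_def)
  qed
qed

text \<open>The intersection of \<open>q k\<close> with \<nn> is cut out by the pivots so far, all
  of which lie in \<open>flag Z b\<close>. A functional vanishing on it is a combination of their
  equations, and \<open>W\<close> is the same combination of the pivots.\<close>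

lemma orthogonal_to_q_N:
  assumes "\<And>V. incl_n V \<in> J.q k \<Longrightarrow> JN.form X V = 0"
    and "\<And>i. i < k \<Longrightarrow> J.step i \<Longrightarrow> jump_i (lie G) Z' (lift_n f) (Suc i) \<le> b" "b \<le> DIM('n)"
  shows "\<exists>W\<in>flag Z b. \<forall>V. JN.form (X - W) V = 0"
  using assms
proof (induction k arbitrary: X)
  case 0
  then show ?case by (intro bexI[of _ 0]) (auto simp: flag_zero)
next
  case (Suc k)
  show ?case
  proof (cases "J.step k")
    case False
    then show ?thesis using Suc J.q_stationary by (metis less_SucI)
  next
    case True
    let ?i = "jump_i (lie G) Z' (lift_n f) (Suc k)"
    obtain U where U: "U \<in> flag Z' ?i" "U \<in> J.q k"
        "\<And>V. V \<in> J.q (Suc k) \<longleftrightarrow> V \<in> J.q k \<and> J.form U V = 0"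
      by (rule J.pivot_i[OF True]) blast
    have i: "?i \<le> b" using Suc.prems True by simp
    then have "?i \<le> DIM('n)" using Suc.prems(3) by simp
    then have "U \<in> incl_n ` flag Z ?i" using U(1) flag_full_basis_le[of ?i p Z A] by simp
    then obtain U' where U': "U = incl_n U'" "U' \<in> flag Z ?i" by blast
    have Ub: "U' \<in> flag Z b" using U'(2) flag_mono[OF i] by blast
    have q: "incl_n V \<in> J.q (Suc k) \<longleftrightarrow> incl_n V \<in> J.q k \<and> JN.form U' V = 0" for V
      using U(3)[of "incl_n V"] by (simp add: U'(1) form_incl)
    show ?thesis
    proof (cases "\<forall>V. incl_n V \<in> J.q k \<longrightarrow> JN.form U' V = 0")
      case True
      \<comment> \<open>Here the new equation cuts nothing from the intersection of
        \<open>q k\<close> with \<nn>.\<close>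
      show ?thesis by (rule Suc.IH) (use Suc.prems True q in auto)
    next
      case False
      then obtain V0 where V0: "incl_n V0 \<in> J.q k" "JN.form U' V0 \<noteq> 0" by blast
      \<comment> \<open>\<open>c\<close> makes the difference vanish at \<open>V0\<close>, which
        inside \<nn> spans \<open>q k\<close> modulo \<open>q (Suc k)\<close>.\<close>
      define c where "c = JN.form X V0 / JN.form U' V0"
      have "JN.form (X - cscale c U') V = 0" if V: "incl_n V \<in> J.q k" for V
      proof -
        let ?d = "JN.form U' V / JN.form U' V0"
        have "incl_n (V - cscale ?d V0) =
            (incl_n V - cscale ?d (incl_n V0) :: ('n \<times> 'h) \<times> ('n \<times> 'h))"
          by (simp add: cscale_incl_n) (simp add: incl_n_def)
        then have "incl_n (V - cscale ?d V0) \<in> J.q k"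
          using J.q_diff[OF V J.q_scale[OF V0(1), of ?d]] by (simp only:)
        moreover have "JN.form U' (V - cscale ?d V0) = 0"
          using V0(2) by (simp add: JN.form_diff_right JN.form_cscale_right)
        ultimately have "JN.form X (V - cscale ?d V0) = 0" using Suc.prems(1) q by blast
        then show ?thesis
          using V0(2) by (simp add: JN.form_diff_right JN.form_cscale_right JN.form_diff_left
              JN.form_cscale_left c_def)
      qed
      then obtain W where W: "W \<in> flag Z b" "\<forall>V. JN.form (X - cscale c U' - W) V = 0"
        using Suc.IH[of "X - cscale c U'"] Suc.prems by auto
      have "X - cscale c U' - W = X - (cscale c U' + W)" by simp
      then show ?thesis using W flag_add[OF flag_scale[OF Ub] W(1)] by metis
    qed
  qed
qed

text \<open>When \<open>jump_j\<close> lies beyond n, the pivot is orthogonal to the part of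
  \<open>q k\<close> in \<nn>. Earlier pivots have smaller indices, so
  \<open>orthogonal_to_q_N\<close> corrects it below its leading index to a vector of the radical of
  f in \<nn>.\<close>

lemma jump_i_notin_e:
  assumes k: "J.step k" and j: "DIM('n) < jump_j (lie G) Z' (lift_n f) (Suc k)"
  shows "jump_i (lie G) Z' (lift_n f) (Suc k) \<notin> e"
proof -
  let ?i = "jump_i (lie G) Z' (lift_n f) (Suc k)"
  obtain U where U: "U \<in> flag Z' ?i" "U \<in> J.q k" "U \<notin> flag Z' (?i - 1)"
      "\<And>V. V \<in> J.q (Suc k) \<longleftrightarrow> V \<in> J.q k \<and> J.form U V = 0" "1 \<le> ?i"
    by (rule J.pivot_i[OF k]) blast
  have i: "?i \<le> DIM('n)" by (rule jump_i_le[OF k])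
  then obtain U' where U': "U = incl_n U'" "U' \<in> flag Z ?i" using U(1) flag_full_basis_le by blast
  have "?i - 1 \<le> DIM('n)" using i by simp
  then have U'2: "U' \<notin> flag Z (?i - 1)" using U(3) U'(1) flag_full_basis_le by blast
  have low: "flag Z' (jump_j (lie G) Z' (lift_n f) (Suc k) - 1) \<inter> J.q k \<subseteq> J.q (Suc k)"
    by (rule J.pivot_j[OF k])
  have orth: "JN.form U' V = 0" if "incl_n V \<in> J.q k" for V
  proof -
    have "incl_n V \<in> flag Z' DIM('n)" using flag_full_basis_le[of "DIM('n)" p Z A] flag_n by simp
    moreover have "DIM('n) \<le> jump_j (lie G) Z' (lift_n f) (Suc k) - 1" using j by simp
    ultimately have "incl_n V \<in> flag Z' (jump_j (lie G) Z' (lift_n f) (Suc k) - 1)"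
      using flag_mono by blast
    then have "J.form U (incl_n V) = 0" using low that U(4) by blast
    then show ?thesis by (simp add: U'(1) form_incl)
  qed
  have less: "jump_i (lie G) Z' (lift_n f) (Suc i') \<le> ?i - 1" if "i' < k" "J.step i'" for i'
    using J.jump_i_less[OF k that(1)] by simp
  obtain W where W: "W \<in> flag Z (?i - 1)" "\<forall>V. JN.form (U' - W) V = 0"
    using orthogonal_to_q_N[OF orth less \<open>?i - 1 \<le> DIM('n)\<close>] by blast
  obtain c where c: "c \<noteq> 0" "U' - cscale c (Z ?i) \<in> flag Z (?i - 1)"
    using flag_leadingE[OF U'(2) U'2 U(5)] by blast
  have "cscale (1 / c) (U' - W) \<in> form_radical (lie N) f"
    using W(2) JN.form_skew[of _ "U' - W"] by (simp add: JN.form_radical_iff JN.form_cscale_right)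
  moreover have "cscale (1 / c) ((U' - cscale c (Z ?i)) - W) \<in> flag Z (?i - 1)"
    by (intro flag_scale flag_diff c(2) W(1))
  then have "cscale (1 / c) (U' - W) - Z ?i \<in> flag Z (?i - 1)"
    using c(1) by (simp add: cplx.scale_right_diff_distrib algebra_simps)
  ultimately have "has_lead Z ?i (form_radical (lie N) f)" by (auto simp: has_lead_def)
  then show ?thesis using JN.no_lead_if_in_e_set e_eq by blast
qed

lemma lift_n_f: "lift_n f \<in> Omega_nu N Z e j"
  by (rule Omega_nu_if_Lambda_nu) (simp add: f)

lemma i_set_diff: "i_set (lie G) Z' (lift_n f) - e = \<iota> ` {1..r}"
  and s_step: "t \<in> {1..r} \<Longrightarrow> s t \<in> jump_steps (lie G) Z' (lift_n f)"
  and jump_i_s: "t \<in> {1..r} \<Longrightarrow> jump_i (lie G) Z' (lift_n f) (s t) = \<iota> t"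
  and jump_j_s: "t \<in> {1..r} \<Longrightarrow> Z' (jump_j (lie G) Z' (lift_n f) (s t)) = of_re (0, A t)"
  using normalized lift_n_f unfolding normalized_basis_def Let_def by blast+

lemma iota_in_nu: "t \<in> {1..r} \<Longrightarrow> \<iota> t \<in> {1..DIM('n)} - e"
proof -
  assume "t \<in> {1..r}"
  then have i: "\<iota> t \<in> i_set (lie G) Z' (lift_n f)" "\<iota> t \<notin> e" using i_set_diff
    by blast+
  then obtain k where k: "J.step k" "\<iota> t = jump_i (lie G) Z' (lift_n f) (Suc k)"
    using J.i_set_iff by blast
  have "1 \<le> jump_i (lie G) Z' (lift_n f) (Suc k)" by (rule J.pivot_i[OF k(1)])
  then show ?thesis using i(2) k(2) jump_i_le[OF k(1)] by simp
qed

lemma A_in_sum: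
  assumes q: "q \<in> {1..p}"
  shows "\<exists>K\<in> stabilizer_algebra TYPE('n) lam \<alpha> e. \<exists>B\<in>span (A ` {1..r}). A q = K + B"
  using assms
proof (induction "p - q" arbitrary: q rule: less_induct)
  case less
  let ?T = "{K + B | K B. K \<in> stabilizer_algebra TYPE('n) lam \<alpha> e \<and> B \<in> span (A ` {1..r})}"
  have T: "subspace ?T" by (rule subspace_sums[OF subspace_stabilizer subspace_span])
  have stT: "stabilizer_algebra TYPE('n) lam \<alpha> e \<subseteq> ?T"
  proof (rule subsetI, rule CollectI)
    fix K assume "K \<in> stabilizer_algebra TYPE('n) lam \<alpha> e"
    then show "\<exists>K' B. K = K' + B \<and> K' \<in> stabilizer_algebra TYPE('n) lam \<alpha> e \<and> B \<in> span (A ` {1..r})"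
      by (intro exI[of _ K] exI[of _ 0]) (simp add: span_zero)
  qed
  have spT: "span (A ` {1..r}) \<subseteq> ?T"
    using subspace_0[OF subspace_stabilizer] by force
  let ?m = "DIM('n) + p + 1 - q"
  have m: "1 \<le> ?m" "?m \<le> DIM('n) + p" "DIM('n) < ?m" using less.prems by auto
  have Zm: "Z' ?m = of_re (0, A q)" using less.prems by (auto simp: full_basis_def)
  have "A q \<in> ?T"
  proof (cases "?m \<in> e_set (lie G) Z' (lift_n f)")
    case True
    then obtain k where k: "J.step k"
        "?m = jump_i (lie G) Z' (lift_n f) (Suc k) \<or> ?m = jump_j (lie G) Z' (lift_n f) (Suc k)"
      using J.e_set_iff by blast
    then have mj: "?m = jump_j (lie G) Z' (lift_n f) (Suc k)" using jump_i_le[OF k(1)] m(3) by auto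
    then have "jump_i (lie G) Z' (lift_n f) (Suc k) \<notin> e" using jump_i_notin_e[OF k(1)] m(3)
      by simp
    moreover have "jump_i (lie G) Z' (lift_n f) (Suc k) \<in> i_set (lie G) Z' (lift_n f)"
      using k(1) J.i_set_iff by blast
    ultimately obtain t where t: "t \<in> {1..r}" "jump_i (lie G) Z' (lift_n f) (Suc k) = \<iota> t"
      using i_set_diff by blast
    obtain k' where k': "s t = Suc k'" "J.step k'" using s_step[OF t(1)] J.jump_steps_iff by blast
    have "k' = k"
      using jump_i_s[OF t(1)] t(2) k' k(1) J.jump_i_less by (metis less_irrefl linorder_neqE_nat)
    then have "of_re (0, A t) = of_re (0 :: 'n, A q)" using jump_j_s[OF t(1)] k'(1) mj Zm by metis
    then have "A q = A t" by (simp add: of_re_def)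
    then have "A q \<in> span (A ` {1..r})" using t(1) by (simp add: span_base)
    then show ?thesis using spT by blast
  next
    case False
    then have "has_lead Z' ?m (form_radical (lie G) (lift_n f))"
      using J.has_lead_if_notin_e_set m by blast
    then obtain W where W: "W \<in> form_radical (lie G) (lift_n f)" "W - Z' ?m \<in> flag Z' (?m - 1)"
      by (auto simp: has_lead_def)
    obtain Y B Y2 B2 where WB: "W = ((Y, B), (Y2, B2))" by (metis prod.collapse)
    \<comment> \<open>Below position \<open>?m\<close> only \<open>A (q + 1)\<close>, ...,
      \<open>A p\<close> occur, and these are covered by the induction hypothesis.\<close>
    have "snd (fst (W - Z' ?m)) \<in> span (A ` {DIM('n) + p + 1 - (?m - 1)..p})"
      using m W(2) by (intro linear_snd_flag) auto
    moreover have "snd (fst (W - Z' ?m)) = B - A q" by (simp only: WB Zm) (simp add: of_re_def)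
    moreover have "DIM('n) + p + 1 - (?m - 1) = q + 1" using less.prems by simp
    ultimately have "B - A q \<in> span (A ` {q + 1..p})" by simp
    moreover have "A ` {q + 1..p} \<subseteq> ?T"
    proof (rule image_subsetI)
      fix t assume "t \<in> {q + 1..p}"
      then have "p - t < p - q" "t \<in> {1..p}" by auto
      from less.hyps[OF this] show "A t \<in> ?T" by blast
    qed
    ultimately have 1: "B - A q \<in> ?T" using span_minimal[OF _ T] by blast
    \<comment> \<open>Orthogonality of \<open>W\<close> to \<nn> says that \<open>B\<close> acts on
      f as \<open>- Y\<close> does, so \<open>B\<close> is a tangent direction.\<close>
    have "blinfun_apply f (D B X) = blinfun_apply f (lie N (- Y) X)" for X
    proof -
      have "J.form (incl_n (of_re X)) W = 0" using W(1) J.form_radical_iff by blast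
      then have "J.form W (incl_n (of_re X)) = 0" using J.form_skew[of W] by simp
      then show ?thesis
        unfolding WB form_of_re_right
        by (simp add: complex_eq_iff blinfun.add_right bilinear_lneg[OF bilinear_lie] blinfun.minus_right
            add_eq_0_iff)
    qed
    then have "B \<in> stabilizer_algebra TYPE('n) lam \<alpha> e" using stabilizer_if_tangent[OF f]
      by blast
    then have "B - (B - A q) \<in> ?T" using 1 stT subspace_diff[OF T] by blast
    then show ?thesis by simp
  qed
  then show ?case by blast
qed

lemma h_eq_sum: "\<exists>K\<in> stabilizer_algebra TYPE('n) lam \<alpha> e. \<exists>B\<in>span (A ` {1..r}). C = K + B"
proof -
  let ?T = "{K + B | K B. K \<in> stabilizer_algebra TYPE('n) lam \<alpha> e \<and> B \<in> span (A ` {1..r})}"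
  have "subspace ?T" by (rule subspace_sums[OF subspace_stabilizer subspace_span])
  moreover have "A ` {1..p} \<subseteq> ?T" using A_in_sum by blast
  ultimately have "span (A ` {1..p}) \<subseteq> ?T" by (rule span_minimal[rotated])
  then have "C \<in> ?T" using basis_of_h by (auto simp: basis_of_h_def)
  then show ?thesis by blast
qed

lemma lam_iota:
  assumes "t \<in> {1..r}" "t' \<in> {1..r}"
  shows "lam (\<iota> t) (A t') = (if t = t' then 1 else 0)"
proof -
  have "(\<forall>t\<in>{1..r}. Re (weight lam \<alpha> (\<iota> t) (A t)) = 1) \<and>
      (\<forall>t\<in>{1..r}. \<forall>t'\<in>{1..r}. t \<noteq> t' \<longrightarrow> weight lam \<alpha> (\<iota> t) (A t') = 0)"
    using normalized unfolding normalized_basis_def Let_def by blast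
  then show ?thesis using assms by (auto simp: Re_weight weight_eq_0_iff)
qed

lemma linear_lam_iota: "t \<in> {1..r} \<Longrightarrow> linear (lam (\<iota> t))"
  using iota_in_nu linear_lam by blast

lemma lam_iota_stab: "t \<in> {1..r} \<Longrightarrow> B \<in> stabilizer_algebra TYPE('n) lam \<alpha> e \<Longrightarrow> lam (\<iota> t) B = 0"
  using iota_in_nu by (simp add: mem_stabilizer_iff)

lemma lam_iota_sum:
  assumes "t \<in> {1..r}"
  shows "lam (\<iota> t) (\<Sum>t'\<in>{1..r}. c t' *\<^sub>R A t') = c t"
proof -
  have "lam (\<iota> t) (\<Sum>t'\<in>{1..r}. c t' *\<^sub>R A t') = (\<Sum>t'\<in>{1..r}. c t' * lam (\<iota> t) (A t'))"
    using linear_lam_iota[OF assms] by (simp add: linear_sum linear_scale)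
  also have "\<dots> = (\<Sum>t'\<in>{1..r}. if t = t' then c t' else 0)"
    using assms by (intro sum.cong) (simp_all add: lam_iota)
  finally show ?thesis using assms by simp
qed

text \<open>The functionals \<open>lam (\<iota> t)\<close> are dual to \<open>A 1\<close>, ...,
  \<open>A r\<close>, so the right side is a linear map fixing these vectors.\<close>

lemma span_A_expand:
  assumes "B \<in> span (A ` {1..r})"
  shows "B = (\<Sum>t\<in>{1..r}. lam (\<iota> t) B *\<^sub>R A t)"
proof -
  define g where "g B = (\<Sum>t\<in>{1..r}. lam (\<iota> t) B *\<^sub>R A t)" for B
  have "linear g"
  proof (rule linearI)
    show "g (x + y) = g x + g y" for x y
      unfolding g_def sum.distrib[symmetric]
      by (rule sum.cong) (simp_all add: linear_add[OF linear_lam_iota] scaleR_add_left)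
    show "g (c *\<^sub>R x) = c *\<^sub>R g x" for c x
      unfolding g_def scaleR_sum_right
      by (rule sum.cong) (simp_all add: linear_scale[OF linear_lam_iota])
  qed
  then have "subspace {B. g B = B}"
    by (intro subspaceI) (simp_all add: linear_0 linear_add linear_scale)
  moreover have "A ` {1..r} \<subseteq> {B. g B = B}"
  proof (rule image_subsetI, rule CollectI)
    fix t assume "t \<in> {1..r}"
    then have "(\<Sum>t'\<in>{1..r}. lam (\<iota> t') (A t) *\<^sub>R A t') = (\<Sum>t'\<in>{1..r}. if t' = t then A t' else 0)"
      by (intro sum.cong) (simp_all add: lam_iota)
    then show "g (A t) = A t" using \<open>t \<in> {1..r}\<close> by (simp add: g_def)
  qed
  ultimately have "span (A ` {1..r}) \<subseteq> {B. g B = B}" by (rule span_minimal[rotated])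
  then show ?thesis using assms by (auto simp: g_def)
qed

text \<open>If no radical vector separated \<open>A t\<close> from the others, duality would write
  f(D (A t) .) as f([Y, .]) + f(D B .) with \<open>B\<close> in the span of the others. Then
  \<open>A t - B\<close> would be tangent, hence in \<kk>, although \<open>lam (\<iota> t)\<close>
  is 1 on it. So a dual family exists in the radical, and it interpolates any
  \<open>b\<close>.\<close>

lemma radical_onto_dual:
  obtains X where "\<And>Y. blinfun_apply f (lie N Y X) = 0"
    "\<And>t. t \<in> {1..r} \<Longrightarrow> blinfun_apply f (D (A t) X) = b t"
proof -
  define R where "R = {X. \<forall>Y. blinfun_apply f (lie N Y X) = 0}"
  have R: "subspace R"
    by (rule subspaceI) (auto simp: R_def linear_add[OF linear_lie] linear_scale[OF linear_lie]
        blinfun.add_right blinfun.scaleR_right)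
  have "\<exists>X\<in>R. blinfun_apply f (D (A t) X) = 1 \<and> (\<forall>t'\<in>{1..r} - {t}. blinfun_apply f (D (A t') X) = 0)"
    if t: "t \<in> {1..r}" for t
  proof (rule ccontr)
    assume no: "\<not> ?thesis"
    \<comment> \<open>The factor \<open>UNIV\<close> puts all functionals f([Y, .]) into the family,
      which forces the common kernel into the radical.\<close>
    let ?S = "UNIV \<times> span (A ` ({1..r} - {t}))"
    let ?F = "\<lambda>v X. blinfun_apply f (lie N (fst v) X) + blinfun_apply f (D (snd v) X)"
    have "\<exists>v\<in>?S. \<forall>X. blinfun_apply f (D (A t) X) = ?F v X"
    proof (rule functional_in_family)
      show "subspace ?S" by (intro subspace_Times subspace_UNIV subspace_span)
      show "linear (?F v)" for v by (intro linear_compose_add linear_form_right linear_form_D)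
      show "linear (\<lambda>v. ?F v X)" for X
        using linear_compose[OF linear_fst linear_form_left] linear_compose[OF linear_snd linear_form_D_left]
        by (intro linear_compose_add) (auto simp: o_def)
      show "linear (\<lambda>X. blinfun_apply f (D (A t) X))" by (rule linear_form_D)
      fix X assume X: "\<And>v. v \<in> ?S \<Longrightarrow> ?F v X = 0"
      have XR: "X \<in> R" unfolding R_def using X[of "(_, 0)"] by (auto simp: span_zero)
      have X0: "blinfun_apply f (D (A t') X) = 0" if "t' \<in> {1..r} - {t}" for t'
      proof -
        have "A t' \<in> span (A ` ({1..r} - {t}))" using that by (intro span_base imageI)
        then show ?thesis using X[of "(0, A t')"] by simp
      qed
      show "blinfun_apply f (D (A t) X) = 0"
      proof (rule ccontr)
        assume d: "blinfun_apply f (D (A t) X) \<noteq> 0"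
        let ?X = "(1 / blinfun_apply f (D (A t) X)) *\<^sub>R X"
        have "?X \<in> R" using XR R subspace_scale by blast
        moreover have "blinfun_apply f (D (A t) ?X) = 1"
          using d by (simp add: linear_scale[OF linear_D] blinfun.scaleR_right)
        moreover have "\<forall>t'\<in>{1..r} - {t}. blinfun_apply f (D (A t') ?X) = 0"
          using X0 by (simp add: linear_scale[OF linear_D] blinfun.scaleR_right)
        ultimately show False using no by blast
      qed
    qed
    then obtain Y B where YB: "B \<in> span (A ` ({1..r} - {t}))"
        "\<And>X. blinfun_apply f (D (A t) X) = blinfun_apply f (lie N Y X) + blinfun_apply f (D B X)"
      by auto
    have "blinfun_apply f (D (A t - B) X) = blinfun_apply f (lie N Y X)" for X
      using YB(2)[of X] by (simp add: linear_diff[OF linear_D_left] blinfun.diff_right)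
    then have "A t - B \<in> stabilizer_algebra TYPE('n) lam \<alpha> e"
      using stabilizer_if_tangent[OF f] by blast
    then have "lam (\<iota> t) (A t) - lam (\<iota> t) B = 0"
      using lam_iota_stab[OF t] linear_diff[OF linear_lam_iota[OF t]] by metis
    moreover have "lam (\<iota> t) B = 0"
    proof -
      have "subspace {B. lam (\<iota> t) B = 0}"
        by (rule subspaceI) (auto simp: linear_0 linear_add linear_scale linear_lam_iota[OF t])
      moreover have "A ` ({1..r} - {t}) \<subseteq> {B. lam (\<iota> t) B = 0}" using t
        by (auto simp: lam_iota)
      ultimately show ?thesis using YB(1) span_minimal by blast
    qed
    ultimately show False using lam_iota[OF t t] by simp
  qed
  then obtain x where x: "\<And>t. t \<in> {1..r} \<Longrightarrow> x t \<in> R"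
      "\<And>t. t \<in> {1..r} \<Longrightarrow> blinfun_apply f (D (A t) (x t)) = 1"
      "\<And>t t'. t \<in> {1..r} \<Longrightarrow> t' \<in> {1..r} - {t} \<Longrightarrow> blinfun_apply f (D (A t') (x t)) = 0"
    by metis
  define X where "X = (\<Sum>t\<in>{1..r}. b t *\<^sub>R x t)"
  have "X \<in> R" unfolding X_def using x(1) R by (intro subspace_sum subspace_scale) auto
  moreover have "blinfun_apply f (D (A t) X) = b t" if t: "t \<in> {1..r}" for t
  proof -
    have "blinfun_apply f (D (A t) X) = (\<Sum>t'\<in>{1..r}. b t' * blinfun_apply f (D (A t) (x t')))"
      by (simp add: X_def linear_sum[OF linear_form_D] linear_scale[OF linear_form_D])
    also have "\<dots> = (\<Sum>t'\<in>{1..r}. if t' = t then b t' else 0)"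
      using t x(2,3) by (intro sum.cong) auto
    finally show ?thesis using t by simp
  qed
  ultimately show ?thesis using that by (auto simp: R_def)
qed

end

context normalized
begin

section \<open>The coadjoint action of \<open>G\<close>\<close>

lemma coad_G_apply: "blinfun_apply (coad G g l) V = blinfun_apply l (Ad G (inv\<^bsub>G\<^esub> g) V)"
proof -
  have "bounded_linear (\<lambda>V. blinfun_apply l (Ad G (inv\<^bsub>G\<^esub> g) V))"
    by (intro bounded_linear_compose[OF blinfun.bounded_linear_right] bounded_linear_Ad_G)
  then show ?thesis by (simp add: coad_def bounded_linear_Blinfun_apply)
qed

lemma coad_G_mult: "coad G (g \<otimes>\<^bsub>G\<^esub> h) l = coad G g (coad G h l)"
  by (rule blinfun_eqI) (simp add: coad_G_apply G.inv_mult_group Ad_G_mult)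

lemma coad_orbit_G: "coad_orbit G l = range (\<lambda>g. coad G g l)"
  by (simp add: coad_orbit_def)

lemma restrict_coad_n: "restrict_n (coad G (X, 0) l) = coad N X (restrict_n l)"
  by (rule blinfun_eqI) (simp add: coad_G_apply coad_N_apply Ad_G_n)

lemma restrict_coad_h: "restrict_n (coad G (0, B) l) = hact B (restrict_n l)"
  by (rule blinfun_eqI) (simp add: coad_G_apply hact_apply Ad_G_n)

lemma coad_h_h: "blinfun_apply (coad G (0, B) l) (0, C) = blinfun_apply l (0, C)"
  by (simp add: coad_G_apply Ad_G_h)

lemma coad_n_h:
  assumes "\<And>Y. blinfun_apply (restrict_n l) (lie N X Y) = 0"
  shows "blinfun_apply (coad G (X, 0) l) (0, C) =
    blinfun_apply (restrict_n l) (D C X) + blinfun_apply l (0, C)"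
proof -
  have neg: "blinfun_apply (restrict_n l) (lie N (- X) Y) = 0" for Y
    using assms[of Y] by (simp add: bilinear_lneg[OF bilinear_lie] blinfun.minus_right del: restrict_n_apply)
  have "Ad G (- X, 0) (0, C) = (fst (Ad G (- X, 0) (0, C)), 0) + (0, C)"
    using Ad_G_n_h[of "- X" C] by simp
  then have "blinfun_apply l (Ad G (- X, 0) (0, C)) =
      blinfun_apply l ((fst (Ad G (- X, 0) (0, C)), 0) + (0, C))" by metis
  also have "\<dots> = blinfun_apply (restrict_n l) (fst (Ad G (- X, 0) (0, C))) + blinfun_apply l (0, C)"
    by (simp add: blinfun.add_right[symmetric])
  also have "blinfun_apply (restrict_n l) (fst (Ad G (- X, 0) (0, C))) = blinfun_apply (restrict_n l) (D C X)"
    using Ad_G_stabilizer[of "restrict_n l" "- X" C] neg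
    by (simp add: linear_neg[OF linear_D] blinfun.minus_right del: restrict_n_apply)
  finally show ?thesis by (simp add: coad_G_apply)
qed

lemma coad_N_stabilizer:
  assumes "\<And>Y. blinfun_apply f (lie N X Y) = 0"
  shows "coad N X f = f"
proof (rule blinfun_eqI)
  show "blinfun_apply (coad N X f) Y = blinfun_apply f Y" for Y
    using inn_ray_stabilizer[of f X "- 1" Y] assms by (simp add: coad_N_apply)
qed

lemma stabilizer_coad_N:
  assumes "coad N X f = f"
  shows "blinfun_apply f (lie N X Y) = 0"
proof -
  have "capply f (ad (- X) (of_re Y)) = 0"
  proof (rule inn_fixes_imp_ad_kills[where i="DIM('n)"])
    show "capply f (cmap (inn (- X)) V) = capply f V" for V using assms capply_coad_N by metis
  qed (use flag_n in auto)
  then show ?thesis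
    by (simp add: capply_of_re[OF linear_lie] bilinear_lneg[OF bilinear_lie] blinfun.minus_right)
qed

section \<open>The cross-section for \<open>G\<close>\<close>

lemma normalized_atI: "f \<in> Lambda_nu N Z e j \<Longrightarrow> normalized_at N \<eta> Z lam \<alpha> e j p r A s \<iota> f"
  by unfold_locales

abbreviation "\<Sigma> \<equiv> Sigma_G N Z lam \<alpha> e j A r \<iota>"
abbreviation "\<Sigma>0 \<equiv> Sigma_circ N Z e j r \<iota>"

text \<open>The \<kk>-coordinate is unconstrained: \<open>\<kappa>\<close> may be taken as the
  restriction of l to \<hh>. Membership in \<open>Omega_nu\<close> follows since a point of
  \<open>Lambda\<close> is its own representative.\<close>

lemma Sigma_G_iff:
  "l \<in> \<Sigma> \<longleftrightarrow> restrict_n l \<in> \<Sigma>0 \<and> (\<forall>B\<in>span (A ` {1..r}). blinfun_apply l (0, B) = 0)"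
proof
  assume "l \<in> \<Sigma>"
  then obtain f \<kappa> where f: "f \<in> \<Sigma>0" and
    dual: "dual_coordinates (stabilizer_algebra TYPE('n) lam \<alpha> e) (span (A ` {1..r})) l f \<kappa> 0"
    by (auto simp: Sigma_G_def)
  have eq: "blinfun_apply l (X, B) = blinfun_apply f X" if "B \<in> span (A ` {1..r})" for X B
  proof -
    have "blinfun_apply l (X, 0 + B) = blinfun_apply f X + blinfun_apply \<kappa> 0 + blinfun_apply 0 B"
      using dual subspace_0[OF subspace_stabilizer] that unfolding dual_coordinates_def by blast
    then show ?thesis by (simp add: blinfun.zero_right)
  qed
  have "restrict_n l = f" by (rule blinfun_eqI) (simp add: eq[OF span_zero])
  then show "restrict_n l \<in> \<Sigma>0 \<and> (\<forall>B\<in>span (A ` {1..r}). blinfun_apply l (0, B) = 0)"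
    using f eq by (simp add: blinfun.zero_right)
next
  assume l: "restrict_n l \<in> \<Sigma>0 \<and> (\<forall>B\<in>span (A ` {1..r}). blinfun_apply l (0, B) = 0)"
  define \<kappa> where "\<kappa> = Blinfun (\<lambda>B. blinfun_apply l (0, B))"
  have "bounded_linear (\<lambda>B. blinfun_apply l (0, B))"
    by (intro bounded_linear_compose[OF blinfun.bounded_linear_right] bounded_linear_Pair
        bounded_linear_ident bounded_linear_zero)
  then have \<kappa>: "blinfun_apply \<kappa> B = blinfun_apply l (0, B)" for B
    by (simp add: \<kappa>_def bounded_linear_Blinfun_apply)
  have "blinfun_apply l (X, K + B) = blinfun_apply (restrict_n l) X + blinfun_apply \<kappa> K + blinfun_apply 0 B"
    if "B \<in> span (A ` {1..r})" for X K B
  proof -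
    have "blinfun_apply l (X, K + B) = blinfun_apply l ((X, 0) + (0, K) + (0, B))" by simp
    also have "\<dots> = blinfun_apply l (X, 0) + blinfun_apply l (0, K) + blinfun_apply l (0, B)"
      by (simp only: blinfun.add_right)
    finally show ?thesis using l that by (simp add: \<kappa>)
  qed
  then have "dual_coordinates (stabilizer_algebra TYPE('n) lam \<alpha> e) (span (A ` {1..r})) l (restrict_n l) \<kappa> 0"
    unfolding dual_coordinates_def by blast
  moreover have "l \<in> Omega_nu N Z e j"
    using l by (intro Omega_nu_if_Lambda_nu) (simp add: Sigma_circ_def)
  ultimately show "l \<in> \<Sigma>" using l unfolding Sigma_G_def by blast
qed

lemma restrict_Sigma: "restrict_n ` \<Sigma> = \<Sigma>0"
proof
  show "restrict_n ` \<Sigma> \<subseteq> \<Sigma>0" using Sigma_G_iff by blast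
  show "\<Sigma>0 \<subseteq> restrict_n ` \<Sigma>"
  proof
    fix f assume "f \<in> \<Sigma>0"
    then have "lift_n f \<in> \<Sigma>" by (simp add: Sigma_G_iff blinfun.zero_right)
    then show "f \<in> restrict_n ` \<Sigma>" by (metis imageI restrict_n_lift_n)
  qed
qed

lemma Sigma_meets_orbit:
  assumes l: "l \<in> Omega_nu N Z e j"
  shows "\<exists>\<sigma>. \<sigma> \<in> \<Sigma> \<and> \<sigma> \<in> coad_orbit G l"
proof -
  have "restrict_n l \<in> Omega N Z e j" using l by (simp add: Omega_nu_def)
  then obtain g where g: "coad N g (restrict_n l) \<in> Lambda N Z e j" using Lambda_exists by blast
  define f1 where "f1 = coad N g (restrict_n l)"
  have f1: "f1 \<in> Lambda_nu N Z e j"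
    using l to_Lambda_eq[OF g] by (simp add: Omega_nu_def f1_def)
  interpret L1: normalized_at N \<eta> Z lam \<alpha> e j p r A s \<iota> f1
    by (rule normalized_atI[OF f1])
  \<comment> \<open>\<open>hact B\<close> multiplies the modulus at \<open>\<iota> t\<close> by
    exp(- \<open>lam (\<iota> t) B\<close>), so the logarithm of the modulus is the value to
    prescribe.\<close>
  define B where "B = (\<Sum>t\<in>{1..r}. ln (cmod (capply f1 (Z (\<iota> t)))) *\<^sub>R A t)"
  define f2 where "f2 = hact B f1"
  have f2: "f2 \<in> Lambda_nu N Z e j" unfolding f2_def by (rule Lambda_nu_hact[OF f1])
  have "cmod (capply f2 (Z (\<iota> t))) = 1" if t: "t \<in> {1..r}" for t
  proof -
    have i: "\<iota> t \<in> {1..DIM('n)} - e" by (rule L1.iota_in_nu[OF t])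
    then have "cmod (capply f1 (Z (\<iota> t))) > 0" using f1 by (simp add: Lambda_nu_def nu_def)
    moreover have "lam (\<iota> t) B = ln (cmod (capply f1 (Z (\<iota> t))))"
      unfolding B_def by (rule L1.lam_iota_sum[OF t])
    ultimately show ?thesis using i by (simp add: f2_def cmod_hact_Z exp_minus)
  qed
  then have f2S: "f2 \<in> \<Sigma>0" using f2 by (auto simp: Sigma_circ_def)
  interpret L2: normalized_at N \<eta> Z lam \<alpha> e j p r A s \<iota> f2
    by (rule normalized_atI[OF f2])
  define l2 where "l2 = coad G (0, B) (coad G (g, 0) l)"
  have l2: "restrict_n l2 = f2"
    by (simp add: l2_def restrict_coad_h restrict_coad_n f2_def f1_def)
  \<comment> \<open>A radical vector fixes \<open>f2\<close> and adds f2(D C X) to the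
    \<hh>-components; the values prescribed here cancel \<open>l2\<close> on \<aa>.\<close>
  obtain X where X: "\<And>Y. blinfun_apply f2 (lie N Y X) = 0"
      "\<And>t. t \<in> {1..r} \<Longrightarrow> blinfun_apply f2 (D (A t) X) = - blinfun_apply l2 (0, A t)"
    using L2.radical_onto_dual[of "\<lambda>t. - blinfun_apply l2 (0, A t)"] by metis
  have X': "blinfun_apply f2 (lie N X Y) = 0" for Y
    using X(1)[of Y] lie_skew[of X Y] by (simp add: blinfun.minus_right)
  define l3 where "l3 = coad G (X, 0) l2"
  have r3: "restrict_n l3 = f2" by (simp only: l3_def restrict_coad_n l2 coad_N_stabilizer[OF X'])
  have h3: "blinfun_apply l3 (0, C) = blinfun_apply f2 (D C X) + blinfun_apply l2 (0, C)" for C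
    unfolding l3_def using coad_n_h[of l2 X C] X' l2 by simp
  have "subspace {C. blinfun_apply l3 (0, C) = 0}"
  proof (rule subspaceI; safe)
    show "blinfun_apply l3 (0, 0) = 0" by (simp add: blinfun.zero_right flip: zero_prod_def)
    show "blinfun_apply l3 (0, x + y) = 0"
      if "blinfun_apply l3 (0, x) = 0" "blinfun_apply l3 (0, y) = 0" for x y
      using that blinfun.add_right[of l3 "(0, x)" "(0, y)"] by simp
    show "blinfun_apply l3 (0, c *\<^sub>R x) = 0" if "blinfun_apply l3 (0, x) = 0" for c x
      using that blinfun.scaleR_right[of l3 c "(0, x)"] by simp
  qed
  moreover have "A ` {1..r} \<subseteq> {C. blinfun_apply l3 (0, C) = 0}"
    by (rule image_subsetI, rule CollectI) (simp add: h3 X(2))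
  ultimately have "span (A ` {1..r}) \<subseteq> {C. blinfun_apply l3 (0, C) = 0}"
    by (rule span_minimal[rotated])
  then have "l3 \<in> \<Sigma>" using r3 f2S by (auto simp: Sigma_G_iff)
  moreover have "l3 \<in> coad_orbit G l"
    unfolding coad_orbit_G l3_def l2_def coad_G_mult[symmetric] by blast
  ultimately show ?thesis by blast
qed

lemma Sigma_unique:
  assumes \<sigma>: "\<sigma> \<in> \<Sigma>" and \<sigma>': "coad G (X, C) \<sigma> \<in> \<Sigma>"
  shows "coad G (X, C) \<sigma> = \<sigma>"
proof -
  define \<sigma>1 where "\<sigma>1 = coad G (0, C) \<sigma>"
  have split: "coad G (X, C) \<sigma> = coad G (X, 0) \<sigma>1"
    using coad_G_mult[of "(X, 0)" "(0, C)" \<sigma>] by (simp add: \<sigma>1_def)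
  define f where "f = restrict_n \<sigma>"
  have f: "f \<in> \<Sigma>0" "f \<in> Lambda_nu N Z e j" "f \<in> Lambda N Z e j"
    using \<sigma> by (auto simp: Sigma_G_iff Sigma_circ_def Lambda_nu_def f_def)
  interpret L: normalized_at N \<eta> Z lam \<alpha> e j p r A s \<iota> f
    by (rule normalized_atI[OF f(2)])
  have r': "restrict_n (coad G (X, C) \<sigma>) = coad N X (hact C f)"
    by (simp add: split \<sigma>1_def restrict_coad_n restrict_coad_h f_def)
  have f': "coad N X (hact C f) \<in> \<Sigma>0" using \<sigma>' r' by (metis Sigma_G_iff)
  then have "coad N X (hact C f) \<in> Lambda N Z e j" by (simp add: Sigma_circ_def Lambda_nu_def)
  \<comment> \<open>The H-part alone already leads into \<open>Lambda\<close>, so the N-part must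
    fix the point reached.\<close>
  then have fixed: "coad N X (hact C f) = hact C f"
    using Lambda_unique[OF Lambda_hact[OF f(3)]] by blast
  \<comment> \<open>The moduli are 1 before and after, so the factor exp(-
    \<open>lam (\<iota> t) C\<close>) is 1.\<close>
  have lam0: "lam (\<iota> t) C = 0" if t: "t \<in> {1..r}" for t
  proof -
    have "cmod (capply (hact C f) (Z (\<iota> t))) = 1" "cmod (capply f (Z (\<iota> t))) = 1"
      using f' f(1) t by (auto simp: fixed Sigma_circ_def)
    then show ?thesis using L.iota_in_nu[OF t] by (simp add: cmod_hact_Z)
  qed
  obtain K B where KB: "K \<in> stabilizer_algebra TYPE('n) lam \<alpha> e" "B \<in> span (A ` {1..r})" "C = K + B"
    using L.h_eq_sum by blast
  have "lam (\<iota> t) B = 0" if t: "t \<in> {1..r}" for t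
    using lam0[OF t] L.lam_iota_stab[OF t KB(1)] linear_add[OF L.linear_lam_iota[OF t]] KB(3) by simp
  then have "B = 0" using L.span_A_expand[OF KB(2)] by simp
  then have C: "C \<in> stabilizer_algebra TYPE('n) lam \<alpha> e" using KB by simp
  have hC: "hact C f = f" by (rule hact_stabilizer[OF f(3) C])
  have r1: "restrict_n \<sigma>1 = f" by (simp add: \<sigma>1_def restrict_coad_h hC flip: f_def)
  have stab: "blinfun_apply f (lie N X Y) = 0" for Y
    by (rule stabilizer_coad_N) (use fixed hC in simp)
  have h: "blinfun_apply (coad G (X, C) \<sigma>) (0, E) = blinfun_apply f (D E X) + blinfun_apply \<sigma> (0, E)" for E
    using coad_n_h[of \<sigma>1 X E] stab r1 by (simp add: split) (simp add: \<sigma>1_def coad_h_h)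
  \<comment> \<open>On \<kk> the shift f(D E X) vanishes because \<kk> stabilizes f; on \<aa> both
    functionals are 0 by membership in \<open>\<Sigma>\<close>.\<close>
  have hE: "blinfun_apply (coad G (X, C) \<sigma>) (0, E) = blinfun_apply \<sigma> (0, E)" for E
  proof -
    obtain K B where KB: "K \<in> stabilizer_algebra TYPE('n) lam \<alpha> e" "B \<in> span (A ` {1..r})" "E = K + B"
      using L.h_eq_sum by blast
    have "blinfun_apply (coad G (X, C) \<sigma>) (0, K) = blinfun_apply \<sigma> (0, K)"
      using h[of K] D_eq_0_if_stabilizer[OF f(3) KB(1)] by simp
    moreover have "blinfun_apply (coad G (X, C) \<sigma>) (0, B) = blinfun_apply \<sigma> (0, B)"
      using \<sigma> \<sigma>' KB(2) by (simp add: Sigma_G_iff)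
    moreover have "(0, E) = (0, K) + (0 :: 'n, B)" by (simp add: KB(3))
    ultimately show ?thesis by (simp only: blinfun.add_right)
  qed
  show ?thesis
  proof (rule blinfun_eqI)
    fix V :: "'n \<times> 'h"
    have V: "V = (fst V, 0) + (0, snd V)" by (simp add: prod_eq_iff)
    have "restrict_n (coad G (X, C) \<sigma>) = restrict_n \<sigma>" using r' fixed hC
      by (simp add: f_def)
    then have "blinfun_apply (coad G (X, C) \<sigma>) (fst V, 0) = blinfun_apply \<sigma> (fst V, 0)"
      by (metis restrict_n_apply)
    then show "blinfun_apply (coad G (X, C) \<sigma>) V = blinfun_apply \<sigma> V"
      using hE[of "snd V"] by (subst (1 2) V) (simp only: blinfun.add_right)
  qed
qed

lemma Sigma_cross_section: "orbit_cross_section (coad_orbit G) (Omega_nu N Z e j) \<Sigma>"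
  unfolding orbit_cross_section_def
proof (intro conjI ballI)
  show "\<Sigma> \<subseteq> Omega_nu N Z e j" by (auto simp: Sigma_G_def)
  fix l :: "('n \<times> 'h) \<Rightarrow>\<^sub>L real" assume "l \<in> Omega_nu N Z e j"
  then obtain \<sigma> where \<sigma>: "\<sigma> \<in> \<Sigma>" "\<sigma> \<in> coad_orbit G l"
    using Sigma_meets_orbit by blast
  show "\<exists>!\<sigma>. \<sigma> \<in> \<Sigma> \<and> \<sigma> \<in> coad_orbit G l"
  proof (rule ex1I[of _ \<sigma>])
    fix \<sigma>' assume \<sigma>': "\<sigma>' \<in> \<Sigma> \<and> \<sigma>' \<in> coad_orbit G l"
    obtain g g' where g: "\<sigma> = coad G g l" "\<sigma>' = coad G g' l" using \<sigma> \<sigma>'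
      by (auto simp: coad_orbit_G)
    have "g' \<otimes>\<^bsub>G\<^esub> inv\<^bsub>G\<^esub> g \<otimes>\<^bsub>G\<^esub> g = g'"
      by (metis G.m_assoc G.l_inv G.r_one G.inv_closed UNIV_I carrier_G)
    then have "coad G (g' \<otimes>\<^bsub>G\<^esub> inv\<^bsub>G\<^esub> g) \<sigma> = \<sigma>'"
      by (simp only: g coad_G_mult[symmetric])
    then show "\<sigma>' = \<sigma>" using Sigma_unique[OF \<sigma>(1)] \<sigma>'
      by (metis prod.collapse)
  qed (use \<sigma> in blast)
qed

end

theorem proposition20:
  fixes N :: "'n::euclidean_space monoid"
    and \<eta> :: "'h::real_normed_vector \<Rightarrow> 'n \<Rightarrow> 'n"
    and Z :: "nat \<Rightarrow> 'n \<times> 'n"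
    and lam :: "nat \<Rightarrow> 'h \<Rightarrow> real" and \<alpha> :: "nat \<Rightarrow> real"
    and e j :: "nat set"
    and p r :: nat and A :: "nat \<Rightarrow> 'h" and s \<iota> :: "nat \<Rightarrow> nat"
  assumes "vector_lie_group N" and "exponential_coordinates N"
    and "nilpotent (lie N)" and "\<not> comm_group N"
    and "automorphism_vector_group N \<eta>"
    and "adaptable (semidirect N \<eta>) Z lam \<alpha>"
    and "basis_of_h p A"
    and "generic_jumps N Z e j"
    and "normalized_basis N \<eta> Z lam \<alpha> e j p A r s \<iota>"
  shows "orbit_cross_section (coad_orbit (semidirect N \<eta>)) (Omega_nu N Z e j)
           (Sigma_G N Z lam \<alpha> e j A r \<iota>) \<and>
         restrict_n ` Sigma_G N Z lam \<alpha> e j A r \<iota> = Sigma_circ N Z e j r \<iota>"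
proof -
  interpret normalized N \<eta> Z lam \<alpha> e j p r A s \<iota>
    by unfold_locales (use assms in auto)
  show ?thesis using Sigma_cross_section restrict_Sigma by blast
qed

end
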